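(* Let $\alpha$ be either a positive real number or $+\infty$. Let $S$ be an odometer whose associated supernatural number $\prod_{p\in\Pi}p^{k_p}$ satisfies the following property: there exists a prime number $p_\star$ such that $k_{p_\star}=+\infty$. Then there exists a Cantor minimal homeomorphism $T$ such that 1. $\mathrm{h}_{\mathrm{top}}(T)=\alpha$; 2. there exists a strong orbit equivalence between $S$ and $T$ which is $\varphi_m$-integrable for all integers $m\geq 0$, where $\varphi_m$ denotes the map $t\mapsto\frac{\log t}{\log^{(\circ m)}t}$ and $\log^{(\circ m)}$ is the composition $\log\circ\cdots\circ\log$ ($m$ times).
   Context: Odometers. For integers $q_n\geq 2$ ($n\ge 0$), the odometer on the Cantor space $X=\prod_{n\geq 0}\{0,\ldots,q_n-1\}$ (product topology) is the homeomorphism $S\colon X\to X$ given by addition of $(1,0,0,\ldots)$ with carry over to the right. It is minimal, and uniquely ergodic with invariant measure $\mu$ the product of the uniform measures. Its supernatural number is the formal product $\prod_{p\in\Pi}p^{k_p}$ over the set $\Pi$ of primes, with $k_p=\sum_{n\geq 0}\nu_p(q_n)\in\mathbb{N}\cup\{+\infty\}$, where $\nu_p$ is the $p$-adic valuation. A Cantor minimal homeomorphism is a homeomorphism of a Cantor set all of whose orbits are dense. $\mathrm{h}_{\mathrm{top}}$ is topological entropy. A strong orbit equivalence between Cantor minimal homeomorphisms $(X,S)$ and $(Y,T)$ is a homeomorphism $\Psi\colon X\to Y$ such that $S$ and $\Psi^{-1}T\Psi$ have the same orbits on all of $X$, and such that the cocycles $c_S\colon X\to\mathbb{Z}$, $c_T\colon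 Y\to\mathbb{Z}$, defined by $Sx=\Psi^{-1}T^{c_S(x)}\Psi(x)$ and $Ty=\Psi S^{c_T(y)}\Psi^{-1}(y)$, each have at most one point of discontinuity. For $\varphi\colon\mathbb{R}_+\to\mathbb{R}_+$ it is $\varphi$-integrable if $\int_X\varphi(|c_S|)\,d\mu<+\infty$ and $\int_Y\varphi(|c_T|)\,d\Psi_\star\mu<+\infty$, where $\mu$ is the unique $S$-invariant probability measure (then $\Psi_\star\mu$ is the unique $T$-invariant probability measure). Convention: $\log^{(\circ 0)}t=t$. The expression for $\varphi_m(t)$ is used for $t$ large enough (where $\log^{(\circ m)}t$ is defined and positive, and $\log t\ge0$); on the remaining bounded set of values of $t$, $\varphi_m$ is extended by arbitrary bounded non-negative values, which does not affect integrability. *)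

theory Defs
  imports "HOL-Analysis.Analysis" "HOL-Computational_Algebra.Primes"
begin

definition cantor_space :: "'a topology \<Rightarrow> bool" where
  "cantor_space X \<longleftrightarrow>
     X homeomorphic_space
       product_topology (\<lambda>_ :: nat. discrete_topology (UNIV :: bool set)) UNIV"

text \<open>Integer powers of a self-homeomorphism \<open>T\<close> of \<open>X\<close>; the inverse is the one on
  \<^term>\<open>topspace X\<close>, since \<open>T\<close> is unconstrained outside of it.\<close>

definition homeo_pow :: "'a topology \<Rightarrow> ('a \<Rightarrow> 'a) \<Rightarrow> int \<Rightarrow> 'a \<Rightarrow> 'a" where
  "homeo_pow X T k =
     (if 0 \<le> k then T ^^ nat k else inv_into (topspace X) T ^^ nat (- k))"

definition homeo_orbit :: "'a topology \<Rightarrow> ('a \<Rightarrow> 'a) \<Rightarrow> 'a \<Rightarrow> 'a set" where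
  "homeo_orbit X T x = range (\<lambda>k. homeo_pow X T k x)"

definition cantor_minimal :: "'a topology \<Rightarrow> ('a \<Rightarrow> 'a) \<Rightarrow> bool" where
  "cantor_minimal X T \<longleftrightarrow>
     cantor_space X \<and> homeomorphic_map X X T \<and>
     (\<forall>x\<in>topspace X. X closure_of homeo_orbit X T x = topspace X)"


subsection \<open>Odometers\<close>

definition odometer_space :: "(nat \<Rightarrow> nat) \<Rightarrow> (nat \<Rightarrow> nat) topology" where
  "odometer_space q = product_topology (\<lambda>n. discrete_topology {..<q n}) UNIV"

text \<open>\<open>carry q x n\<close> is the amount carried into position \<open>n\<close> in the addition
  \<open>x + (1, 0, 0, \<dots>)\<close>; the initial \<open>1\<close> is the summand \<open>(1, 0, 0, \<dots>)\<close> itself.\<close>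

primrec carry :: "(nat \<Rightarrow> nat) \<Rightarrow> (nat \<Rightarrow> nat) \<Rightarrow> nat \<Rightarrow> nat" where
  "carry q x 0 = 1"
| "carry q x (Suc n) = (x n + carry q x n) div q n"

definition odometer :: "(nat \<Rightarrow> nat) \<Rightarrow> (nat \<Rightarrow> nat) \<Rightarrow> (nat \<Rightarrow> nat)" where
  "odometer q x = (\<lambda>n. (x n + carry q x n) mod q n)"

text \<open>The unique invariant Borel probability measure of the odometer. The product
  \<open>\<sigma>\<close>-algebra is the Borel \<open>\<sigma>\<close>-algebra of \<^term>\<open>odometer_space q\<close>, because there
  are countably many finite factors.\<close>

definition odometer_measure :: "(nat \<Rightarrow> nat) \<Rightarrow> (nat \<Rightarrow> nat) measure" where
  "odometer_measure q = PiM UNIV (\<lambda>n. uniform_count_measure {..<q n})"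

text \<open>The exponent of the prime \<open>p\<close> in the supernatural number of the odometer.\<close>

definition supernatural_exponent :: "(nat \<Rightarrow> nat) \<Rightarrow> nat \<Rightarrow> enat" where
  "supernatural_exponent q p = (\<Sum>n. enat (multiplicity p (q n)))"


subsection \<open>Topological entropy\<close>

text \<open>Topological entropy by open covers (Adler, Konheim, McAndrew), with natural
  logarithms, for a continuous self-map of a compact space: \<open>subcover_number\<close> is then a
  minimum over a nonempty set, and the limit exists by subadditivity.\<close>

definition open_cover :: "'a topology \<Rightarrow> 'a set set \<Rightarrow> bool" where
  "open_cover X \<U> \<longleftrightarrow> (\<forall>U\<in>\<U>. openin X U) \<and> topspace X \<subseteq> \<Union>\<U>"

definition subcover_number :: "'a topology \<Rightarrow> 'a set set \<Rightarrow> nat" where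
  "subcover_number X \<U> =
     (LEAST N. \<exists>\<V>. \<V> \<subseteq> \<U> \<and> finite \<V> \<and> topspace X \<subseteq> \<Union>\<V> \<and> card \<V> = N)"

text \<open>The join of \<open>\<U>, T\<^sup>-\<^sup>1\<U>, \<dots>, T\<^sup>-\<^sup>(\<^sup>n\<^sup>-\<^sup>1\<^sup>)\<U>\<close>.\<close>

definition iterated_join ::
    "'a topology \<Rightarrow> ('a \<Rightarrow> 'a) \<Rightarrow> 'a set set \<Rightarrow> nat \<Rightarrow> 'a set set" where
  "iterated_join X T \<U> n =
     {{x \<in> topspace X. \<forall>i<n. (T ^^ i) x \<in> U i} | U. \<forall>i<n. U i \<in> \<U>}"

definition cover_entropy :: "'a topology \<Rightarrow> ('a \<Rightarrow> 'a) \<Rightarrow> 'a set set \<Rightarrow> ereal" where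
  "cover_entropy X T \<U> =
     lim (\<lambda>n. ereal (ln (real (subcover_number X (iterated_join X T \<U> n))) / real n))"

definition topological_entropy :: "'a topology \<Rightarrow> ('a \<Rightarrow> 'a) \<Rightarrow> ereal" where
  "topological_entropy X T = (SUP \<U> \<in> {\<U>. open_cover X \<U>}. cover_entropy X T \<U>)"


subsection \<open>Strong orbit equivalence\<close>

text \<open>The two cocycles are only used for aperiodic homeomorphisms with
  \<open>\<Psi>\<close>-corresponding orbits, where the integer \<open>k\<close> exists and is unique.\<close>

definition source_cocycle ::
    "'a topology \<Rightarrow> ('a \<Rightarrow> 'a) \<Rightarrow> 'b topology \<Rightarrow> ('b \<Rightarrow> 'b) \<Rightarrow> ('a \<Rightarrow> 'b) \<Rightarrow> 'a \<Rightarrow> int" where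
  "source_cocycle X S Y T \<Psi> x =
     (THE k. S x = inv_into (topspace X) \<Psi> (homeo_pow Y T k (\<Psi> x)))"

definition target_cocycle ::
    "'a topology \<Rightarrow> ('a \<Rightarrow> 'a) \<Rightarrow> 'b topology \<Rightarrow> ('b \<Rightarrow> 'b) \<Rightarrow> ('a \<Rightarrow> 'b) \<Rightarrow> 'b \<Rightarrow> int" where
  "target_cocycle X S Y T \<Psi> y =
     (THE k. T y = \<Psi> (homeo_pow X S k (inv_into (topspace X) \<Psi> y)))"

definition at_most_one_discontinuity :: "'a topology \<Rightarrow> ('a \<Rightarrow> int) \<Rightarrow> bool" where
  "at_most_one_discontinuity X c \<longleftrightarrow>
     (\<exists>p. \<forall>x\<in>topspace X. x \<noteq> p \<longrightarrow> topcontinuous_at X (discrete_topology UNIV) c x)"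

definition strong_orbit_equivalence ::
    "'a topology \<Rightarrow> ('a \<Rightarrow> 'a) \<Rightarrow> 'b topology \<Rightarrow> ('b \<Rightarrow> 'b) \<Rightarrow> ('a \<Rightarrow> 'b) \<Rightarrow> bool" where
  "strong_orbit_equivalence X S Y T \<Psi> \<longleftrightarrow>
     homeomorphic_map X Y \<Psi> \<and>
     (\<forall>x\<in>topspace X.
        homeo_orbit X S x = homeo_orbit X (inv_into (topspace X) \<Psi> \<circ> T \<circ> \<Psi>) x) \<and>
     at_most_one_discontinuity X (source_cocycle X S Y T \<Psi>) \<and>
     at_most_one_discontinuity Y (target_cocycle X S Y T \<Psi>)"

definition borel_of_topology :: "'a topology \<Rightarrow> 'a measure" where
  "borel_of_topology X = sigma (topspace X) {U. openin X U}"

text \<open>Here \<open>\<mu>\<close> is meant to be the unique \<open>S\<close>-invariant probability measure. For a strong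
  orbit equivalence, the integrands below are Borel measurable, having at most one point
  of discontinuity before \<open>\<phi>\<close> is applied to their integer values.\<close>

definition orbit_equivalence_integrable ::
    "(real \<Rightarrow> real) \<Rightarrow> 'a measure \<Rightarrow> 'a topology \<Rightarrow> ('a \<Rightarrow> 'a) \<Rightarrow>
     'b topology \<Rightarrow> ('b \<Rightarrow> 'b) \<Rightarrow> ('a \<Rightarrow> 'b) \<Rightarrow> bool" where
  "orbit_equivalence_integrable \<phi> \<mu> X S Y T \<Psi> \<longleftrightarrow>
     (\<integral>\<^sup>+ x. ennreal (\<phi> (real_of_int \<bar>source_cocycle X S Y T \<Psi> x\<bar>)) \<partial>\<mu>) < \<infinity> \<and>
     (\<integral>\<^sup>+ y. ennreal (\<phi> (real_of_int \<bar>target_cocycle X S Y T \<Psi> y\<bar>))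
        \<partial>distr \<mu> (borel_of_topology Y) \<Psi>) < \<infinity>"


subsection \<open>The functions \<open>\<phi>\<^sub>m\<close>\<close>

text \<open>The set of \<open>t\<close> for which the \<open>m\<close>-fold iterated logarithm is genuinely defined and
  positive, and \<open>ln t \<ge> 0\<close>. Positivity of the lower iterates keeps out the values that
  the total function \<^const>\<open>ln\<close> takes on nonpositive arguments.\<close>

definition phi_domain :: "nat \<Rightarrow> real set" where
  "phi_domain m = {t. (\<forall>j\<le>m. 0 < (ln ^^ j) t) \<and> 0 \<le> ln t}"

text \<open>\<open>is_phi m \<phi>\<close> says that \<open>\<phi>\<close> is \<open>t \<mapsto> ln t / ln\<^sup>(\<^sup>m\<^sup>) t\<close>, extended to the
  nonnegative reals by arbitrary bounded nonnegative values.\<close>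

definition is_phi :: "nat \<Rightarrow> (real \<Rightarrow> real) \<Rightarrow> bool" where
  "is_phi m \<phi> \<longleftrightarrow>
     (\<forall>t\<in>phi_domain m. \<phi> t = ln t / (ln ^^ m) t) \<and>
     (\<forall>t\<ge>0. 0 \<le> \<phi> t) \<and>
     bounded (\<phi> ` ({0..} - phi_domain m))"

end

theory Submission
  imports Defs "HOL-Probability.Infinite_Product_Measure" "HOL-Real_Asymp.Real_Asymp"
begin

text \<open>
  The odometer on \<open>X = \<Prod>\<^sub>n {..<q n}\<close> finds the first digit \<open>x n\<close> that is not maximal,
  replaces it by its successor and all earlier digits by \<open>0\<close>. If "successor" is taken in
  an order of \<open>{..<q n}\<close> that depends on the next digit \<open>x (n + 1)\<close>, but always has first
  element \<open>0\<close> and last element \<open>q n - 1\<close>, the result \<open>T\<close> is again a minimal homeomorphism of \<open>X\<close>,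
  and it moves the same digits as the odometer. Hence \<open>T\<close> and the odometer are strongly
  orbit equivalent by the identity. Where \<open>n\<close> is the first non-maximal position the cocycles
  are bounded by \<open>h (n + 1)\<close>, with \<open>h n = q 0 \<cdots> q (n - 1)\<close>, and this happens
  with probability at most \<open>1 / h n\<close>.

  If \<open>(ln q\<^sub>n) / h\<^sub>n\<close> tends to \<open>\<alpha>\<close>, then \<open>h\<close> grows like an iterated exponential and
  \<open>\<Sum> \<phi>\<^sub>m (h\<^sub>n\<^sub>+\<^sub>1) / h\<^sub>n\<close> converges for all \<open>m\<close>. If moreover all \<open>(q n - 2)!\<close> orders occur,
  equally often up to a factor \<open>2\<close>, then the entropy of \<open>T\<close> is \<open>\<alpha>\<close>: blocks of length \<open>h (n + 1)\<close> are arranged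
  in at most \<open>(q n)!\<close> ways, and conversely the largest proportion \<open>\<rho>\<^sub>m\<close> of blocks of level \<open>m\<close>
  sharing a name satisfies \<open>\<rho>\<^sub>m\<^sub>+\<^sub>1 \<le> 2 (q\<^sub>m \<rho>\<^sub>m)^q\<^sub>m / (q\<^sub>m - 2)!\<close>, so that \<open>- ln \<rho>\<^sub>m / h\<^sub>m\<close>
  loses at most \<open>3 / h\<^sub>m\<close> at each step.

  An odometer depends only on its supernatural number up to conjugacy. So the digit sizes can be
  chosen anew: powers of the prime of infinite multiplicity give the growth, and the
  remaining factors are inserted as soon as they are small compared with \<open>exp (\<alpha> h n)\<close>.
\<close>

subsection \<open>Spaces of digit sequences\<close>

text \<open>The data form a Bratteli diagram: the vertices of level \<open>n\<close> are the values
  of digit \<open>n\<close>, consecutive levels are completely joined by single edges, and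
  \<open>s n v\<close> orders the edges into \<open>v\<close>. Every level-\<open>n\<close> tower
  has height \<open>h n\<close> whatever the orders are, so the orders carry all the entropy. There
  are \<open>q n\<close> towers of level \<open>n\<close>; if all their names differed, level
  \<open>n\<close> would show the entropy \<open>ln (q n) / h n\<close>. A common first and a common
  last digit make the minimal and the maximal sequence unique, which keeps the map continuous there.

  The integrability is critical. Since \<open>ln (h (n + 1)) / h n\<close> stays near \<alpha> when
  \<alpha> is finite, the majorising series for \<open>ln\<close> itself diverges. For
  \<open>m\<close> \<ge> 1 the divisor in \<open>\<phi>\<^sub>m\<close> is roughly
  \<open>h (n + 1 - m)\<close>, still of iterated exponential size, and this saves the series for
  every \<open>m\<close>. The same gain absorbs the linear growth of the rate
  \<open>A n = n + 1\<close> that produces infinite entropy.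

  Choosing a power of the prime \<open>p\<close> places \<open>q n\<close> within a factor
  \<open>p\<close> of \<open>exp (A n * h n)\<close>; the resulting error \<open>ln p / h n\<close>
  vanishes in the limit.\<close>

abbreviation agree :: "nat \<Rightarrow> (nat \<Rightarrow> 'a) \<Rightarrow> (nat \<Rightarrow> 'a) \<Rightarrow> bool" where
  "agree N x y \<equiv> \<forall>i<N. x i = y i"

abbreviation seq_space :: "(nat \<Rightarrow> 'a set) \<Rightarrow> (nat \<Rightarrow> 'a) topology" where
  "seq_space D \<equiv> product_topology (\<lambda>n. discrete_topology (D n)) UNIV"

text \<open>A basic open box constrains finitely many coordinates, so a long enough prefix forces
  membership. Every later topological claim is thereby reduced to prefixes.\<close>

lemma openin_seq_space:
  "openin (seq_space D) U \<longleftrightarrow>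
    U \<subseteq> {x. \<forall>n. x n \<in> D n} \<and>
    (\<forall>x\<in>U. \<exists>N. \<forall>y. (\<forall>n. y n \<in> D n) \<longrightarrow> agree N y x \<longrightarrow> y \<in> U)" (is "?L \<longleftrightarrow> ?R")
proof
  assume L: ?L
  have sub: "U \<subseteq> {x. \<forall>n. x n \<in> D n}"
    using openin_subset[OF L] by (auto simp: PiE_iff)
  show ?R
  proof (intro conjI sub ballI)
    fix x assume x: "x \<in> U"
    then obtain V where V: "finite {i. V i \<noteq> D i}" "\<And>i. V i \<subseteq> D i"
        "x \<in> Pi\<^sub>E UNIV V" "Pi\<^sub>E UNIV V \<subseteq> U"
      using L unfolding openin_product_topology_alt by fastforce
    obtain N where N: "\<And>i. V i \<noteq> D i \<Longrightarrow> i < N"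
      using V(1) unfolding finite_nat_set_iff_bounded by blast
    have "y \<in> U" if y: "\<forall>n. y n \<in> D n" "agree N y x" for y
    proof -
      have "y i \<in> V i" for i
        using V(3) y N[of i] by (cases "V i = D i") (auto simp: PiE_iff)
      then show ?thesis using V(4) by auto
    qed
    then show "\<exists>N. \<forall>y. (\<forall>n. y n \<in> D n) \<longrightarrow> agree N y x \<longrightarrow> y \<in> U" by blast
  qed
next
  assume R: ?R
  show ?L
    unfolding openin_product_topology_alt
  proof
    fix x assume x: "x \<in> U"
    then obtain N where N: "\<And>y. (\<forall>n. y n \<in> D n) \<Longrightarrow> agree N y x \<Longrightarrow> y \<in> U"
      using R by blast
    have xD: "x n \<in> D n" for n using R x by auto
    define V where "V = (\<lambda>i. if i < N then {x i} else D i)"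
    have Vx: "V i = {x i}" if "i < N" for i using that by (simp add: V_def)
    have VD: "V i = D i" if "\<not> i < N" for i using that by (simp add: V_def)
    have 1: "{i \<in> UNIV. V i \<noteq> D i} \<subseteq> {..<N}" using VD by blast
    then have 1: "finite {i \<in> UNIV. V i \<noteq> D i}" by (rule finite_subset) simp
    have 2: "V i \<subseteq> D i" for i using Vx VD xD by (cases "i < N") simp_all
    have "x i \<in> V i" for i using Vx VD xD by (cases "i < N") simp_all
    then have 3: "x \<in> Pi\<^sub>E UNIV V" by (simp add: PiE_iff)
    have 4: "Pi\<^sub>E UNIV V \<subseteq> U"
    proof
      fix y assume "y \<in> Pi\<^sub>E UNIV V"
      then have y: "y i \<in> V i" for i by (simp add: PiE_iff)
      show "y \<in> U"
      proof (rule N; intro allI impI)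
        show "y n \<in> D n" for n using y 2 by blast
        show "y i = x i" if "i < N" for i using y[of i] Vx[OF that] by simp
      qed
    qed
    show "\<exists>V. finite {i \<in> UNIV. V i \<noteq> topspace (discrete_topology (D i))} \<and>
         (\<forall>i\<in>UNIV. openin (discrete_topology (D i)) (V i)) \<and>
         x \<in> Pi\<^sub>E UNIV V \<and> Pi\<^sub>E UNIV V \<subseteq> U"
      unfolding openin_discrete_topology topspace_discrete_topology
      using 1 2 3 4 by (intro exI[of _ V] conjI ballI)
  qed
qed

lemma topspace_seq_space: "topspace (seq_space D) = {x. \<forall>n. x n \<in> D n}"
  by (auto simp: PiE_iff)

lemma continuous_map_seq_space:
  assumes f: "\<And>x. (\<forall>n. x n \<in> D n) \<Longrightarrow> (\<forall>n. f x n \<in> E n)"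
    and cont: "\<And>x N. (\<forall>n. x n \<in> D n) \<Longrightarrow>
       \<exists>M. \<forall>y. (\<forall>n. y n \<in> D n) \<longrightarrow> agree M y x \<longrightarrow> agree N (f y) (f x)"
  shows "continuous_map (seq_space D) (seq_space E) f"
  unfolding continuous_map
proof (intro conjI allI impI)
  show "f ` topspace (seq_space D) \<subseteq> topspace (seq_space E)"
    using f unfolding topspace_seq_space by blast
  fix U assume U: "openin (seq_space E) U"
  show "openin (seq_space D) {x \<in> topspace (seq_space D). f x \<in> U}"
    unfolding openin_seq_space topspace_seq_space
  proof (intro conjI ballI, blast)
    fix x assume x: "x \<in> {x \<in> {x. \<forall>n. x n \<in> D n}. f x \<in> U}"
    then obtain N where N: "\<And>y. (\<forall>n. y n \<in> E n) \<Longrightarrow> agree N y (f x) \<Longrightarrow> y \<in> U"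
      using U unfolding openin_seq_space by blast
    obtain M where "\<And>y. (\<forall>n. y n \<in> D n) \<Longrightarrow> agree M y x \<Longrightarrow> agree N (f y) (f x)"
      using cont[of x N] x by blast
    then have "\<forall>y. (\<forall>n. y n \<in> D n) \<longrightarrow> agree M y x \<longrightarrow> y \<in> {x \<in> {x. \<forall>n. x n \<in> D n}. f x \<in> U}"
      using N f by simp
    then show "\<exists>N. \<forall>y. (\<forall>n. y n \<in> D n) \<longrightarrow> agree N y x \<longrightarrow> y \<in> {x \<in> {x. \<forall>n. x n \<in> D n}. f x \<in> U}" ..
  qed
qed

lemma compact_seq_space:
  assumes "\<And>n. finite (D n)" shows "compact_space (seq_space D)"
  using assms by (simp add: compact_space_product_topology compact_space_discrete_topology)

lemma Hausdorff_seq_space: "Hausdorff_space (seq_space D)"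
  by (simp add: Hausdorff_space_product_topology)

definition dseqs :: "(nat \<Rightarrow> nat) \<Rightarrow> (nat \<Rightarrow> nat) set" where
  "dseqs q = {x. \<forall>n. x n < q n}"

lemma topspace_odometer: "topspace (odometer_space q) = dseqs q"
  by (auto simp: odometer_space_def dseqs_def PiE_iff)

lemma openin_odometer:
  "openin (odometer_space q) U \<longleftrightarrow>
    U \<subseteq> dseqs q \<and> (\<forall>x\<in>U. \<exists>N. \<forall>y\<in>dseqs q. agree N y x \<longrightarrow> y \<in> U)"
  unfolding odometer_space_def openin_seq_space dseqs_def by auto

lemma compact_odometer: "compact_space (odometer_space q)"
  unfolding odometer_space_def by (rule compact_seq_space) simp

text \<open>A continuous bijection from a compact space to a Hausdorff space is a homeomorphism, so
  continuity of the inverse never has to be checked.\<close>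

lemma homeomorphic_map_seq_space:
  assumes "bij_betw f (dseqs q) {y. \<forall>n. y n \<in> E n}"
    and cont: "\<And>x N. x \<in> dseqs q \<Longrightarrow> \<exists>M. \<forall>y\<in>dseqs q. agree M y x \<longrightarrow> agree N (f y) (f x)"
  shows "homeomorphic_map (odometer_space q) (seq_space E) f"
proof (rule continuous_imp_homeomorphic_map)
  show "continuous_map (odometer_space q) (seq_space E) f"
    unfolding odometer_space_def
  proof (rule continuous_map_seq_space)
    show "\<forall>n. f x n \<in> E n" if "\<forall>n. x n \<in> {..<q n}" for x
      using assms(1) that unfolding bij_betw_def dseqs_def by auto
    show "\<exists>M. \<forall>y. (\<forall>n. y n \<in> {..<q n}) \<longrightarrow> agree M y x \<longrightarrow> agree N (f y) (f x)"
      if "\<forall>n. x n \<in> {..<q n}" for x N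
      using cont[of x N] that unfolding dseqs_def by auto
  qed
  show "f ` topspace (odometer_space q) = topspace (seq_space E)"
    using assms(1) unfolding topspace_odometer topspace_seq_space bij_betw_def by blast
  show "inj_on f (topspace (odometer_space q))"
    using assms(1) unfolding topspace_odometer bij_betw_def by blast
qed (use compact_odometer Hausdorff_seq_space in auto)

lemma homeomorphic_map_odometer:
  assumes "bij_betw f (dseqs q) (dseqs q')"
    and "\<And>x N. x \<in> dseqs q \<Longrightarrow> \<exists>M. \<forall>y\<in>dseqs q. agree M y x \<longrightarrow> agree N (f y) (f x)"
  shows "homeomorphic_map (odometer_space q) (odometer_space q') f"
  unfolding odometer_space_def[of q']
  by (rule homeomorphic_map_seq_space) (use assms in \<open>auto simp: dseqs_def\<close>)

lemma topcontinuous_at_odometer: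
  assumes "x \<in> dseqs q" "\<forall>y\<in>dseqs q. agree N y x \<longrightarrow> c y = c x"
  shows "topcontinuous_at (odometer_space q) (discrete_topology UNIV) c x"
  unfolding topcontinuous_at_def topspace_odometer
proof (intro conjI allI impI)
  fix V assume V: "openin (discrete_topology UNIV) V \<and> c x \<in> V"
  let ?U = "{y\<in>dseqs q. agree N y x}"
  have "openin (odometer_space q) ?U"
    unfolding openin_odometer by (intro conjI ballI exI[of _ N]) auto
  moreover have "x \<in> ?U" using assms(1) by simp
  moreover have "c y \<in> V" if "y \<in> ?U" for y
  proof -
    have "c y = c x" using assms(2) that by blast
    then show ?thesis using V by simp
  qed
  ultimately show "\<exists>U. openin (odometer_space q) U \<and> x \<in> U \<and> (\<forall>y\<in>U. c y \<in> V)"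
    by blast
qed (use assms(1) in simp_all)

subsection \<open>Cantor spaces\<close>

text \<open>The digit \<open>u < q\<close> is encoded by the complete prefix code
  \<open>1\<^sup>u0\<close> for \<open>u < q - 1\<close> and \<open>1\<^sup>u\<close> for \<open>u = q - 1\<close>.\<close>

definition code_length :: "nat \<Rightarrow> nat \<Rightarrow> nat" where
  "code_length b u = (if u < b - 1 then Suc u else u)"

definition decode_digit :: "nat \<Rightarrow> (nat \<Rightarrow> bool) \<Rightarrow> nat \<Rightarrow> nat" where
  "decode_digit b w k = (LEAST u. u \<ge> b - 1 \<or> \<not> w (k + u))"

definition code_start :: "(nat \<Rightarrow> nat) \<Rightarrow> (nat \<Rightarrow> nat) \<Rightarrow> nat \<Rightarrow> nat" where
  "code_start q x n = (\<Sum>i<n. code_length (q i) (x i))"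

definition encode_seq :: "(nat \<Rightarrow> nat) \<Rightarrow> (nat \<Rightarrow> nat) \<Rightarrow> nat \<Rightarrow> bool" where
  "encode_seq q x k \<longleftrightarrow> (\<exists>n. code_start q x n \<le> k \<and> k < code_start q x n + x n)"

lemma code_length_pos: "2 \<le> b \<Longrightarrow> u < b \<Longrightarrow> 0 < code_length b u"
  by (auto simp: code_length_def)

lemma code_start_Suc: "code_start q x (Suc n) = code_start q x n + code_length (q n) (x n)"
  by (simp add: code_start_def)

lemma code_start_strict_mono:
  assumes "\<And>n. 2 \<le> q n" "x \<in> dseqs q"
  shows "strict_mono (code_start q x)"
  by (rule strict_monoI_Suc)
     (use assms code_length_pos in \<open>auto simp: code_start_Suc dseqs_def\<close>)

text \<open>The code words occupy consecutive disjoint intervals. A position inside word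
  \<open>n\<close> can therefore lie in the run of ones of no other word.\<close>

lemma encode_seq_at:
  assumes q: "\<And>n. 2 \<le> q n" and x: "x \<in> dseqs q" and j: "j < code_length (q n) (x n)"
  shows "encode_seq q x (code_start q x n + j) \<longleftrightarrow> j < x n"
proof
  note sm = code_start_strict_mono[OF q x]
  assume "encode_seq q x (code_start q x n + j)"
  then obtain m where m: "code_start q x m \<le> code_start q x n + j"
      "code_start q x n + j < code_start q x m + x m"
    unfolding encode_seq_def by blast
  have le: "x m \<le> code_length (q m) (x m)" by (simp add: code_length_def)
  have "code_start q x m < code_start q x (Suc n)"
    using m(1) j by (simp add: code_start_Suc)
  then have "m \<le> n" using sm by (simp add: strict_mono_less)
  moreover have "code_start q x n < code_start q x (Suc m)"
    using m(2) le by (simp add: code_start_Suc)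
  then have "n \<le> m" using sm by (simp add: strict_mono_less)
  ultimately show "j < x n" using m(2) by simp
qed (auto simp: encode_seq_def intro!: exI[of _ n])

lemma decode_digit_encode_seq:
  assumes q: "\<And>n. 2 \<le> q n" and x: "x \<in> dseqs q"
  shows "decode_digit (q n) (encode_seq q x) (code_start q x n) = x n"
  unfolding decode_digit_def
proof (rule Least_equality)
  have xn: "x n < q n" using x by (simp add: dseqs_def)
  show "x n \<ge> q n - 1 \<or> \<not> encode_seq q x (code_start q x n + x n)"
    using encode_seq_at[OF q x, of "x n" n] by (cases "x n < q n - 1") (auto simp: code_length_def)
  fix u assume u: "u \<ge> q n - 1 \<or> \<not> encode_seq q x (code_start q x n + u)"
  show "x n \<le> u"
  proof (rule ccontr)
    assume "\<not> x n \<le> u"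
    then have "u < x n" "u < code_length (q n) (x n)" by (auto simp: code_length_def)
    then show False using encode_seq_at[OF q x, of u n] u xn by auto
  qed
qed

lemma encode_seq_surj:
  assumes q: "\<And>n. 2 \<le> q n"
  shows "\<exists>x\<in>dseqs q. encode_seq q x = w"
proof -
  \<comment> \<open>Greedy parsing of \<open>w\<close>: \<open>p n\<close> is the place where word
    \<open>n\<close> starts. Since the prefix code is complete, the parse never gets stuck, and
    since no word is empty, it exhausts \<open>w\<close>.\<close>
  define p where "p = rec_nat 0 (\<lambda>n k. k + code_length (q n) (decode_digit (q n) w k))"
  define x where "x = (\<lambda>n. decode_digit (q n) w (p n))"
  have p: "p 0 = 0" "p (Suc n) = p n + code_length (q n) (x n)" for n
    by (simp_all add: p_def x_def)
  have ps: "p n = code_start q x n" for n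
    by (induction n) (simp_all add: p code_start_Suc, simp add: code_start_def)
  have D: "x n \<ge> q n - 1 \<or> \<not> w (p n + x n)" for n
    unfolding x_def decode_digit_def by (rule LeastI[of _ "q n - 1"]) simp
  have D2: "\<not> (u \<ge> q n - 1 \<or> \<not> w (p n + u))" if "u < x n" for n u
    using that unfolding x_def decode_digit_def by (rule not_less_Least)
  have xd: "x n < q n" for n
  proof -
    have "x n \<le> q n - 1"
      unfolding x_def decode_digit_def by (rule Least_le) simp
    then show ?thesis using q[of n] by linarith
  qed
  then have xq: "x \<in> dseqs q" by (simp add: dseqs_def)
  have "encode_seq q x k = w k" for k
  proof -
    have sm: "strict_mono (code_start q x)" by (rule code_start_strict_mono[OF q xq])
    define n where "n = (GREATEST n. code_start q x n \<le> k)"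
    have bnd: "n \<le> k" if "code_start q x n \<le> k" for n
      using that strict_mono_imp_increasing[OF sm, of n] by linarith
    have "code_start q x 0 \<le> k" by (simp add: code_start_def)
    then have n1: "code_start q x n \<le> k"
      using GreatestI_nat[of "\<lambda>n. code_start q x n \<le> k" 0 k] bnd unfolding n_def by blast
    have n2: "k < code_start q x (Suc n)"
    proof (rule ccontr)
      assume "\<not> ?thesis"
      then have "code_start q x (Suc n) \<le> k" by (rule leI)
      then have "Suc n \<le> n"
        unfolding n_def using Greatest_le_nat[of "\<lambda>n. code_start q x n \<le> k" "Suc n" k] bnd n_def by blast
      then show False by (rule Suc_n_not_le_n[THEN notE])
    qed
    define j where "j = k - code_start q x n"
    have k: "k = code_start q x n + j" using n1 by (simp add: j_def)
    have j: "j < code_length (q n) (x n)" using n2 k by (simp add: code_start_Suc)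
    have "encode_seq q x k \<longleftrightarrow> j < x n" unfolding k by (rule encode_seq_at[OF q xq j])
    also have "\<dots> \<longleftrightarrow> w k"
    proof (cases "j < x n")
      case True then show ?thesis using D2[OF True] ps k by simp
    next
      case False
      then have "j = x n" "x n < q n - 1" using j by (auto simp: code_length_def split: if_splits)
      then show ?thesis using D[of n] ps k by simp
    qed
    finally show ?thesis .
  qed
  then show ?thesis using xq by blast
qed

lemma cantor_space_odometer:
  assumes q: "\<And>n. 2 \<le> q n"
  shows "cantor_space (odometer_space q)"
proof -
  have inj: "inj_on (encode_seq q) (dseqs q)"
  proof (rule inj_onI)
    fix x y assume x: "x \<in> dseqs q" and y: "y \<in> dseqs q" and e: "encode_seq q x = encode_seq q y"
    have "code_start q x n = code_start q y n \<and> agree n x y" for n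
    proof (induction n)
      case (Suc n)
      have "x n = y n"
        using decode_digit_encode_seq[OF q x, of n] decode_digit_encode_seq[OF q y, of n] e Suc by metis
      then show ?case using Suc by (auto simp: code_start_Suc less_Suc_eq)
    qed (simp add: code_start_def)
    then show "x = y" by blast
  qed
  have "homeomorphic_map (odometer_space q) (seq_space (\<lambda>_. UNIV)) (encode_seq q)"
  proof (rule homeomorphic_map_seq_space)
    show "bij_betw (encode_seq q) (dseqs q) {y. \<forall>n. y n \<in> UNIV}"
      unfolding bij_betw_def
    proof (intro conjI inj)
      have "w \<in> encode_seq q ` dseqs q" for w
        using encode_seq_surj[of q w, OF q] by blast
      then show "encode_seq q ` dseqs q = {y. \<forall>n. y n \<in> UNIV}" by auto
    qed
    fix x N assume x: "x \<in> dseqs q"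
    have "agree N (encode_seq q y) (encode_seq q x)" if y: "y \<in> dseqs q" and a: "agree N y x" for y
    proof (intro allI impI)
      fix k assume k: "k < N"
      have *: "code_start q y n = code_start q x n" if "n \<le> N" for n
        unfolding code_start_def using a that by (intro sum.cong) auto
      \<comment> \<open>No word is empty, so word \<open>n\<close> starts at position
        \<open>n\<close> or later. Only words with index below \<open>N\<close> reach the positions
        below \<open>N\<close>.\<close>
      have b: "n < N" if "code_start q z n \<le> k" "z \<in> dseqs q" for n z
        using that strict_mono_imp_increasing[OF code_start_strict_mono[OF q that(2)], of n] k by linarith
      show "encode_seq q y k = encode_seq q x k"
        unfolding encode_seq_def using * a b[OF _ x] b[OF _ y] by (metis less_imp_le)
    qed
    then show "\<exists>M. \<forall>y\<in>dseqs q. agree M y x \<longrightarrow> agree N (encode_seq q y) (encode_seq q x)" by blast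
  qed
  then show ?thesis
    unfolding cantor_space_def by (metis homeomorphic_map_imp_homeomorphic_space)
qed

subsection \<open>Vershik maps on sequence spaces\<close>

definition place :: "(nat \<Rightarrow> nat) \<Rightarrow> nat \<Rightarrow> nat" where
  "place q n = (\<Prod>i<n. q i)"

definition top_seq :: "(nat \<Rightarrow> nat) \<Rightarrow> nat \<Rightarrow> nat" where
  "top_seq q n = q n - 1"

text \<open>The height of \<open>x\<close> in its level-\<open>n\<close> tower: the mixed radix
  number whose digits are the ranks of the \<open>x i\<close> in their orders. The rank of
  \<open>x (n - 1)\<close> consults \<open>x n\<close>, so the value depends on \<open>n + 1\<close>
  digits and not only on \<open>n\<close>.\<close>

definition pos :: "(nat \<Rightarrow> nat) \<Rightarrow> (nat \<Rightarrow> nat \<Rightarrow> nat \<Rightarrow> nat) \<Rightarrow> nat \<Rightarrow> (nat \<Rightarrow> nat) \<Rightarrow> nat" where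
  "pos q s n x = (\<Sum>i<n. inv (s i (x (Suc i))) (x i) * place q i)"

text \<open>\<open>s n v r\<close> is the digit of rank \<open>r\<close> in the order prescribed by
  the next digit \<open>v\<close>, and \<open>inv (s n v)\<close> gives the rank. This is the
  Vershik map of an ordered Bratteli diagram, with paths recorded by their vertices.\<close>

definition vershik :: "(nat \<Rightarrow> nat) \<Rightarrow> (nat \<Rightarrow> nat \<Rightarrow> nat \<Rightarrow> nat) \<Rightarrow> (nat \<Rightarrow> nat) \<Rightarrow> (nat \<Rightarrow> nat)" where
  "vershik q s x =
    (if x = top_seq q then (\<lambda>_. 0)
     else let n = (LEAST n. x n \<noteq> top_seq q n) in
       (\<lambda>i. if i < n then 0
             else if i = n then s n (x (Suc n)) (Suc (inv (s n (x (Suc n))) (x n)))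
             else x i))"

lemma place_0 [simp]: "place q 0 = 1" and place_Suc: "place q (Suc n) = q n * place q n"
  by (simp_all add: place_def)

lemma mixed_radix_less: "\<lbrakk>p < P; r < (b::nat)\<rbrakk> \<Longrightarrow> p + r * P < b * P"
proof -
  assume "p < P" "r < b"
  then have "p + r * P < Suc r * P" by simp
  also have "\<dots> \<le> b * P" using \<open>r < b\<close> by (intro mult_right_mono) simp_all
  finally show ?thesis .
qed

lemma mixed_radix_inj:
  assumes "p < P" "p' < (P::nat)" "p + r * P = p' + r' * P"
  shows "p = p'" "r = r'"
proof -
  have "(p + r * P) mod P = (p' + r' * P) mod P" using assms(3) by simp
  then show "p = p'" using assms(1,2) by simp
  then show "r = r'" using assms by simp
qed

text \<open>Permuting only the inner digits keeps \<open>0\<close> first and \<open>q n - 1\<close>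
  last in every order. Whether a digit is maximal then does not depend on the digit after
  it.\<close>

locale ordered_odometer =
  fixes q :: "nat \<Rightarrow> nat" and s :: "nat \<Rightarrow> nat \<Rightarrow> nat \<Rightarrow> nat"
  assumes q2: "2 \<le> q n"
    and s_permutes: "s n v permutes {1..<q n - 1}"
begin

abbreviation T where "T \<equiv> vershik q s"
abbreviation h where "h \<equiv> place q"
abbreviation rank where "rank n v u \<equiv> inv (s n v) u"
abbreviation P where "P \<equiv> pos q s"

lemma place_pos: "0 < h n"
proof -
  have "0 < q i" for i using q2[of i] by linarith
  then show ?thesis unfolding place_def by (intro prod_pos)
qed

lemma place_ge_power: "2 ^ n \<le> h n"
proof (induction n)
  case (Suc n)
  then show ?case using mult_le_mono[OF q2[of n] Suc] by (simp add: place_Suc)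
qed simp

lemma top_seq_dseqs: "top_seq q \<in> dseqs q"
proof -
  have "q n - 1 < q n" for n using q2[of n] by simp
  then show ?thesis by (simp add: dseqs_def top_seq_def)
qed

lemma rank_permutes: "inv (s n v) permutes {1..<q n - 1}"
  by (rule permutes_inv[OF s_permutes])

lemma s_zero [simp]: "s n v 0 = 0" and s_top [simp]: "s n v (q n - 1) = q n - 1"
  and rank_zero [simp]: "rank n v 0 = 0" and rank_top [simp]: "rank n v (q n - 1) = q n - 1"
  by (rule permutes_not_in[OF s_permutes] permutes_not_in[OF rank_permutes]; simp)+

lemma rank_top' [simp]: "rank n v (q n - Suc 0) = q n - Suc 0"
  using rank_top by simp

lemma s_rank [simp]: "s n v (rank n v u) = u" and rank_s [simp]: "rank n v (s n v u) = u"
  by (simp_all add: permutes_inverses[OF s_permutes])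

lemma permutes_less:
  assumes "\<pi> permutes {1..<q n - 1}" "u < q n" shows "\<pi> u < q n"
proof (cases "u \<in> {1..<q n - 1}")
  case True
  then have "\<pi> u \<in> {1..<q n - 1}" using permutes_in_image[OF assms(1)] by simp
  then show ?thesis by auto
next
  case False
  then show ?thesis using permutes_not_in[OF assms(1)] assms(2) by simp
qed

lemma s_less: "u < q n \<Longrightarrow> s n v u < q n" and rank_less: "u < q n \<Longrightarrow> rank n v u < q n"
  by (rule permutes_less[OF s_permutes] permutes_less[OF rank_permutes]; assumption)+

lemma rank_eq_iff: "rank n v u = rank n v u' \<longleftrightarrow> u = u'"
  by (metis s_rank)

lemma rank_less_top: "u < q n \<Longrightarrow> u \<noteq> q n - 1 \<Longrightarrow> Suc (rank n v u) < q n"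
  using rank_less[of u n v] rank_eq_iff[of n v u "q n - 1"] rank_top[of n v] by linarith

lemma pos_Suc: "P (Suc n) x = P n x + rank n (x (Suc n)) (x n) * h n"
  by (simp add: pos_def)

lemma pos_0 [simp]: "P 0 x = 0"
  by (simp add: pos_def)

lemma pos_less: "x \<in> dseqs q \<Longrightarrow> P n x < h n"
proof (induction n)
  case (Suc n)
  then have "x n < q n" by (simp add: dseqs_def)
  then show ?case
    unfolding pos_Suc place_Suc using Suc by (intro mixed_radix_less rank_less) simp_all
qed simp

lemma pos_zero: "agree n x (\<lambda>_. 0) \<Longrightarrow> P n x = 0"
  by (simp add: pos_def)

lemma pos_top: "agree n x (top_seq q) \<Longrightarrow> Suc (P n x) = h n"
proof (induction n)
  case (Suc n)
  then have "x n = q n - 1" by (simp add: top_seq_def)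
  then have "Suc (P (Suc n) x) = h n + (q n - 1) * h n"
    using Suc by (simp add: pos_Suc)
  also have "\<dots> = h (Suc n)" using q2[of n] by (cases "q n") (simp_all add: place_Suc)
  finally show ?case .
qed simp

lemma pos_cong:
  assumes "agree (Suc n) x y" shows "P n x = P n y"
  unfolding pos_def using assms by (intro sum.cong) simp_all

text \<open>Digits are recovered from the top downwards: the order at index \<open>n - 1\<close>
  turns the leading rank into \<open>x (n - 1)\<close>, which in turn fixes the order at index
  \<open>n - 2\<close>, and so on. The premise asks for equal orders, not equal digits
  \<open>x n\<close>, so that it can be applied when only the permutation is known.\<close>

lemma pos_inj:
  assumes "x \<in> dseqs q" "y \<in> dseqs q"
  shows "P n x = P n y \<Longrightarrow> (0 < n \<Longrightarrow> s (n - 1) (x n) = s (n - 1) (y n)) \<Longrightarrow> agree n x y"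
proof (induction n)
  case (Suc n)
  have e: "s n (x (Suc n)) = s n (y (Suc n))" using Suc.prems(2) by simp
  note * = mixed_radix_inj[OF pos_less[OF assms(1)] pos_less[OF assms(2)]
      Suc.prems(1)[unfolded pos_Suc]]
  have "x n = y n" using *(2) e rank_eq_iff[of n "x (Suc n)"] by simp
  moreover from this have "agree n x y" using *(1) by (intro Suc.IH) simp_all
  ultimately show ?case by (simp add: less_Suc_eq)
qed simp

lemma pos_eq_top:
  assumes x: "x \<in> dseqs q" and p: "Suc (P n x) = h n" shows "agree n x (top_seq q)"
proof -
  define y where "y = (\<lambda>i. if i < n then top_seq q i else x i)"
  have y: "y \<in> dseqs q" using x top_seq_dseqs by (simp add: y_def dseqs_def)
  have "Suc (P n y) = h n" by (rule pos_top) (simp add: y_def)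
  then have "agree n x y" using p by (intro pos_inj[OF x y]) (simp_all add: y_def)
  then show ?thesis by (simp add: y_def)
qed

lemma vershik_top: "T (top_seq q) = (\<lambda>_. 0)"
  by (simp add: vershik_def)

lemma vershik_step:
  assumes "agree n x (top_seq q)" "x n \<noteq> top_seq q n"
  shows "T x = (\<lambda>i. if i < n then 0
             else if i = n then s n (x (Suc n)) (Suc (rank n (x (Suc n)) (x n))) else x i)"
proof -
  have "(LEAST n. x n \<noteq> top_seq q n) = n"
    using assms by (intro Least_equality) (auto simp: not_less[symmetric])
  then show ?thesis using assms(2) by (auto simp: vershik_def Let_def)
qed

lemma first_nontop:
  assumes "x \<noteq> top_seq q"
  obtains n where "agree n x (top_seq q)" "x n \<noteq> top_seq q n"
proof -
  define n where "n = (LEAST n. x n \<noteq> top_seq q n)"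
  have "\<exists>n. x n \<noteq> top_seq q n" using assms by blast
  then have "x n \<noteq> top_seq q n" unfolding n_def by (rule LeastI_ex)
  moreover have "agree n x (top_seq q)" unfolding n_def using not_less_Least by blast
  ultimately show ?thesis using that by blast
qed

lemma vershik_dseqs: "x \<in> dseqs q \<Longrightarrow> T x \<in> dseqs q"
proof (cases "x = top_seq q")
  case True
  have "0 < q n" for n using q2[of n] by simp
  then show ?thesis using True by (simp add: vershik_top dseqs_def)
next
  case False
  assume x: "x \<in> dseqs q"
  obtain n where n: "agree n x (top_seq q)" "x n \<noteq> top_seq q n" using first_nontop[OF False] .
  have "s n (x (Suc n)) (Suc (rank n (x (Suc n)) (x n))) < q n"
    using x n by (intro s_less rank_less_top) (auto simp: dseqs_def top_seq_def)
  moreover have "0 < q i" "x i < q i" for i using q2[of i] x by (simp_all add: dseqs_def)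
  ultimately show ?thesis unfolding vershik_step[OF n] by (auto simp: dseqs_def)
qed

lemma vershik_funpow_dseqs: "x \<in> dseqs q \<Longrightarrow> (T ^^ j) x \<in> dseqs q"
  by (induction j) (simp_all add: vershik_dseqs)

lemma vershik_wrap: "agree n x (top_seq q) \<Longrightarrow> agree n (T x) (\<lambda>_. 0)"
proof (cases "x = top_seq q")
  case False
  assume a: "agree n x (top_seq q)"
  obtain m where m: "agree m x (top_seq q)" "x m \<noteq> top_seq q m" using first_nontop[OF False] .
  then have "n \<le> m" using a by (meson not_less)
  then show ?thesis unfolding vershik_step[OF m] by simp
qed (simp add: vershik_top)

lemma vershik_tail:
  assumes "agree n x (top_seq q)" "x n \<noteq> top_seq q n" "n < i"
  shows "T x i = x i"
  unfolding vershik_step[OF assms(1,2)] using assms(3) by simp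

text \<open>At the carry index \<open>m\<close> the part below \<open>m\<close> drops from
  \<open>h m - 1\<close> to \<open>0\<close> while the rank at \<open>m\<close>, worth
  \<open>h m\<close>, rises by one. All later digits stay, and with them the orders and ranks at
  later indices.\<close>

lemma pos_vershik:
  assumes x: "x \<in> dseqs q" and p: "Suc (P n x) < h n"
  shows "P n (T x) = Suc (P n x)" "\<forall>i\<ge>n. T x i = x i"
proof -
  have na: "\<not> agree n x (top_seq q)" using p pos_top by fastforce
  then obtain m where m: "agree m x (top_seq q)" "x m \<noteq> top_seq q m"
    using first_nontop[of x] by blast
  have mn: "m < n" using na m(1) by (meson leI order_less_le_trans)
  show "\<forall>i\<ge>n. T x i = x i" using mn vershik_tail[OF m] by simp
  have "P (Suc m) (T x) = Suc (P (Suc m) x)"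
  proof -
    have "P m (T x) = 0" using vershik_wrap[OF m(1)] by (rule pos_zero)
    moreover have "rank m (T x (Suc m)) (T x m) = Suc (rank m (x (Suc m)) (x m))"
      unfolding vershik_step[OF m] by simp
    moreover have "Suc (P m x) = h m" using m(1) by (rule pos_top)
    ultimately show ?thesis by (simp add: pos_Suc)
  qed
  moreover have "P k (T x) = Suc (P k x)" if "Suc m \<le> k" "P (Suc m) (T x) = Suc (P (Suc m) x)" for k
    using that
  proof (induction k rule: dec_induct)
    case (step k)
    then show ?case using vershik_tail[OF m] by (simp add: pos_Suc)
  qed simp
  ultimately show "P n (T x) = Suc (P n x)" using mn by simp
qed

lemma pos_vershik_funpow:
  assumes x: "x \<in> dseqs q"
  shows "P n x + j < h n \<Longrightarrow> P n ((T ^^ j) x) = P n x + j \<and> (\<forall>i\<ge>n. (T ^^ j) x i = x i)"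
proof (induction j)
  case (Suc j)
  then have IH: "P n ((T ^^ j) x) = P n x + j" "\<forall>i\<ge>n. (T ^^ j) x i = x i" by simp_all
  have "Suc (P n ((T ^^ j) x)) < h n" using IH Suc.prems by simp
  from pos_vershik[OF vershik_funpow_dseqs[OF x] this] show ?case using IH by simp
qed simp

text \<open>For any choice of orders, \<open>P n\<close> is a factor map onto the rotation of the
  integers modulo \<open>h n\<close>. This yields aperiodicity and locates the block boundaries in
  the entropy estimates.\<close>

lemma pos_vershik_mod:
  assumes x: "x \<in> dseqs q" shows "P n (T x) = Suc (P n x) mod h n"
proof (cases "Suc (P n x) = h n")
  case True
  then have "P n (T x) = 0" by (intro pos_zero vershik_wrap pos_eq_top[OF x])
  then show ?thesis using True by simp
next
  case False
  then have "Suc (P n x) < h n" using pos_less[OF x, of n] by simp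
  then show ?thesis using pos_vershik(1)[OF x] by simp
qed

lemma pos_vershik_funpow_mod:
  assumes x: "x \<in> dseqs q" shows "P n ((T ^^ j) x) = (P n x + j) mod h n"
proof (induction j)
  case 0 show ?case using pos_less[OF x] by simp
next
  case (Suc j)
  then show ?case using pos_vershik_mod[OF vershik_funpow_dseqs[OF x], of n j] by (simp add: mod_Suc_eq)
qed

lemma vershik_reach:
  assumes x: "x \<in> dseqs q" and y: "y \<in> dseqs q" and t: "\<forall>i\<ge>n. x i = y i" and le: "P n x \<le> P n y"
  shows "(T ^^ (P n y - P n x)) x = y"
proof -
  let ?z = "(T ^^ (P n y - P n x)) x"
  have "P n x + (P n y - P n x) < h n" using le pos_less[OF y] by simp
  from pos_vershik_funpow[OF x this]
  have z: "P n ?z = P n y" "\<forall>i\<ge>n. ?z i = y i" using le t by auto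
  then have "agree n ?z y" by (intro pos_inj vershik_funpow_dseqs x y) auto
  then have "?z i = y i" for i using z(2) by (cases "i < n") auto
  then show ?thesis by blast
qed

text \<open>The carry index can be read off the image: it is the first nonzero digit, because a rank
  that has just been increased is not the rank of \<open>0\<close>.\<close>

lemma vershik_inj: "inj_on T (dseqs q)"
proof (rule inj_onI)
  have nz: "T x n \<noteq> 0" if "x \<in> dseqs q" "agree n x (top_seq q)" "x n \<noteq> top_seq q n" for x n
  proof -
    have "rank n (x (Suc n)) (T x n) = Suc (rank n (x (Suc n)) (x n))"
      unfolding vershik_step[OF that(2,3)] by simp
    then show ?thesis by (metis Zero_not_Suc rank_zero)
  qed
  fix x y assume x: "x \<in> dseqs q" and y: "y \<in> dseqs q" and e: "T x = T y"
  have top: "z = top_seq q" if "z \<in> dseqs q" "T z = (\<lambda>_. 0)" for z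
    using first_nontop[of z] nz[OF that(1)] that(2) by metis
  show "x = y"
  proof (cases "x = top_seq q \<or> y = top_seq q")
    case True
    then show ?thesis using top x y e vershik_top by metis
  next
    case False
    obtain n where n: "agree n x (top_seq q)" "x n \<noteq> top_seq q n" using False first_nontop by metis
    obtain m where m: "agree m y (top_seq q)" "y m \<noteq> top_seq q m" using False first_nontop by metis
    have "n = m"
      using nz[OF x n] nz[OF y m] e vershik_wrap[OF n(1)] vershik_wrap[OF m(1)]
      by (metis linorder_neqE_nat)
    have t: "x i = y i" if "n < i" for i
      using vershik_tail[OF n that] vershik_tail[OF m, of i] that e \<open>n = m\<close> by simp
    have "s n (x (Suc n)) (Suc (rank n (x (Suc n)) (x n))) = s n (y (Suc n)) (Suc (rank n (y (Suc n)) (y n)))"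
      using fun_cong[OF e, of n] unfolding vershik_step[OF n] vershik_step[OF m] \<open>n = m\<close> by simp
    then have "x n = y n" using t[of "Suc n"] by (metis lessI nat.inject rank_eq_iff rank_s)
    moreover have "x i = y i" if "i < n" for i using n(1) m(1) that \<open>n = m\<close> by simp
    ultimately have "x i = y i" for i using t by (metis linorder_neqE_nat)
    then show ?thesis by blast
  qed
qed

lemma vershik_surj:
  assumes y: "y \<in> dseqs q" shows "\<exists>x\<in>dseqs q. T x = y"
proof (cases "y = (\<lambda>_. 0)")
  case True
  then show ?thesis using vershik_top top_seq_dseqs by blast
next
  case False
  define n where "n = (LEAST n. y n \<noteq> 0)"
  have "\<exists>n. y n \<noteq> 0" using False by blast
  then have n1: "y n \<noteq> 0" unfolding n_def by (rule LeastI_ex)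
  have n0: "y i = 0" if "i < n" for i using that not_less_Least unfolding n_def by blast
  define r where "r = rank n (y (Suc n)) (y n)"
  have r0: "r \<noteq> 0" using n1 rank_eq_iff[of n _ "y n" 0] by (simp add: r_def)
  have yq: "y i < q i" for i using y by (simp add: dseqs_def)
  have rq: "r < q n" unfolding r_def by (rule rank_less[OF yq])
  \<comment> \<open>Subtraction with borrow: the first nonzero digit of \<open>y\<close> goes down
    by one rank and the zeros before it become maximal digits.\<close>
  define x where "x = (\<lambda>i. if i < n then top_seq q i else if i = n then s n (y (Suc n)) (r - 1) else y i)"
  have "s n (y (Suc n)) (r - 1) < q n" using rq by (intro s_less) simp
  then have x: "x \<in> dseqs q"
    using yq top_seq_dseqs by (simp add: x_def dseqs_def)
  have "rank n (y (Suc n)) (x n) = r - 1" by (simp add: x_def)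
  then have "x n \<noteq> top_seq q n" using rank_top[of n "y (Suc n)"] r0 rq by (auto simp: top_seq_def)
  moreover have a: "agree n x (top_seq q)" by (simp add: x_def)
  ultimately have "T x = y"
    unfolding vershik_step[OF a \<open>x n \<noteq> top_seq q n\<close>]
    using n0 r0 by (intro ext) (simp add: x_def r_def)
  then show ?thesis using x by blast
qed

lemma vershik_bij: "bij_betw T (dseqs q) (dseqs q)"
  unfolding bij_betw_def
proof (intro conjI vershik_inj equalityI subsetI)
  show "y \<in> dseqs q" if "y \<in> T ` dseqs q" for y using that vershik_dseqs by auto
  show "y \<in> T ` dseqs q" if "y \<in> dseqs q" for y using vershik_surj[OF that] by blast
qed

text \<open>One extra digit is needed because the successor at index \<open>n\<close> consults digit
  \<open>n + 1\<close>. If the first \<open>N\<close> digits are maximal, both images begin with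
  \<open>N\<close> zeros regardless of the rest.\<close>

lemma vershik_local:
  assumes "agree (Suc N) y x" shows "agree N (T y) (T x)"
proof (cases "agree N x (top_seq q)")
  case True
  then have "agree N y (top_seq q)" using assms by simp
  then show ?thesis using vershik_wrap[of N] True by simp
next
  case False
  then obtain n where n: "agree n x (top_seq q)" "x n \<noteq> top_seq q n"
    using first_nontop[of x] by blast
  have nN: "n < N" using n False by (meson leI order_less_le_trans)
  have m: "agree n y (top_seq q)" "y n \<noteq> top_seq q n" using n assms nN by simp_all
  show ?thesis unfolding vershik_step[OF n] vershik_step[OF m] using assms nN by simp
qed

lemma vershik_homeomorphic: "homeomorphic_map (odometer_space q) (odometer_space q) T"
proof (rule homeomorphic_map_odometer[OF vershik_bij])
  show "\<exists>M. \<forall>y\<in>dseqs q. agree M y x \<longrightarrow> agree N (T y) (T x)" for x N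
    using vershik_local[of N _ x] by blast
qed

section \<open>Integer powers, aperiodicity and minimality\<close>

abbreviation Z where "Z \<equiv> homeo_pow (odometer_space q) T"

lemma Z_nat: "Z (int j) x = (T ^^ j) x"
  by (simp add: homeo_pow_def)

lemma vershik_inv_funpow:
  assumes "x \<in> dseqs q"
  shows "(inv_into (dseqs q) T ^^ j) x \<in> dseqs q" "(T ^^ j) ((inv_into (dseqs q) T ^^ j) x) = x"
proof -
  have *: "inv_into (dseqs q) T y \<in> dseqs q" "T (inv_into (dseqs q) T y) = y" if "y \<in> dseqs q" for y
    using that bij_betw_inv_into_right[OF vershik_bij] vershik_bij
    by (auto simp: bij_betw_def inv_into_into)
  have "(inv_into (dseqs q) T ^^ j) x \<in> dseqs q \<and> (T ^^ j) ((inv_into (dseqs q) T ^^ j) x) = x"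
  proof (induction j)
    case (Suc j)
    then show ?case using * unfolding funpow_Suc_right[of j T] by simp
  qed (simp add: assms)
  then show "(inv_into (dseqs q) T ^^ j) x \<in> dseqs q" "(T ^^ j) ((inv_into (dseqs q) T ^^ j) x) = x"
    by auto
qed

lemma Z_neg:
  assumes "x \<in> dseqs q"
  shows "Z (- int j) x \<in> dseqs q" "(T ^^ j) (Z (- int j) x) = x"
proof -
  have "Z (- int j) x = (inv_into (dseqs q) T ^^ j) x"
    unfolding homeo_pow_def topspace_odometer by (cases "j = 0") simp_all
  then show "Z (- int j) x \<in> dseqs q" "(T ^^ j) (Z (- int j) x) = x"
    using vershik_inv_funpow[OF assms, of j] by metis+
qed

lemma Z_dseqs: "x \<in> dseqs q \<Longrightarrow> Z k x \<in> dseqs q"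
  using Z_neg(1)[of x] vershik_funpow_dseqs[of x] Z_nat by (metis int_cases2)

lemma vershik_funpow_inj: "inj_on (T ^^ j) (dseqs q)"
  using bij_betw_funpow[OF vershik_bij] by (simp add: bij_betw_def)

lemma Z_negI:
  assumes "x \<in> dseqs q" "(T ^^ j) x = y" shows "Z (- int j) y = x"
proof -
  have y: "y \<in> dseqs q" using assms vershik_funpow_dseqs by blast
  show ?thesis
    using inj_onD[OF vershik_funpow_inj[of j], of "Z (- int j) y" x] Z_neg[OF y, of j] assms by simp
qed

lemma Z_reach:
  assumes "x \<in> dseqs q" "y \<in> dseqs q" "\<forall>i\<ge>n. x i = y i"
  shows "Z (int (P n y) - int (P n x)) x = y"
proof (cases "P n x \<le> P n y")
  case True
  then have "int (P n y) - int (P n x) = int (P n y - P n x)" by simp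
  then show ?thesis using vershik_reach[OF assms True] Z_nat by metis
next
  case False
  then have "int (P n y) - int (P n x) = - int (P n x - P n y)" by simp
  moreover have "(T ^^ (P n x - P n y)) y = x"
    by (rule vershik_reach) (use assms False in auto)
  ultimately show ?thesis using Z_negI assms(2) by metis
qed

lemma pos_Z:
  assumes x: "x \<in> dseqs q" shows "int (P n (Z k x)) mod int (h n) = (int (P n x) + k) mod int (h n)"
proof (cases k rule: int_cases2)
  case (nonneg j)
  then show ?thesis using pos_vershik_funpow_mod[OF x, of n j] by (simp add: Z_nat zmod_int)
next
  case (nonpos j)
  let ?y = "Z k x"
  have y: "?y \<in> dseqs q" "(T ^^ j) ?y = x" using Z_neg[OF x, of j] nonpos by simp_all
  have "P n x = (P n ?y + j) mod h n" using pos_vershik_funpow_mod[OF y(1), of n j] y(2) by simp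
  then have "int (P n x) mod int (h n) = (int (P n ?y) + int j) mod int (h n)"
    by (simp add: zmod_int)
  then have "(int (P n x) - int j) mod int (h n) = (int (P n ?y) + int j - int j) mod int (h n)"
    by (rule mod_diff_cong) simp
  then show ?thesis using nonpos by simp
qed

text \<open>Equality of the two powers makes \<open>k - l\<close> divisible by every
  \<open>h n\<close>, and these numbers are unbounded. This aperiodicity is what makes the cocycles
  well defined.\<close>

lemma Z_inj:
  assumes x: "x \<in> dseqs q" and e: "Z k x = Z l x" shows "k = l"
proof -
  have d: "int (h n) dvd k - l" for n
  proof -
    have "(int (P n x) + k) mod int (h n) = (int (P n x) + l) mod int (h n)"
      using pos_Z[OF x, of n k] pos_Z[OF x, of n l] e by simp
    then show ?thesis by (simp add: mod_eq_dvd_iff)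
  qed
  let ?n = "nat \<bar>k - l\<bar>"
  have "?n < 2 ^ ?n" by (rule less_exp)
  also have "\<dots> \<le> h ?n" by (rule place_ge_power)
  finally have "\<bar>k - l\<bar> < int (h ?n)" by linarith
  then show ?thesis using d[of ?n] by (metis dvd_imp_le_int linorder_not_le eq_iff_diff_eq_0 abs_of_nat)
qed

lemma cantor_minimal_vershik: "cantor_minimal (odometer_space q) T"
  unfolding cantor_minimal_def
proof (intro conjI ballI)
  show "cantor_space (odometer_space q)" by (rule cantor_space_odometer[OF q2])
  show "homeomorphic_map (odometer_space q) (odometer_space q) T" by (rule vershik_homeomorphic)
  fix x assume "x \<in> topspace (odometer_space q)"
  then have x: "x \<in> dseqs q" by (simp add: topspace_odometer)
  show "odometer_space q closure_of homeo_orbit (odometer_space q) T x = topspace (odometer_space q)"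
  proof
    show "topspace (odometer_space q) \<subseteq> odometer_space q closure_of homeo_orbit (odometer_space q) T x"
    proof
      fix y assume y: "y \<in> topspace (odometer_space q)"
      show "y \<in> odometer_space q closure_of homeo_orbit (odometer_space q) T x"
        unfolding in_closure_of
      proof (intro conjI y allI impI)
        fix U assume U: "y \<in> U \<and> openin (odometer_space q) U"
        then obtain N where N: "\<And>z. z \<in> dseqs q \<Longrightarrow> agree N z y \<Longrightarrow> z \<in> U"
          unfolding openin_odometer by blast
        \<comment> \<open>The prefix of \<open>y\<close> places \<open>z\<close> in
          \<open>U\<close>, the tail of \<open>x\<close> places it in the orbit of
          \<open>x\<close>.\<close>
        define z where "z = (\<lambda>i. if i < N then y i else x i)"
        have z: "z \<in> dseqs q" using x y by (simp add: z_def topspace_odometer dseqs_def)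
        have "Z (int (P N z) - int (P N x)) x = z"
          by (rule Z_reach[OF x z]) (simp add: z_def)
        then have "z \<in> homeo_orbit (odometer_space q) T x"
          unfolding homeo_orbit_def by (metis rangeI)
        moreover have "z \<in> U" using N[OF z] by (simp add: z_def)
        ultimately show "\<exists>z. z \<in> homeo_orbit (odometer_space q) T x \<and> z \<in> U" by blast
      qed
    qed
  qed (rule closure_of_subset_topspace)
qed

end

section \<open>The odometer as a Vershik map\<close>

lemma ordered_odometer_id: "(\<And>n. 2 \<le> q n) \<Longrightarrow> ordered_odometer q (\<lambda>_ _. id)"
  by unfold_locales (simp_all add: permutes_id)

lemma carry_eq:
  assumes q: "\<And>n. 2 \<le> q n" and x: "x \<in> dseqs q"
  shows "carry q x n = (if agree n x (top_seq q) then 1 else 0)"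
proof (induction n)
  case (Suc n)
  have "x n < q n" using x by (simp add: dseqs_def)
  moreover have "(q n - 1 + 1) div q n = 1" using q[of n] by simp
  moreover have "(x n + 1) div q n = 0" if "x n \<noteq> q n - 1"
    using that \<open>x n < q n\<close> q[of n] by (intro div_less) linarith
  ultimately show ?case using Suc
    by (cases "x n = q n - 1") (auto simp: top_seq_def less_Suc_eq)
qed simp

text \<open>For identity orders the rank of a digit is the digit itself, so passing to the successor
  is addition of one with carry. All results on \<open>ordered_odometer\<close> thereby apply to the
  odometer.\<close>

lemma odometer_eq_vershik:
  assumes q: "\<And>n. 2 \<le> q n" and x: "x \<in> dseqs q"
  shows "odometer q x = vershik q (\<lambda>_ _. id) x"
proof
  interpret ordered_odometer q "\<lambda>_ _. id" by (rule ordered_odometer_id[OF q])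
  fix i
  have xi: "x i < q i" for i using x by (simp add: dseqs_def)
  have tp: "(top_seq q i + 1) mod q i = 0" for i using q[of i] by (simp add: top_seq_def)
  show "odometer q x i = T x i"
  proof (cases "x = top_seq q")
    case True
    then show ?thesis using tp carry_eq[OF q x, of i] by (simp add: odometer_def vershik_top)
  next
    case False
    then obtain n where n: "agree n x (top_seq q)" "x n \<noteq> top_seq q n" using first_nontop by metis
    have a: "agree i x (top_seq q) \<longleftrightarrow> i \<le> n" using n by (metis leI less_le_trans)
    have "Suc (x n) < q n" using xi[of n] n(2) by (simp add: top_seq_def)
    moreover have "x i = top_seq q i" if "i < n" using n(1) that by simp
    ultimately show ?thesis
      unfolding vershik_step[OF n] odometer_def carry_eq[OF q x] a using tp[of i] xi[of i]
      by (cases i n rule: linorder_cases) (simp_all add: inv_id)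
  qed
qed

subsection \<open>Conjugacy of odometers\<close>

text \<open>Both maps have the same carry index \<open>n\<close> and leave the digits beyond
  \<open>n\<close> alone, so \<open>vershik q s'\<close> moves a point within its
  level-\<open>n + 1\<close> tower for \<open>s\<close>. The exponent is the difference of the two
  heights in that tower, hence the bound; heights at level \<open>n + 1\<close> depend on
  \<open>n + 2\<close> digits, hence the length of the cylinder on which \<open>k\<close> is
  constant.\<close>

lemma vershik_crossing:
  assumes "ordered_odometer q s" "ordered_odometer q s'"
    and x: "x \<in> dseqs q" and n: "agree n x (top_seq q)" "x n \<noteq> top_seq q n"
  obtains k where "\<bar>k\<bar> < int (place q (Suc n))"
    "\<forall>y\<in>dseqs q. agree (n + 2) y x \<longrightarrow>
       vershik q s' y = homeo_pow (odometer_space q) (vershik q s) k y"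
proof -
  interpret A: ordered_odometer q s by fact
  interpret B: ordered_odometer q s' by fact
  define k where "k = int (A.P (Suc n) (B.T x)) - int (A.P (Suc n) x)"
  have "\<bar>k\<bar> < int (place q (Suc n))"
    using A.pos_less[OF x, of "Suc n"] A.pos_less[OF B.vershik_dseqs[OF x], of "Suc n"]
    unfolding k_def by linarith
  moreover have "B.T y = A.Z k y" if y: "y \<in> dseqs q" and a: "agree (n + 2) y x" for y
  proof -
    have m: "agree n y (top_seq q)" "y n \<noteq> top_seq q n" using n a by simp_all
    have t: "\<forall>i\<ge>Suc n. y i = B.T y i" using B.vershik_tail[OF m] by simp
    have tx: "B.T x (Suc n) = x (Suc n)" using B.vershik_tail[OF n] by simp
    have "agree (Suc n) (B.T y) (B.T x)" using B.vershik_local[of "Suc n" y x] a by simp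
    moreover have "B.T y (Suc n) = y (Suc n)" "y (Suc n) = x (Suc n)" using B.vershik_tail[OF m] a by simp_all
    then have "B.T y (Suc n) = B.T x (Suc n)" using tx by simp
    ultimately have "agree (Suc (Suc n)) (B.T y) (B.T x)" by (simp add: less_Suc_eq)
    then have "A.P (Suc n) (B.T y) = A.P (Suc n) (B.T x)" by (rule A.pos_cong)
    moreover have "A.P (Suc n) y = A.P (Suc n) x" by (rule A.pos_cong) (use a in simp)
    ultimately have "k = int (A.P (Suc n) (B.T y)) - int (A.P (Suc n) y)" by (simp add: k_def)
    then show ?thesis using A.Z_reach[OF y B.vershik_dseqs[OF y] t] by simp
  qed
  ultimately show ?thesis using that by blast
qed

text \<open>The maximal sequence has no carry index, but both maps send it to zero. It is the one
  point at which the cocycles may be discontinuous.\<close>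

lemma vershik_crossing_top:
  assumes "ordered_odometer q s" "ordered_odometer q s'"
  shows "vershik q s' (top_seq q) = homeo_pow (odometer_space q) (vershik q s) 1 (top_seq q)"
  using ordered_odometer.vershik_top[OF assms(1)] ordered_odometer.vershik_top[OF assms(2)]
  by (simp add: homeo_pow_def)

section \<open>Changing the base of an odometer\<close>

definition val :: "(nat \<Rightarrow> nat) \<Rightarrow> nat \<Rightarrow> (nat \<Rightarrow> nat) \<Rightarrow> nat" where
  "val q n x = (\<Sum>i<n. x i * place q i)"

text \<open>The residue modulo \<open>d\<close> of the profinite integer with digits
  \<open>x\<close>. Any \<open>n\<close> with \<open>d dvd place q n\<close> gives the same value,
  as \<open>residue_eq\<close> shows; \<open>LEAST\<close> merely picks one.\<close>

definition residue :: "(nat \<Rightarrow> nat) \<Rightarrow> nat \<Rightarrow> (nat \<Rightarrow> nat) \<Rightarrow> nat" where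
  "residue q d x = val q (LEAST n. d dvd place q n) x mod d"

text \<open>The digits in base \<open>q'\<close> of the profinite integer whose digits in base
  \<open>q\<close> are \<open>x\<close>.\<close>

definition transfer_seq :: "(nat \<Rightarrow> nat) \<Rightarrow> (nat \<Rightarrow> nat) \<Rightarrow> (nat \<Rightarrow> nat) \<Rightarrow> (nat \<Rightarrow> nat)" where
  "transfer_seq q q' x n = residue q (place q' (Suc n)) x div place q' n"

lemma pos_id: "pos q (\<lambda>_ _. id) = val q"
  by (intro ext) (simp add: pos_def val_def inv_id)

lemma val_Suc: "val q (Suc n) x = val q n x + x n * place q n"
  by (simp add: val_def)

lemma val_less: "(\<And>n. 2 \<le> q n) \<Longrightarrow> x \<in> dseqs q \<Longrightarrow> val q n x < place q n"
  using ordered_odometer.pos_less[OF ordered_odometer_id] by (metis pos_id)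

lemma val_inj:
  assumes q: "\<And>n. 2 \<le> q n" and x: "x \<in> dseqs q" "y \<in> dseqs q" and e: "val q n x = val q n y"
  shows "agree n x y"
  using ordered_odometer.pos_inj[OF ordered_odometer_id[OF q] x, unfolded pos_id, OF e] by simp

lemma val_cong: "agree n x y \<Longrightarrow> val q n x = val q n y"
  unfolding val_def by (intro sum.cong) simp_all

lemma place_dvd: "m \<le> n \<Longrightarrow> place q m dvd place q n"
  by (induction n rule: dec_induct) (simp_all add: place_Suc)

lemma val_mod:
  assumes q: "\<And>n. 2 \<le> q n" and x: "x \<in> dseqs q" and "m \<le> n"
  shows "val q n x mod place q m = val q m x"
  using assms(3)
proof (induction n rule: dec_induct)
  case base
  show ?case using val_less[OF q x] by simp
next
  case (step n)
  have "place q m dvd x n * place q n" using place_dvd[OF step(1), of q] by simp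
  then show ?case using step by (metis mod_add_self2 val_Suc dvd_imp_mod_0 mod_add_right_eq add_0_right)
qed

lemma residue_eq:
  assumes q: "\<And>n. 2 \<le> q n" and x: "x \<in> dseqs q" and d: "d dvd place q n"
  shows "residue q d x = val q n x mod d"
proof -
  define m where "m = (LEAST n. d dvd place q n)"
  have m: "d dvd place q m" "m \<le> n" unfolding m_def using d by (auto intro: LeastI Least_le)
  have "val q n x mod d = val q n x mod place q m mod d" using m(1) by (simp add: mod_mod_cancel)
  also have "\<dots> = val q m x mod d" using val_mod[OF q x m(2)] by simp
  finally show ?thesis by (simp add: residue_def m_def)
qed

lemma residue_place: "(\<And>n. 2 \<le> q n) \<Longrightarrow> x \<in> dseqs q \<Longrightarrow> residue q (place q n) x = val q n x"
  using residue_eq[of q x "place q n" n] val_less[of q x n] by simp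

lemma residue_mod:
  assumes q: "\<And>n. 2 \<le> q n" and x: "x \<in> dseqs q" and d: "d dvd place q n" and e: "e dvd d"
  shows "residue q d x mod e = residue q e x"
  using residue_eq[OF q x d] residue_eq[OF q x dvd_trans[OF e d]] e by (simp add: mod_mod_cancel)

lemma residue_odometer:
  assumes q: "\<And>n. 2 \<le> q n" and x: "x \<in> dseqs q" and d: "d dvd place q n"
  shows "residue q d (odometer q x) = Suc (residue q d x) mod d"
proof -
  interpret ordered_odometer q "\<lambda>_ _. id" by (rule ordered_odometer_id[OF q])
  have "residue q d (odometer q x) = val q n (T x) mod d"
    using residue_eq[OF q vershik_dseqs[OF x] d] odometer_eq_vershik[OF q x] by simp
  also have "\<dots> = Suc (val q n x) mod place q n mod d"
    using pos_vershik_mod[OF x, of n] by (simp add: pos_id)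
  also have "\<dots> = Suc (val q n x) mod d" using d by (simp add: mod_mod_cancel)
  finally show ?thesis by (simp add: residue_eq[OF q x d] mod_Suc_eq)
qed

text \<open>Divisibility in this direction says that the supernatural number of \<open>q'\<close>
  divides that of \<open>q\<close>, which gives a factor map from base \<open>q\<close> to base
  \<open>q'\<close>. A conjugacy arises when the locale also holds with the roles exchanged.\<close>

locale odometer_pair =
  fixes q q' :: "nat \<Rightarrow> nat"
  assumes q2: "\<And>n. 2 \<le> q n" and q2': "\<And>n. 2 \<le> q' n"
    and place_dvd_place: "\<exists>N. place q' n dvd place q N"
begin

abbreviation \<Phi> where "\<Phi> \<equiv> transfer_seq q q'"

text \<open>The quotient digits telescope: \<open>r mod P + (r div P) * P = r\<close>. As
  \<open>val\<close> determines the digits, all properties of \<Phi> reduce to comparing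
  residues.\<close>

lemma val_transfer:
  assumes x: "x \<in> dseqs q" shows "val q' n (\<Phi> x) = residue q (place q' n) x"
proof (induction n)
  case 0
  show ?case by (simp add: val_def residue_def)
next
  case (Suc n)
  obtain N where N: "place q' (Suc n) dvd place q N" using place_dvd_place by blast
  have "residue q (place q' n) x = residue q (place q' (Suc n)) x mod place q' n"
    by (rule residue_mod[symmetric, OF q2 x N]) (simp add: place_Suc)
  then show ?case by (simp add: val_Suc Suc transfer_seq_def[of q q' x n] mod_div_mult_eq)
qed

lemma transfer_dseqs:
  assumes x: "x \<in> dseqs q" shows "\<Phi> x \<in> dseqs q'"
proof -
  have "\<Phi> x n < q' n" for n
  proof -
    have "0 < place q' (Suc n)"
      by (rule ordered_odometer.place_pos[OF ordered_odometer_id[OF q2']])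
    then have "residue q (place q' (Suc n)) x < q' n * place q' n"
      unfolding residue_def place_Suc[symmetric] by simp
    then show ?thesis unfolding transfer_seq_def by (rule less_mult_imp_div_less)
  qed
  then show ?thesis by (simp add: dseqs_def)
qed

lemma transfer_odometer:
  assumes x: "x \<in> dseqs q" shows "\<Phi> (odometer q x) = odometer q' (\<Phi> x)"
proof -
  have sx: "odometer q x \<in> dseqs q"
    using ordered_odometer.vershik_dseqs[OF ordered_odometer_id[OF q2] x] odometer_eq_vershik[OF q2 x] by simp
  have y: "\<Phi> x \<in> dseqs q'" by (rule transfer_dseqs[OF x])
  have sy: "odometer q' (\<Phi> x) \<in> dseqs q'"
    using ordered_odometer.vershik_dseqs[OF ordered_odometer_id[OF q2'] y] odometer_eq_vershik[OF q2' y] by simp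
  have "agree n (\<Phi> (odometer q x)) (odometer q' (\<Phi> x))" for n
  proof (rule val_inj[OF q2' transfer_dseqs[OF sx] sy])
    obtain N where N: "place q' n dvd place q N" using place_dvd_place by blast
    have "val q' n (\<Phi> (odometer q x)) = Suc (residue q (place q' n) x) mod place q' n"
      using val_transfer[OF sx] residue_odometer[OF q2 x N] by simp
    also have "\<dots> = Suc (residue q' (place q' n) (\<Phi> x)) mod place q' n"
      using val_transfer[OF x] residue_place[OF q2' y] by simp
    also have "\<dots> = val q' n (odometer q' (\<Phi> x))"
      using residue_odometer[OF q2' y dvd_refl] residue_place[OF q2' sy] by simp
    finally show "val q' n (\<Phi> (odometer q x)) = val q' n (odometer q' (\<Phi> x))" .
  qed
  then show ?thesis by blast
qed

lemma transfer_local: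
  assumes "x \<in> dseqs q" shows "\<exists>M. \<forall>y\<in>dseqs q. agree M y x \<longrightarrow> agree n (\<Phi> y) (\<Phi> x)"
proof -
  obtain N where N: "place q' n dvd place q N" using place_dvd_place by blast
  have "agree n (\<Phi> y) (\<Phi> x)" if y: "y \<in> dseqs q" "agree N y x" for y
  proof (rule val_inj[OF q2' transfer_dseqs[OF y(1)] transfer_dseqs[OF assms]])
    show "val q' n (\<Phi> y) = val q' n (\<Phi> x)"
      unfolding val_transfer[OF y(1)] val_transfer[OF assms]
        residue_eq[OF q2 y(1) N] residue_eq[OF q2 assms N] val_cong[OF y(2)] ..
  qed
  then show ?thesis by blast
qed

end

lemma transfer_inverse:
  assumes "odometer_pair q q'" "odometer_pair q' q" and y: "y \<in> dseqs q'"
  shows "transfer_seq q q' (transfer_seq q' q y) = y"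
proof -
  interpret A: odometer_pair q q' by fact
  interpret B: odometer_pair q' q by fact
  have x: "B.\<Phi> y \<in> dseqs q" by (rule B.transfer_dseqs[OF y])
  have "agree n (A.\<Phi> (B.\<Phi> y)) y" for n
  proof (rule val_inj[OF A.q2' A.transfer_dseqs[OF x] y])
    obtain N where N: "place q' n dvd place q N" using A.place_dvd_place by blast
    obtain m where m: "place q N dvd place q' m" using B.place_dvd_place by blast
    have "val q' n (A.\<Phi> (B.\<Phi> y)) = val q N (B.\<Phi> y) mod place q' n"
      using A.val_transfer[OF x] residue_eq[OF A.q2 x N] by simp
    also have "\<dots> = residue q' (place q N) y mod place q' n"
      using B.val_transfer[OF y] by simp
    also have "\<dots> = residue q' (place q' n) y"
      by (rule residue_mod[OF A.q2' y m N])
    also have "\<dots> = val q' n y" by (rule residue_place[OF A.q2' y])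
    finally show "val q' n (A.\<Phi> (B.\<Phi> y)) = val q' n y" .
  qed
  then show ?thesis by blast
qed

lemma transfer_bij:
  assumes "odometer_pair q q'" "odometer_pair q' q"
  shows "bij_betw (transfer_seq q q') (dseqs q) (dseqs q')"
  by (rule bij_betw_byWitness[where f' = "transfer_seq q' q"])
     (use transfer_inverse assms odometer_pair.transfer_dseqs in \<open>auto simp: image_subset_iff\<close>)

lemma transfer_homeomorphic:
  assumes "odometer_pair q q'" "odometer_pair q' q"
  shows "homeomorphic_map (odometer_space q) (odometer_space q') (transfer_seq q q')"
  by (rule homeomorphic_map_odometer[OF transfer_bij[OF assms] odometer_pair.transfer_local[OF assms(1)]])

subsection \<open>Cylinders and the invariant measure\<close>

definition cyl :: "(nat \<Rightarrow> nat) \<Rightarrow> nat \<Rightarrow> (nat \<Rightarrow> nat) \<Rightarrow> (nat \<Rightarrow> nat) set" where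
  "cyl q N w = {x \<in> dseqs q. agree N x w}"

definition words :: "(nat \<Rightarrow> nat) \<Rightarrow> nat \<Rightarrow> (nat \<Rightarrow> nat) set" where
  "words q N = Pi\<^sub>E {..<N} (\<lambda>i. {..<q i})"

lemma finite_words: "finite (words q N)"
  unfolding words_def by (intro finite_PiE) simp_all

lemma restrict_words: "x \<in> dseqs q \<Longrightarrow> restrict x {..<N} \<in> words q N"
  by (auto simp: words_def dseqs_def)

lemma cyl_restrict: "x \<in> dseqs q \<Longrightarrow> x \<in> cyl q N (restrict x {..<N})"
  by (simp add: cyl_def)

lemma space_odometer_measure: "space (odometer_measure q) = dseqs q"
  by (auto simp: odometer_measure_def space_PiM dseqs_def PiE_iff space_uniform_count_measure)

lemma cyl_measure:
  assumes q: "\<And>n. 2 \<le> q n" and w: "w \<in> words q N"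
  shows "cyl q N w \<in> sets (odometer_measure q)"
    "emeasure (odometer_measure q) (cyl q N w) = ennreal (1 / real (place q N))"
proof -
  have q0: "{..<q n} \<noteq> {}" for n using q[of n] by (auto simp: lessThan_empty_iff)
  interpret product_prob_space "\<lambda>n. uniform_count_measure {..<q n}" UNIV
    unfolding product_prob_space_def product_prob_space_axioms_def product_sigma_finite_def
    using q0 by (auto intro!: prob_space_uniform_count_measure prob_space_imp_sigma_finite)
  have wq: "w i < q i" if "i < N" for i using w that by (auto simp: words_def PiE_iff)
  have e: "cyl q N w = {x \<in> space (odometer_measure q). \<forall>i\<in>{..<N}. x i \<in> {w i}}"
    unfolding cyl_def space_odometer_measure by auto
  have s: "{w i} \<in> sets (uniform_count_measure {..<q i})" if "i \<in> {..<N}" for i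
    using wq that by (simp add: sets_uniform_count_measure)
  show "cyl q N w \<in> sets (odometer_measure q)"
    unfolding e odometer_measure_def by (rule sets.sets_Collect_finite_All) (use s in \<open>auto intro!: sets_Collect_single\<close>)
  have "emeasure (odometer_measure q) (cyl q N w)
      = (\<Prod>i\<in>{..<N}. emeasure (uniform_count_measure {..<q i}) {w i})"
    unfolding e unfolding odometer_measure_def by (rule emeasure_PiM_Collect) (use s in auto)
  also have "\<dots> = (\<Prod>i\<in>{..<N}. ennreal (1 / real (q i)))"
  proof (rule prod.cong[OF refl])
    fix i assume "i \<in> {..<N}"
    then have "{w i} \<subseteq> {..<q i}" using wq by simp
    then show "emeasure (uniform_count_measure {..<q i}) {w i} = ennreal (1 / real (q i))"
      by (simp add: emeasure_uniform_count_measure)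
  qed
  also have "\<dots> = ennreal (\<Prod>i\<in>{..<N}. 1 / real (q i))" by (simp add: prod_ennreal)
  also have "(\<Prod>i\<in>{..<N}. 1 / real (q i)) = 1 / real (place q N)"
    by (simp add: place_def prod_dividef)
  finally show "emeasure (odometer_measure q) (cyl q N w) = ennreal (1 / real (place q N))" .
qed

lemma open_sets_odometer_measure:
  assumes q: "\<And>n. 2 \<le> q n" and U: "openin (odometer_space q) U"
  shows "U \<in> sets (odometer_measure q)"
proof -
  define I where "I = {(N, w). w \<in> words q N \<and> cyl q N w \<subseteq> U}"
  have "I \<subseteq> (SIGMA N:UNIV. words q N)" by (auto simp: I_def)
  moreover have "countable (SIGMA N:UNIV. words q N)"
    by (rule countable_SIGMA[OF _ countable_finite[OF finite_words]]) simp
  ultimately have cI: "countable I" by (rule countable_subset)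
  have "U = (\<Union>(N, w)\<in>I. cyl q N w)"
  proof
    show "U \<subseteq> (\<Union>(N, w)\<in>I. cyl q N w)"
    proof
      fix x assume x: "x \<in> U"
      then have xd: "x \<in> dseqs q" using U unfolding openin_odometer by blast
      obtain N where N: "\<And>y. y \<in> dseqs q \<Longrightarrow> agree N y x \<Longrightarrow> y \<in> U"
        using U x unfolding openin_odometer by blast
      have "cyl q N (restrict x {..<N}) \<subseteq> U"
      proof
        fix y assume "y \<in> cyl q N (restrict x {..<N})"
        then have "y \<in> dseqs q" "agree N y x" by (simp_all add: cyl_def)
        then show "y \<in> U" by (rule N)
      qed
      then have "(N, restrict x {..<N}) \<in> I" using restrict_words[OF xd] by (simp add: I_def)
      then show "x \<in> (\<Union>(N, w)\<in>I. cyl q N w)" using cyl_restrict[OF xd] by blast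
    qed
  qed (auto simp: I_def)
  moreover have "(\<Union>(N, w)\<in>I. cyl q N w) \<in> sets (odometer_measure q)"
    by (rule sets.countable_UN'[OF cI]) (auto simp: I_def intro: cyl_measure(1)[OF q])
  ultimately show ?thesis by simp
qed

text \<open>Write \<open>place q N = d * b\<close>. At most \<open>b\<close> words of length
  \<open>N\<close> have the given residue, and each of their cylinders has measure
  \<open>1 / (d * b)\<close>.\<close>

lemma emeasure_residue:
  assumes q: "\<And>n. 2 \<le> q n" and d: "d dvd place q N"
  shows "emeasure (odometer_measure q) {x \<in> dseqs q. residue q d x = c} \<le> ennreal (1 / real d)"
proof -
  let ?\<mu> = "odometer_measure q"
  define W where "W = {w \<in> words q N. val q N w mod d = c}"
  have W: "W \<subseteq> words q N" by (auto simp: W_def)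
  have fW: "finite W" by (rule finite_subset[OF W finite_words])
  have pN: "0 < place q N" by (rule ordered_odometer.place_pos[OF ordered_odometer_id[OF q]])
  obtain b where b: "place q N = d * b" using d by blast
  have d0: "0 < d" "0 < b" using pN b by auto
  have "card W \<le> card {..<b}"
  proof (rule card_inj_on_le[where f = "\<lambda>w. val q N w div d"])
    \<comment> \<open>Words are \<open>undefined\<close> from \<open>N\<close> on, whereas
      \<open>val_inj\<close> speaks of full sequences; hence the padding by zeros.\<close>
    let ?ext = "\<lambda>w i. if i < N then w i else 0 :: nat"
    have ext: "?ext w \<in> dseqs q" if "w \<in> words q N" for w
    proof -
      have "w i < q i" if "i < N" for i using \<open>w \<in> words q N\<close> that by (auto simp: words_def PiE_iff)
      moreover have "0 < q i" for i using q[of i] by simp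
      ultimately show ?thesis by (simp add: dseqs_def)
    qed
    have ve: "val q N (?ext w) = val q N w" for w by (rule val_cong) simp
    show "inj_on (\<lambda>w. val q N w div d) W"
    proof (rule inj_onI)
      fix v w assume v: "v \<in> W" and w: "w \<in> W" and e: "val q N v div d = val q N w div d"
      have vw: "v \<in> words q N" "w \<in> words q N" using v w W by auto
      have "val q N v = val q N w" using v w e unfolding W_def
        by (metis (mono_tags, lifting) mem_Collect_eq div_mult_mod_eq)
      then have "agree N (?ext v) (?ext w)" using val_inj[OF q ext[OF vw(1)] ext[OF vw(2)]] ve by metis
      then have "v i = w i" if "i \<in> {..<N}" for i using that by simp
      then show "v = w" using vw unfolding words_def by (intro PiE_ext) auto
    qed
    show "(\<lambda>w. val q N w div d) ` W \<subseteq> {..<b}"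
    proof (rule image_subsetI)
      fix w assume "w \<in> W"
      then have "val q N w < place q N" using val_less[OF q ext[of w], of N] ve W by auto
      then show "val q N w div d \<in> {..<b}" using b by (simp add: less_mult_imp_div_less mult.commute)
    qed
  qed simp
  then have cW: "card W \<le> b" by simp
  have sub: "{x \<in> dseqs q. residue q d x = c} \<subseteq> (\<Union>w\<in>W. cyl q N w)"
  proof
    fix x assume "x \<in> {x \<in> dseqs q. residue q d x = c}"
    then have x: "x \<in> dseqs q" "val q N x mod d = c" using residue_eq[OF q _ d] by auto
    have "val q N (restrict x {..<N}) = val q N x" by (rule val_cong) simp
    then have "restrict x {..<N} \<in> W" using x restrict_words by (simp add: W_def)
    then show "x \<in> (\<Union>w\<in>W. cyl q N w)" using cyl_restrict[OF x(1)] by blast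
  qed
  have "emeasure ?\<mu> {x \<in> dseqs q. residue q d x = c} \<le> emeasure ?\<mu> (\<Union>w\<in>W. cyl q N w)"
    by (rule emeasure_mono[OF sub] sets.finite_UN[OF fW] cyl_measure(1)[OF q])+ (use W in auto)
  also have "\<dots> \<le> (\<Sum>w\<in>W. emeasure ?\<mu> (cyl q N w))"
    by (rule emeasure_subadditive_finite) (use fW W cyl_measure(1)[OF q] in auto)
  also have "\<dots> = (\<Sum>w\<in>W. ennreal (1 / real (place q N)))"
    using W by (intro sum.cong refl cyl_measure(2)[OF q]) auto
  also have "\<dots> = ennreal (real (card W) * (1 / real (place q N)))"
    by (simp add: ennreal_of_nat_eq_real_of_nat ennreal_mult[symmetric])
  also have "\<dots> \<le> ennreal (1 / real d)"
  proof (rule ennreal_leI)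
    have "real (card W) * (1 / real (place q N)) \<le> real b * (1 / real (place q N))"
      using cW by (intro mult_right_mono) simp_all
    also have "\<dots> = 1 / real d" using b d0 by simp
    finally show "real (card W) * (1 / real (place q N)) \<le> 1 / real d" .
  qed
  finally show ?thesis .
qed

subsection \<open>Subadditivity of cover entropy\<close>

text \<open>Fekete's lemma: writing \<open>n = k * m + r\<close> with \<open>r < m\<close> shows
  that the limit is the infimum of the quotients. It makes the \<open>lim\<close> in
  \<open>cover_entropy\<close> a genuine limit, which may then be computed along
  subsequences.\<close>

lemma subadditive_convergent:
  fixes a :: "nat \<Rightarrow> real"
  assumes nonneg: "\<And>n. 0 \<le> a n" and sub: "\<And>m n. a (m + n) \<le> a m + a n"
  shows "convergent (\<lambda>n. a n / real n)"
proof -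
  define S where "S = (\<lambda>n. a n / real n) ` {1..}"
  define L where "L = Inf S"
  have bdd: "bdd_below S" unfolding S_def by (rule bdd_belowI[of _ 0]) (auto simp: nonneg)
  have ne: "S \<noteq> {}" unfolding S_def by auto
  have lower: "L \<le> a n / real n" if "1 \<le> n" for n
    unfolding L_def by (rule cInf_lower[OF _ bdd]) (use that in \<open>auto simp: S_def\<close>)
  have mult: "a (k * m + r) \<le> real k * a m + a r" for k m r
  proof (induction k)
    case (Suc k)
    have "a (Suc k * m + r) \<le> a m + a (k * m + r)" using sub[of m "k * m + r"] by (simp add: ac_simps)
    then show ?case using Suc by (simp add: algebra_simps)
  qed simp
  have "(\<lambda>n. a n / real n) \<longlonglongrightarrow> L"
  proof (rule LIMSEQ_I)
    fix e :: real assume e: "0 < e"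
    obtain m where m: "1 \<le> m" "a m / real m < L + e / 2"
    proof -
    have "Inf S < L + e / 2" using e by (simp add: L_def)
    then obtain t where "t \<in> S" "t < L + e / 2" using cInf_lessD[OF ne] by blast
    then show ?thesis using that unfolding S_def by auto
  qed
    define C where "C = (\<Sum>r<m. a r)"
    have C: "a r \<le> C" if "r < m" for r
      unfolding C_def using that by (intro member_le_sum) (auto simp: nonneg)
    obtain n0 where n0: "2 * C / e < real n0" using reals_Archimedean2 by blast
    have "norm (a n / real n - L) < e" if n: "max 1 n0 \<le> n" for n
    proof -
      have n1: "0 < real n" using n by simp
      have "a n \<le> real (n div m) * a m + a (n mod m)" using mult[of "n div m" m "n mod m"] by simp
      also have "\<dots> \<le> real n / real m * a m + C"
      proof (intro add_mono mult_right_mono nonneg)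
        show "real (n div m) \<le> real n / real m" by (rule of_nat_div_le_of_nat)
        show "a (n mod m) \<le> C" using m(1) by (intro C) simp
      qed
      finally have "a n / real n \<le> (real n / real m * a m + C) / real n"
        using n1 by (intro divide_right_mono) simp_all
      also have "\<dots> = a m / real m + C / real n" using n1 by (simp add: add_divide_distrib)
      also have "C / real n < e / 2"
      proof -
        have "2 * C / e < real n" using n0 n by simp
        then show ?thesis using e n1 by (simp add: field_simps)
      qed
      finally have "a n / real n < L + e" using m(2) by simp
      moreover have "L \<le> a n / real n" using lower n by simp
      ultimately show ?thesis by simp
    qed
    then show "\<exists>no. \<forall>n\<ge>no. norm (a n / real n - L) < e" by blast
  qed
  then show ?thesis by (rule convergentI)
qed

lemma subcover_number_le:
  assumes "W \<subseteq> \<U>" "finite W" "topspace X \<subseteq> \<Union>W" shows "subcover_number X \<U> \<le> card W"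
  unfolding subcover_number_def by (rule Least_le) (use assms in blast)

lemma subcover_number_witness:
  assumes "W \<subseteq> \<U>" "finite W" "topspace X \<subseteq> \<Union>W"
  obtains V where "V \<subseteq> \<U>" "finite V" "topspace X \<subseteq> \<Union>V" "card V = subcover_number X \<U>"
proof -
  have "\<exists>V. V \<subseteq> \<U> \<and> finite V \<and> topspace X \<subseteq> \<Union>V \<and> card V = subcover_number X \<U>"
    unfolding subcover_number_def by (rule LeastI) (use assms in blast)
  then show ?thesis using that by blast
qed

locale compact_system =
  fixes X :: "'a topology" and T :: "'a \<Rightarrow> 'a"
  assumes compact: "compact_space X" and continuous: "continuous_map X X T"
    and nonempty: "topspace X \<noteq> {}"
begin

lemma T_in: "x \<in> topspace X \<Longrightarrow> (T ^^ i) x \<in> topspace X"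
proof (induction i)
  case (Suc i)
  then show ?case using continuous_map_image_subset_topspace[OF continuous] by auto
qed simp

lemma continuous_funpow: "continuous_map X X (T ^^ i)"
proof (induction i)
  case (Suc i)
  then show ?case using continuous_map_compose[OF Suc continuous] by (simp add: o_def)
qed simp

lemma open_cover_join:
  assumes "open_cover X \<U>" shows "open_cover X (iterated_join X T \<U> n)"
  unfolding open_cover_def
proof (intro conjI ballI subsetI)
  fix V assume "V \<in> iterated_join X T \<U> n"
  then obtain U where U: "\<And>i. i < n \<Longrightarrow> U i \<in> \<U>" "V = {x \<in> topspace X. \<forall>i<n. (T ^^ i) x \<in> U i}"
    unfolding iterated_join_def by blast
  have "openin X {x \<in> topspace X. \<forall>i<k. (T ^^ i) x \<in> U i}" if "k \<le> n" for k
    using that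
  proof (induction k)
    case (Suc k)
    have "openin X (U k)" using U(1)[of k] Suc.prems assms by (simp add: open_cover_def)
    then have "openin X {x \<in> topspace X. (T ^^ k) x \<in> U k}"
      by (rule openin_continuous_map_preimage[OF continuous_funpow])
    moreover have "openin X {x \<in> topspace X. \<forall>i<k. (T ^^ i) x \<in> U i}" using Suc by simp
    ultimately have "openin X ({x \<in> topspace X. (T ^^ k) x \<in> U k} \<inter> {x \<in> topspace X. \<forall>i<k. (T ^^ i) x \<in> U i})"
      by (rule openin_Int)
    also have "{x \<in> topspace X. (T ^^ k) x \<in> U k} \<inter> {x \<in> topspace X. \<forall>i<k. (T ^^ i) x \<in> U i}
        = {x \<in> topspace X. \<forall>i<Suc k. (T ^^ i) x \<in> U i}" by (auto simp: less_Suc_eq)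
    finally show ?case .
  qed simp
  then show "openin X V" unfolding U(2) by simp
next
  fix x assume x: "x \<in> topspace X"
  have "\<exists>U. U \<in> \<U> \<and> (T ^^ i) x \<in> U" for i
    using assms T_in[OF x, of i] unfolding open_cover_def by (meson UnionE subsetD)
  then obtain U where "\<And>i. U i \<in> \<U> \<and> (T ^^ i) x \<in> U i" by metis
  then have "{x \<in> topspace X. \<forall>i<n. (T ^^ i) x \<in> U i} \<in> iterated_join X T \<U> n"
      "x \<in> {x \<in> topspace X. \<forall>i<n. (T ^^ i) x \<in> U i}"
    unfolding iterated_join_def using x by auto
  then show "x \<in> \<Union> (iterated_join X T \<U> n)" by blast
qed

lemma subcover:
  assumes "open_cover X \<V>"
  obtains V where "V \<subseteq> \<V>" "finite V" "topspace X \<subseteq> \<Union>V" "card V = subcover_number X \<V>"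
proof -
  obtain W where "finite W" "W \<subseteq> \<V>" "topspace X \<subseteq> \<Union>W"
    using compact assms unfolding compact_space_alt open_cover_def by meson
  then show ?thesis using subcover_number_witness that by metis
qed

lemma subcover_number_pos: "open_cover X \<V> \<Longrightarrow> 1 \<le> subcover_number X \<V>"
proof -
  assume "open_cover X \<V>"
  from subcover[OF this] obtain V
    where V: "finite V" "topspace X \<subseteq> \<Union>V" "card V = subcover_number X \<V>" by metis
  have "V \<noteq> {}" using V(2) nonempty by auto
  then have "0 < card V" using V(1) by (simp add: card_gt_0_iff)
  then show ?thesis using V(3) by simp
qed

text \<open>The join of length \<open>m + n\<close> consists of intersections of members of the join
  of length \<open>m\<close> with preimages under \<open>T ^^ m\<close> of members of the join of
  length \<open>n\<close>.\<close>

lemma subcover_number_join_add: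
  assumes U: "open_cover X \<U>"
  shows "subcover_number X (iterated_join X T \<U> (m + n))
    \<le> subcover_number X (iterated_join X T \<U> m) * subcover_number X (iterated_join X T \<U> n)"
proof -
  obtain V where V: "V \<subseteq> iterated_join X T \<U> m" "finite V" "topspace X \<subseteq> \<Union>V"
    "card V = subcover_number X (iterated_join X T \<U> m)" using subcover[OF open_cover_join[OF U]] .
  obtain W where W: "W \<subseteq> iterated_join X T \<U> n" "finite W" "topspace X \<subseteq> \<Union>W"
    "card W = subcover_number X (iterated_join X T \<U> n)" using subcover[OF open_cover_join[OF U]] .
  define g where "g = (\<lambda>(A, B). {x \<in> topspace X. x \<in> A \<and> (T ^^ m) x \<in> B})"
  have "g (A, B) \<in> iterated_join X T \<U> (m + n)" if AB: "A \<in> V" "B \<in> W" for A B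
  proof -
    obtain P where P: "\<forall>i<m. P i \<in> \<U>" "A = {x \<in> topspace X. \<forall>i<m. (T ^^ i) x \<in> P i}"
      using AB V(1) unfolding iterated_join_def by blast
    obtain Q where Q: "\<forall>i<n. Q i \<in> \<U>" "B = {x \<in> topspace X. \<forall>i<n. (T ^^ i) x \<in> Q i}"
      using AB W(1) unfolding iterated_join_def by blast
    define R where "R = (\<lambda>i. if i < m then P i else Q (i - m))"
    have "\<forall>i<m + n. R i \<in> \<U>" using P(1) Q(1) by (auto simp: R_def)
    moreover have "(\<forall>i<m + n. (T ^^ i) x \<in> R i) \<longleftrightarrow> (\<forall>i<m. (T ^^ i) x \<in> P i) \<and> (\<forall>i<n. (T ^^ i) ((T ^^ m) x) \<in> Q i)" for x
    proof (intro iffI conjI allI impI)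
      fix i assume H: "\<forall>i<m + n. (T ^^ i) x \<in> R i"
      show "(T ^^ i) x \<in> P i" if "i < m" using H[rule_format, of i] that by (simp add: R_def)
      show "(T ^^ i) ((T ^^ m) x) \<in> Q i" if "i < n"
        using H[rule_format, of "i + m"] that by (simp add: R_def funpow_add)
    next
      fix i assume H: "(\<forall>i<m. (T ^^ i) x \<in> P i) \<and> (\<forall>i<n. (T ^^ i) ((T ^^ m) x) \<in> Q i)" and i: "i < m + n"
      show "(T ^^ i) x \<in> R i"
      proof (cases "i < m")
        case False
        then have "(T ^^ (i - m)) ((T ^^ m) x) = (T ^^ i) x"
          by (metis comp_apply funpow_add le_add_diff_inverse2 not_less)
        then show ?thesis using H i False unfolding R_def by (metis less_diff_conv2 linorder_not_less add.commute)
      qed (use H in \<open>simp add: R_def\<close>)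
    qed
    then have "g (A, B) = {x \<in> topspace X. \<forall>i<m + n. (T ^^ i) x \<in> R i}"
      unfolding g_def P(2) Q(2) using T_in by auto
    ultimately show ?thesis unfolding iterated_join_def by blast
  qed
  then have "g ` (V \<times> W) \<subseteq> iterated_join X T \<U> (m + n)" by auto
  moreover have "topspace X \<subseteq> \<Union> (g ` (V \<times> W))"
  proof
    fix x assume x: "x \<in> topspace X"
    then obtain A B where "A \<in> V" "x \<in> A" "B \<in> W" "(T ^^ m) x \<in> B" using V(3) W(3) T_in by blast
    then show "x \<in> \<Union> (g ` (V \<times> W))" using x unfolding g_def by auto
  qed
  ultimately have "subcover_number X (iterated_join X T \<U> (m + n)) \<le> card (g ` (V \<times> W))"
    using V(2) W(2) by (intro subcover_number_le) auto
  also have "\<dots> \<le> card V * card W"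
    using card_image_le[of "V \<times> W" g] V(2) W(2) by (simp add: card_cartesian_product)
  finally show ?thesis using V(4) W(4) by simp
qed

lemma cover_entropy_real:
  assumes U: "open_cover X \<U>"
  obtains L where "cover_entropy X T \<U> = ereal L"
    "(\<lambda>n. ln (real (subcover_number X (iterated_join X T \<U> n))) / real n) \<longlonglongrightarrow> L"
proof -
  define a where "a = (\<lambda>n. ln (real (subcover_number X (iterated_join X T \<U> n))))"
  have p: "1 \<le> subcover_number X (iterated_join X T \<U> n)" for n
    by (rule subcover_number_pos[OF open_cover_join[OF U]])
  have "convergent (\<lambda>n. a n / real n)"
  proof (rule subadditive_convergent)
    show "0 \<le> a n" for n unfolding a_def using p[of n] by (intro ln_ge_zero) simp
    show "a (m + n) \<le> a m + a n" for m n
    proof -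
      let ?N = "\<lambda>n. subcover_number X (iterated_join X T \<U> n)"
      have "real (?N (m + n)) \<le> real (?N m) * real (?N n)"
        using subcover_number_join_add[OF U, of m n] by (metis of_nat_le_iff of_nat_mult)
      moreover have "0 < real (?N k)" for k using p[of k] by simp
      ultimately show ?thesis
        unfolding a_def by (metis ln_le_cancel_iff ln_mult_pos mult_pos_pos)
    qed
  qed
  then obtain L where L: "(\<lambda>n. a n / real n) \<longlonglongrightarrow> L" by (auto simp: convergent_def)
  have "cover_entropy X T \<U> = ereal L"
    unfolding cover_entropy_def
    by (rule limI) (use L in \<open>simp add: a_def\<close>)
  then show ?thesis by (rule that[OF _ L[unfolded a_def]])
qed

text \<open>The fibres of \<open>f\<close> form a partition finer than the cover. If
  \<open>code\<close> determines the itinerary of length \<open>n\<close> through this partition,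
  one member of the join per code covers everything.\<close>

lemma subcover_number_join_le:
  assumes f: "\<And>x. x \<in> topspace X \<Longrightarrow> \<exists>U\<in>\<U>. \<forall>y\<in>topspace X. f y = f x \<longrightarrow> y \<in> U"
    and S: "finite S" "\<And>x. x \<in> topspace X \<Longrightarrow> code x \<in> S"
    and code: "\<And>x y i. \<lbrakk>x \<in> topspace X; y \<in> topspace X; code x = code y; i < n\<rbrakk>
        \<Longrightarrow> f ((T ^^ i) x) = f ((T ^^ i) y)"
  shows "subcover_number X (iterated_join X T \<U> n) \<le> card S"
proof -
  obtain u where u: "\<And>x. x \<in> topspace X \<Longrightarrow> u x \<in> \<U>"
      "\<And>x y. x \<in> topspace X \<Longrightarrow> y \<in> topspace X \<Longrightarrow> f y = f x \<Longrightarrow> y \<in> u x"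
    using f by metis
  define J where "J = (\<lambda>x. {y \<in> topspace X. \<forall>i<n. (T ^^ i) y \<in> u ((T ^^ i) x)})"
  \<comment> \<open>\<open>r c\<close> is a representative of the code \<open>c\<close>. The join
    member built along its orbit contains every point with the same code.\<close>
  define r where "r = (\<lambda>c. SOME x. x \<in> topspace X \<and> code x = c)"
  have r: "r (code x) \<in> topspace X" "code (r (code x)) = code x" if "x \<in> topspace X" for x
    using someI[of "\<lambda>y. y \<in> topspace X \<and> code y = code x" x] that unfolding r_def by auto
  let ?C = "code ` topspace X"
  have C: "?C \<subseteq> S" using S(2) by auto
  have fC: "finite ?C" by (rule finite_subset[OF C S(1)])
  have "(J \<circ> r) ` ?C \<subseteq> iterated_join X T \<U> n"
  proof (clarsimp)
    fix x assume x: "x \<in> topspace X"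
    have "\<forall>i<n. u ((T ^^ i) (r (code x))) \<in> \<U>" using u(1) T_in r(1)[OF x] by blast
    then show "J (r (code x)) \<in> iterated_join X T \<U> n"
      unfolding J_def iterated_join_def by (intro CollectI exI[of _ "\<lambda>i. u ((T ^^ i) (r (code x)))"] conjI refl)
  qed
  moreover have "topspace X \<subseteq> \<Union> ((J \<circ> r) ` ?C)"
  proof
    fix x assume x: "x \<in> topspace X"
    have "(T ^^ i) x \<in> u ((T ^^ i) (r (code x)))" if "i < n" for i
      using u(2) T_in r[OF x] x code[OF x r(1)[OF x] _ that] by simp
    then have "x \<in> J (r (code x))" using x by (simp add: J_def)
    then show "x \<in> \<Union> ((J \<circ> r) ` ?C)" using x by auto
  qed
  ultimately have "subcover_number X (iterated_join X T \<U> n) \<le> card ((J \<circ> r) ` ?C)"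
    using fC by (intro subcover_number_le) auto
  also have "\<dots> \<le> card ?C" by (rule card_image_le[OF fC])
  also have "\<dots> \<le> card S" by (rule card_mono[OF S(1) C])
  finally show ?thesis .
qed

text \<open>Here the cover is finer than the partition into fibres of \<open>f\<close>. Points in
  one member of the join share their itinerary, so each member contains at most one point of
  \<open>E\<close>.\<close>

lemma subcover_number_join_ge:
  assumes U: "open_cover X \<U>"
    and f: "\<And>U x y. U \<in> \<U> \<Longrightarrow> x \<in> U \<Longrightarrow> y \<in> U \<Longrightarrow> f x = f y"
    and E: "E \<subseteq> topspace X"
    and sep: "\<And>x y. \<lbrakk>x \<in> E; y \<in> E; \<And>i. i < n \<Longrightarrow> f ((T ^^ i) x) = f ((T ^^ i) y)\<rbrakk> \<Longrightarrow> x = y"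
  shows "card E \<le> subcover_number X (iterated_join X T \<U> n)"
proof -
  obtain V where V: "V \<subseteq> iterated_join X T \<U> n" "finite V" "topspace X \<subseteq> \<Union>V"
    "card V = subcover_number X (iterated_join X T \<U> n)" using subcover[OF open_cover_join[OF U]] .
  have "\<forall>x\<in>E. \<exists>A\<in>V. x \<in> A" using V(3) E by blast
  then obtain g where g: "\<And>x. x \<in> E \<Longrightarrow> g x \<in> V" "\<And>x. x \<in> E \<Longrightarrow> x \<in> g x" by metis
  have "inj_on g E"
  proof (rule inj_onI)
    fix x y assume x: "x \<in> E" and y: "y \<in> E" and e: "g x = g y"
    obtain R where R: "\<forall>i<n. R i \<in> \<U>" "g x = {x \<in> topspace X. \<forall>i<n. (T ^^ i) x \<in> R i}"
      using g(1)[OF x] V(1) unfolding iterated_join_def by blast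
    have "f ((T ^^ i) x) = f ((T ^^ i) y)" if "i < n" for i
      by (rule f[of "R i"]) (use R that g(2)[OF x] g(2)[OF y] e in auto)
    then show "x = y" by (rule sep[OF x y])
  qed
  then have "card E \<le> card V" using g(1) V(2) by (intro card_inj_on_le[of g]) auto
  then show ?thesis using V(4) by simp
qed

end

subsection \<open>Entropy of Vershik maps\<close>

text \<open>The lower half of Stirling's formula; the induction step is
  \<open>ln (1 + 1 / n) \<le> 1 / n\<close>.\<close>

lemma ln_fact_ge: "real n * ln (real n) - real n \<le> ln (fact n)"
proof (induction n)
  case (Suc n)
  show ?case
  proof (cases "n = 0")
    case False
    have "ln (1 + 1 / real n) \<le> 1 / real n" by (rule ln_add_one_self_le_self) simp
    moreover have "1 + 1 / real n = real (Suc n) / real n" using False by (simp add: field_simps)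
    ultimately have "ln (real (Suc n)) - ln (real n) \<le> 1 / real n"
      using False by (simp add: ln_div)
    then have "real n * (ln (real (Suc n)) - ln (real n)) \<le> 1"
      using False by (simp add: field_simps)
    moreover have "ln (fact (Suc n)) = ln (real (Suc n)) + ln (fact n)"
      by (simp add: ln_mult del: of_nat_Suc)
    ultimately show ?thesis using Suc by (simp add: algebra_simps)
  qed simp
qed simp

lemma ln_fact_le: "ln (fact n) \<le> real n * ln (real n)"
proof (cases "n = 0")
  case False
  have "(fact n :: real) \<le> real (n ^ n)" by (rule fact_le_power)
  then have "ln (fact n :: real) \<le> ln (real n ^ n)" using False by (subst ln_le_cancel_iff) simp_all
  then show ?thesis using False by (simp add: ln_realpow)
qed simp

lemma ln_fact_minus_2_ge:
  assumes "2 \<le> n" shows "real n * ln (real n) - real n - 2 * ln (real n) \<le> ln (fact (n - 2))"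
proof -
  define k where "k = n - 2"
  have k: "n = Suc (Suc k)" using assms by (simp add: k_def)
  have "(fact n :: real) = real n * (real (Suc k) * fact k)" by (simp add: k)
  then have "ln (fact n :: real) = ln (real n) + (ln (real (Suc k)) + ln (fact k))"
    by (simp add: k ln_mult del: of_nat_Suc)
  moreover have "ln (real (Suc k)) \<le> ln (real n)" by (simp add: k)
  ultimately show ?thesis using ln_fact_ge[of n] unfolding k_def[symmetric] by linarith
qed

section \<open>Upper bound for the entropy\<close>

context ordered_odometer
begin

sublocale compact_system "odometer_space q" T
proof
  show "compact_space (odometer_space q)" by (rule compact_odometer)
  show "continuous_map (odometer_space q) (odometer_space q) T"
    by (rule homeomorphic_imp_continuous_map[OF vershik_homeomorphic])
  show "topspace (odometer_space q) \<noteq> {}" using top_seq_dseqs by (auto simp: topspace_odometer)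
qed

text \<open>A Lebesgue number argument: finitely many cylinders, each inside a member of the cover,
  suffice by compactness, and \<open>M\<close> is the largest of their lengths.\<close>

lemma cover_cylinders:
  assumes U: "open_cover (odometer_space q) \<U>"
  obtains M where "\<And>x. x \<in> dseqs q \<Longrightarrow> \<exists>U\<in>\<U>. \<forall>y\<in>dseqs q. agree M y x \<longrightarrow> y \<in> U"
proof -
  define C where "C = {V. \<exists>N x. x \<in> dseqs q \<and> V = {y \<in> dseqs q. agree N y x} \<and> (\<exists>U\<in>\<U>. V \<subseteq> U)}"
  have "openin (odometer_space q) V" if V: "V \<in> C" for V
  proof -
    obtain N x where V: "V = {y \<in> dseqs q. agree N y x}" using V unfolding C_def by blast
    show ?thesis unfolding V openin_odometer by (intro conjI ballI exI[of _ N]) auto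
  qed
  moreover have "topspace (odometer_space q) \<subseteq> \<Union>C"
  proof
    fix x assume "x \<in> topspace (odometer_space q)"
    then have x: "x \<in> dseqs q" by (simp add: topspace_odometer)
    then obtain U where U': "U \<in> \<U>" "x \<in> U" "openin (odometer_space q) U"
      using U unfolding open_cover_def topspace_odometer by blast
    then obtain N where N: "\<forall>y\<in>dseqs q. agree N y x \<longrightarrow> y \<in> U" unfolding openin_odometer by blast
    then have "{y \<in> dseqs q. agree N y x} \<in> C" unfolding C_def using x U'(1) by blast
    then show "x \<in> \<Union>C" using x by blast
  qed
  ultimately obtain F where F: "finite F" "F \<subseteq> C" "topspace (odometer_space q) \<subseteq> \<Union>F"
    using compact unfolding compact_space_alt by meson
  have "\<forall>V\<in>F. \<exists>N. \<exists>x. V = {y \<in> dseqs q. agree N y x} \<and> (\<exists>U\<in>\<U>. V \<subseteq> U)" using F(2) unfolding C_def by blast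
  from bchoice[OF this] obtain N where
    N: "\<forall>V\<in>F. \<exists>x. V = {y \<in> dseqs q. agree (N V) y x} \<and> (\<exists>U\<in>\<U>. V \<subseteq> U)" ..
  define M where "M = Max (insert 0 (N ` F))"
  have NM: "N V \<le> M" if "V \<in> F" for V unfolding M_def using that F(1) by (intro Max_ge) auto
  show ?thesis
  proof (rule that[of M])
    fix x assume x: "x \<in> dseqs q"
    then obtain V where V: "V \<in> F" "x \<in> V" using F(3) unfolding topspace_odometer by blast
    obtain z U where z: "V = {y \<in> dseqs q. agree (N V) y z}" "U \<in> \<U>" "V \<subseteq> U" using bspec[OF N V(1)] by blast
    have "y \<in> U" if y: "y \<in> dseqs q" "agree M y x" for y
    proof -
      have "agree (N V) x z" using V(2) by (subst (asm) z(1)) simp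
      then have "agree (N V) y z" using y(2) NM[OF V(1)] by simp
      then have "y \<in> V" using y(1) by (subst z(1)) simp
      then show ?thesis using z(3) by blast
    qed
    then show "\<exists>U\<in>\<U>. \<forall>y\<in>dseqs q. agree M y x \<longrightarrow> y \<in> U" using z(2) by blast
  qed
qed

text \<open>The index \<open>i\<close> counts blocks of length \<open>H\<close>; block \<open>i\<close> starts at time \<open>i * H - P (Suc m) x\<close>,
  and truncated subtraction makes this the time \<open>0\<close> for the first, incomplete block.\<close>

lemma order_in_block:
  fixes m :: nat and x :: "nat \<Rightarrow> nat"
  defines "H \<equiv> h (Suc m)"
  defines "c \<equiv> \<lambda>i. (T ^^ (i * H - P (Suc m) x)) x (Suc m)"
  assumes x: "x \<in> dseqs q" and t: "P (Suc m) x + t = i * H + b" "b < H"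
  shows "(T ^^ t) x (Suc m) = c i"
proof (cases "i * H \<le> P (Suc m) x")
  case True
  have "P (Suc m) x < H" unfolding H_def by (rule pos_less[OF x])
  have "i = 0"
  proof (rule ccontr)
    assume "i \<noteq> 0"
    then have "H \<le> i * H" by (cases i) simp_all
    then show False using True \<open>P (Suc m) x < H\<close> by linarith
  qed
  then have "P (Suc m) x + t < h (Suc m)" using t by (simp add: H_def)
  then have "(T ^^ t) x (Suc m) = x (Suc m)" using pos_vershik_funpow[OF x] by blast
  then show ?thesis using \<open>i = 0\<close> by (simp add: c_def)
next
  case False
  define a where "a = i * H - P (Suc m) x"
  define z where "z = (T ^^ a) x"
  have a: "P (Suc m) x + a = i * H" using False by (simp add: a_def)
  have "P (Suc m) z = 0"
    using pos_vershik_funpow_mod[OF x, of "Suc m" a] a by (simp add: z_def H_def)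
  moreover have "t = b + a" using t(1) a by simp
  then have "(T ^^ t) x = (T ^^ b) z" by (simp add: z_def funpow_add)
  moreover have "z \<in> dseqs q" unfolding z_def by (rule vershik_funpow_dseqs[OF x])
  ultimately have "(T ^^ t) x (Suc m) = z (Suc m)"
    using pos_vershik_funpow[of z "Suc m" b] t(2) by (simp add: H_def)
  then show ?thesis by (simp add: z_def a_def c_def)
qed

text \<open>A window of \<open>k * h (Suc m)\<close> steps meets at most \<open>k + 1\<close> blocks
  of level \<open>Suc m\<close>. The height at time \<open>0\<close> and the order used in each of
  these blocks determine the first \<open>Suc m\<close> digits throughout: \<open>h (Suc m)\<close>
  heights, and \<open>fact (q m - 2)\<close> orders per block.\<close>

lemma subcover_number_upper:
  assumes M: "\<And>x. x \<in> dseqs q \<Longrightarrow> \<exists>U\<in>\<U>. \<forall>y\<in>dseqs q. agree M y x \<longrightarrow> y \<in> U" and m: "M \<le> Suc m"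
  shows "subcover_number (odometer_space q) (iterated_join (odometer_space q) T \<U> (k * h (Suc m)))
     \<le> h (Suc m) * fact (q m - 2) ^ Suc k"
proof -
  define H where "H = h (Suc m)"
  have H0: "0 < H" unfolding H_def by (rule place_pos)
  define perms where "perms = {\<pi>. \<pi> permutes {1..<q m - 1}}"
  have fp: "finite perms" unfolding perms_def by (rule finite_permutations) simp
  have cp: "card perms = fact (q m - 2)"
    unfolding perms_def by (rule card_permutations) simp_all
  \<comment> \<open>\<open>c x i\<close> is digit \<open>Suc m\<close> during block
    \<open>i\<close>, where it is constant. The code stores only the order it induces, which is all
    that \<open>pos_inj\<close> asks for.\<close>
  define c where "c = (\<lambda>x i. (T ^^ (i * H - P (Suc m) x)) x (Suc m))"
  define code where "code = (\<lambda>x. (P (Suc m) x, restrict (\<lambda>i. s m (c x i)) {..k}))"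
  define S where "S = {..<H} \<times> (Pi\<^sub>E {..k} (\<lambda>_. perms))"
  have "subcover_number (odometer_space q) (iterated_join (odometer_space q) T \<U> (k * H)) \<le> card S"
  proof (rule subcover_number_join_le[where f = "\<lambda>x. restrict x {..<Suc m}" and code = code])
    fix x assume "x \<in> topspace (odometer_space q)"
    then have x: "x \<in> dseqs q" by (simp add: topspace_odometer)
    obtain U where U: "U \<in> \<U>" "\<And>y. y \<in> dseqs q \<Longrightarrow> agree M y x \<Longrightarrow> y \<in> U" using M[OF x] by blast
    have "y \<in> U" if y: "y \<in> dseqs q" "restrict y {..<Suc m} = restrict x {..<Suc m}" for y
    proof (rule U(2)[OF y(1)], intro allI impI)
      fix i assume "i < M"
      then show "y i = x i" using fun_cong[OF y(2), of i] m by simp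
    qed
    then show "\<exists>U\<in>\<U>. \<forall>y\<in>topspace (odometer_space q).
        restrict y {..<Suc m} = restrict x {..<Suc m} \<longrightarrow> y \<in> U"
      using U(1) by (auto simp: topspace_odometer)
    show "code x \<in> S"
      unfolding code_def S_def perms_def H_def using pos_less[OF x, of "Suc m"] s_permutes by auto
  next
    show "finite S" unfolding S_def using fp by (intro finite_cartesian_product finite_PiE) simp_all
  next
    fix x y t assume "x \<in> topspace (odometer_space q)" "y \<in> topspace (odometer_space q)"
      and e: "code x = code y" and t: "t < k * H"
    then have x: "x \<in> dseqs q" and y: "y \<in> dseqs q" by (simp_all add: topspace_odometer)
    have p: "P (Suc m) x = P (Suc m) y" using e by (simp add: code_def)
    define i where "i = (P (Suc m) x + t) div H"
    define b where "b = (P (Suc m) x + t) mod H"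
    have ib: "P (Suc m) x + t = i * H + b" "b < H" using H0 by (simp_all add: i_def b_def)
    have "P (Suc m) x + t < Suc k * H" using t pos_less[OF x, of "Suc m"] by (simp add: H_def)
    then have "i < Suc k" unfolding i_def using H0 by (simp add: less_mult_imp_div_less)
    moreover have "snd (code x) i = snd (code y) i" using e by simp
    ultimately have "s m (c x i) = s m (c y i)" by (simp add: code_def)
    moreover have "(T ^^ t) x (Suc m) = c x i"
      using order_in_block[OF x, of m t i b] ib by (simp add: H_def c_def)
    moreover have "(T ^^ t) y (Suc m) = c y i"
      using order_in_block[OF y, of m t i b] ib p by (simp add: H_def c_def)
    moreover have "P (Suc m) ((T ^^ t) x) = P (Suc m) ((T ^^ t) y)"
      using pos_vershik_funpow_mod[OF x] pos_vershik_funpow_mod[OF y] p by simp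
    ultimately have "agree (Suc m) ((T ^^ t) x) ((T ^^ t) y)"
      by (intro pos_inj vershik_funpow_dseqs x y) simp_all
    then show "restrict ((T ^^ t) x) {..<Suc m} = restrict ((T ^^ t) y) {..<Suc m}"
      by (intro restrict_ext) simp
  qed
  also have "card S = H * fact (q m - 2) ^ Suc k"
    unfolding S_def by (simp add: card_cartesian_product card_PiE cp)
  finally show ?thesis by (simp add: H_def)
qed

text \<open>Along multiples of \<open>h (Suc m) = q m * h m\<close> the growth rate is at most
  \<open>ln (fact (q m - 2)) / h (Suc m)\<close>; the crude bound \<open>q m * ln (q m)\<close> for
  the numerator cancels the factor \<open>q m\<close>.\<close>

lemma cover_entropy_upper:
  assumes U: "open_cover (odometer_space q) \<U>"
  obtains m0 where "\<And>m. m0 \<le> m \<Longrightarrow> cover_entropy (odometer_space q) T \<U> \<le> ereal (ln (q m) / h m)"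
proof -
  obtain M where M: "\<And>x. x \<in> dseqs q \<Longrightarrow> \<exists>U\<in>\<U>. \<forall>y\<in>dseqs q. agree M y x \<longrightarrow> y \<in> U"
    using cover_cylinders[OF U] by blast
  obtain L where L: "cover_entropy (odometer_space q) T \<U> = ereal L"
    "(\<lambda>n. ln (real (subcover_number (odometer_space q) (iterated_join (odometer_space q) T \<U> n))) / real n)
       \<longlonglongrightarrow> L"
    using cover_entropy_real[OF U] .
  show ?thesis
  proof (rule that[of M])
    fix m assume m: "M \<le> m"
    define H where "H = h (Suc m)"
    have H: "0 < H" unfolding H_def by (rule place_pos)
    define K where "K = ln (fact (q m - 2) :: real)"
    let ?N = "\<lambda>n. subcover_number (odometer_space q) (iterated_join (odometer_space q) T \<U> n)"
    have sm: "strict_mono (\<lambda>k. Suc k * H)" by (rule strict_monoI_Suc) (use H in simp)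
    have l1: "(\<lambda>k. ln (real (?N (Suc k * H))) / real (Suc k * H)) \<longlonglongrightarrow> L"
      using LIMSEQ_subseq_LIMSEQ[OF L(2) sm] by (simp add: o_def)
    have l2: "(\<lambda>k. (ln (real H) + (real k + 2) * K) / ((real k + 1) * real H)) \<longlonglongrightarrow> K / real H"
      unfolding divide_inverse[of K] using H by real_asymp
    have l3: "ln (real (?N (Suc k * H))) / real (Suc k * H)
        \<le> (ln (real H) + (real k + 2) * K) / ((real k + 1) * real H)" for k
    proof -
      have p: "1 \<le> ?N (Suc k * H)" by (rule subcover_number_pos[OF open_cover_join[OF U]])
      have "?N (Suc k * H) \<le> H * fact (q m - 2) ^ Suc (Suc k)"
        unfolding H_def by (rule subcover_number_upper[OF M]) (use m in auto)
      then have "real (?N (Suc k * H)) \<le> real (H * fact (q m - 2) ^ Suc (Suc k))"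
        by (rule of_nat_mono)
      also have "\<dots> = real H * fact (q m - 2) ^ (k + 2)" by simp
      finally have "ln (real (?N (Suc k * H))) \<le> ln (real H * fact (q m - 2) ^ (k + 2))"
        using p H by (subst ln_le_cancel_iff) simp_all
      also have "\<dots> = ln (real H) + (real k + 2) * K"
        using H by (simp add: ln_mult ln_realpow K_def algebra_simps)
      finally show ?thesis using H by (simp add: divide_right_mono algebra_simps)
    qed
    have "L \<le> K / real H" by (rule LIMSEQ_le[OF l1 l2]) (use l3 in blast)
    also have "\<dots> \<le> ln (real (q m)) / real (h m)"
    proof -
      have qm: "2 \<le> q m" by (rule q2)
      have "K \<le> real (q m - 2) * ln (real (q m - 2))" unfolding K_def by (rule ln_fact_le)
      also have "\<dots> \<le> real (q m) * ln (real (q m))"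
      proof (cases "q m - 2 = 0")
        case False
        then show ?thesis using qm by (intro mult_mono) simp_all
      qed (use qm in simp)
      finally have "K / real H \<le> (real (q m) * ln (real (q m))) / real H"
        using H by (intro divide_right_mono) simp_all
      then show ?thesis using qm by (simp add: H_def place_Suc)
    qed
    finally show "cover_entropy (odometer_space q) T \<U> \<le> ereal (ln (q m) / h m)"
      using L(1) by simp
  qed
qed

section \<open>Lower bound for the entropy: names of blocks\<close>

definition base :: "nat \<Rightarrow> nat \<Rightarrow> nat \<Rightarrow> nat" where
  "base m v = (\<lambda>i. if i = m then v else 0)"

text \<open>The word of length \<open>h m\<close> read while climbing the level-\<open>m\<close>
  tower over the letter \<open>v\<close>, when only the digits \<open>0\<close> to \<open>n\<close>
  are visible.\<close>

definition name :: "nat \<Rightarrow> nat \<Rightarrow> nat \<Rightarrow> nat \<Rightarrow> (nat \<Rightarrow> nat)" where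
  "name n m v = restrict (\<lambda>j. restrict ((T ^^ j) (base m v)) {..n}) {..<h m}"

lemma base_dseqs: "v < q m \<Longrightarrow> base m v \<in> dseqs q"
proof -
  assume "v < q m"
  moreover have "0 < q i" for i using q2[of i] by simp
  ultimately show ?thesis by (simp add: base_def dseqs_def)
qed

lemma pos_base: "P m (base m v) = 0"
  by (rule pos_zero) (simp add: base_def)

text \<open>As long as the orbit stays in one level-\<open>m\<close> block, digit \<open>m\<close>
  is frozen and the digits below it evolve independently of those above. Hence a name depends only
  on the letter, not on the zeros that \<open>base\<close> puts after it.\<close>

lemma agree_funpow:
  assumes x: "x \<in> dseqs q" "y \<in> dseqs q" and a: "agree (Suc m) x y" and j: "P m x + j < h m"
  shows "agree (Suc m) ((T ^^ j) x) ((T ^^ j) y)"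
proof -
  have p: "P m x = P m y" by (rule pos_cong[OF a])
  note X = pos_vershik_funpow[OF x(1) j] and Y = pos_vershik_funpow[OF x(2) j[unfolded p]]
  have e: "(T ^^ j) x m = (T ^^ j) y m" using X Y a by simp
  have "P m ((T ^^ j) x) = P m ((T ^^ j) y)" using X Y p by simp
  then have "agree m ((T ^^ j) x) ((T ^^ j) y)"
    using e by (intro pos_inj vershik_funpow_dseqs x) simp_all
  then show ?thesis using e by (simp add: less_Suc_eq)
qed

text \<open>The recursive structure of the blocks: the block of \<open>v\<close> at level
  \<open>Suc m\<close> is the concatenation of the level-\<open>m\<close> blocks of the letters
  \<open>s m v 0\<close>, \<open>s m v 1\<close>, and so on, in this order.\<close>

lemma name_Suc:
  assumes v: "v < q (Suc m)" and i: "i < q m" and j: "j < h m" and n: "n \<le> m"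
  shows "name n (Suc m) v (i * h m + j) = name n m (s m v i) j"
proof -
  let ?x = "base (Suc m) v"
  have x: "?x \<in> dseqs q" by (rule base_dseqs[OF v])
  define z where "z = (T ^^ (i * h m)) ?x"
  have z: "z \<in> dseqs q" unfolding z_def by (rule vershik_funpow_dseqs[OF x])
  have lt: "i * h m + j < h (Suc m)"
    using mixed_radix_less[OF j i] by (simp add: place_Suc add.commute)
  then have "P (Suc m) z = i * h m" "z (Suc m) = v"
    using pos_vershik_funpow[OF x, of "Suc m" "i * h m"] pos_base[of "Suc m" v]
    by (simp_all add: z_def base_def)
  then have "P m z + rank m v (z m) * h m = 0 + i * h m" by (simp add: pos_Suc)
  from mixed_radix_inj[OF pos_less[OF z] place_pos this]
  have pz: "P m z = 0" and "rank m v (z m) = i" by simp_all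
  then have zm: "z m = s m v i" by (metis s_rank)
  let ?y = "base m (s m v i)"
  have y: "?y \<in> dseqs q" by (rule base_dseqs[OF s_less[OF i]])
  have "agree m z ?y" by (rule pos_inj[OF z y]) (use pz pos_base zm in \<open>simp_all add: base_def\<close>)
  then have "agree (Suc m) z ?y" using zm by (simp add: less_Suc_eq base_def)
  then have "agree (Suc m) ((T ^^ j) z) ((T ^^ j) ?y)"
    using pz j by (intro agree_funpow z y) simp_all
  then have "restrict ((T ^^ j) z) {..n} = restrict ((T ^^ j) ?y) {..n}"
    using n by (intro restrict_ext) simp
  moreover have "(T ^^ (i * h m + j)) ?x = (T ^^ j) z"
    by (simp add: z_def add.commute[of "i * h m"] funpow_add)
  ultimately show ?thesis using lt j by (simp add: name_def)
qed

end

text \<open>From level \<open>m0\<close> on, the orders are used almost equally often: the average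
  number of letters per order is \<open>q (Suc m) / fact (q m - 2)\<close>, and \<open>B m\<close>
  exceeds it by a factor of at most \<open>2\<close>.\<close>

locale rich_odometer = ordered_odometer +
  fixes m0 :: nat and B :: "nat \<Rightarrow> nat"
  assumes fibre: "m0 \<le> m \<Longrightarrow> card {v. v < q (Suc m) \<and> (\<forall>i<q m. s m v i = g i)} \<le> B m"
    and B_pos: "m0 \<le> m \<Longrightarrow> 1 \<le> B m"
    and B_le: "m0 \<le> m \<Longrightarrow> real (B m) * fact (q m - 2) \<le> 2 * real (q (Suc m))"
begin

primrec multiplicity_bound :: "nat \<Rightarrow> nat \<Rightarrow> nat" where
  "multiplicity_bound n 0 = 1"
| "multiplicity_bound n (Suc k) = multiplicity_bound n k ^ q (n + k) * B (n + k)"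

lemma multiplicity_bound_pos: "m0 \<le> n \<Longrightarrow> 1 \<le> multiplicity_bound n k"
proof (induction k)
  case (Suc k)
  then have "1 \<le> B (n + k)" using B_pos[of "n + k"] by simp
  then show ?case using Suc by simp
qed simp

text \<open>A name at level \<open>Suc m\<close> prescribes the names of its \<open>q m\<close>
  sub-blocks. Each of these leaves at most \<open>multiplicity_bound n k\<close> letters, so at most
  the \<open>q m\<close>-th power of that number of orders is possible, and each order is used by at
  most \<open>B m\<close> letters.\<close>

lemma card_name_fibre:
  assumes n: "m0 \<le> n" shows "card {v. v < q (n + k) \<and> name n (n + k) v = g} \<le> multiplicity_bound n k"
proof (induction k arbitrary: g)
  case 0
  \<comment> \<open>At level \<open>n\<close> the visible digits include digit \<open>n\<close>,
    which is the letter itself, so names separate letters.\<close>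
  have "v = w" if "v < q n" "w < q n" "name n n v = g" "name n n w = g" for v w
  proof -
    have "name n n v 0 n = name n n w 0 n" using that by simp
    then show ?thesis using place_pos[of n] by (simp add: name_def base_def)
  qed
  then have "card {v. v < q n \<and> name n n v = g} \<le> Suc 0"
    by (subst card_le_Suc0_iff_eq) auto
  then show ?case by simp
next
  case (Suc k)
  define m where "m = n + k"
  have m: "m0 \<le> m" "n \<le> m" using n by (simp_all add: m_def)
  define G where "G = (\<lambda>i. {u. u < q m \<and> name n m u = restrict (\<lambda>j. g (i * h m + j)) {..<h m}})"
  have G: "card (G i) \<le> multiplicity_bound n k" "finite (G i)" for i
    using Suc.IH unfolding G_def m_def by auto
  define A where "A = Pi\<^sub>E {..<q m} G"
  have fA: "finite A" unfolding A_def by (rule finite_PiE) (simp_all add: G)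
  have "card A = (\<Prod>i<q m. card (G i))" unfolding A_def by (simp add: card_PiE)
  also have "\<dots> \<le> (\<Prod>i<q m. multiplicity_bound n k)" by (rule prod_mono) (simp add: G)
  finally have cA: "card A \<le> multiplicity_bound n k ^ q m" by simp
  let ?F = "\<lambda>t. {v. v < q (Suc m) \<and> (\<forall>i<q m. s m v i = t i)}"
  have "{v. v < q (Suc m) \<and> name n (Suc m) v = g} \<subseteq> (\<Union>t\<in>A. ?F t)"
  proof
    fix v assume "v \<in> {v. v < q (Suc m) \<and> name n (Suc m) v = g}"
    then have v: "v < q (Suc m)" "name n (Suc m) v = g" by simp_all
    have "name n m (s m v i) = restrict (\<lambda>j. g (i * h m + j)) {..<h m}" if i: "i < q m" for i
    proof
      fix j
      show "name n m (s m v i) j = restrict (\<lambda>j. g (i * h m + j)) {..<h m} j"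
      proof (cases "j < h m")
        case True
        then show ?thesis using name_Suc[OF v(1) i True m(2)] v(2) by simp
      next
        case False
        then show ?thesis by (simp add: name_def)
      qed
    qed
    then have "restrict (s m v) {..<q m} \<in> A" unfolding A_def G_def using s_less by auto
    moreover have "v \<in> ?F (restrict (s m v) {..<q m})" using v(1) by simp
    ultimately show "v \<in> (\<Union>t\<in>A. ?F t)" by blast
  qed
  then have "card {v. v < q (Suc m) \<and> name n (Suc m) v = g} \<le> card (\<Union>t\<in>A. ?F t)"
    by (rule card_mono[rotated]) (use fA in auto)
  also have "\<dots> \<le> (\<Sum>t\<in>A. card (?F t))" by (rule card_UN_le[OF fA])
  also have "\<dots> \<le> (\<Sum>t\<in>A. B m)" by (rule sum_mono) (rule fibre[OF m(1)])
  also have "\<dots> = card A * B m" by simp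
  also have "\<dots> \<le> multiplicity_bound n k ^ q m * B m" using cA by simp
  finally show ?case by (simp add: m_def)
qed

text \<open>The letters have at least \<open>q (n + k) / multiplicity_bound n k\<close> different
  names. Choosing one letter per name gives base points with pairwise different itineraries of
  length \<open>h (n + k)\<close>.\<close>

lemma subcover_number_lower:
  assumes n: "m0 \<le> n" and U: "open_cover (odometer_space q) \<U>"
    and f: "\<And>U x y. U \<in> \<U> \<Longrightarrow> x \<in> U \<Longrightarrow> y \<in> U \<Longrightarrow> restrict x {..n} = restrict y {..n}"
  shows "q (n + k) \<le>
     subcover_number (odometer_space q) (iterated_join (odometer_space q) T \<U> (h (n + k))) * multiplicity_bound n k"
proof -
  define m where "m = n + k"
  let ?N = "name n m ` {..<q m}"
  have "{..<q m} \<subseteq> (\<Union>g\<in>?N. {v. v < q m \<and> name n m v = g})" by auto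
  then have "card {..<q m} \<le> card (\<Union>g\<in>?N. {v. v < q m \<and> name n m v = g})"
    by (rule card_mono[rotated]) auto
  also have "\<dots> \<le> (\<Sum>g\<in>?N. card {v. v < q m \<and> name n m v = g})" by (rule card_UN_le) simp
  also have "\<dots> \<le> (\<Sum>g\<in>?N. multiplicity_bound n k)"
    by (rule sum_mono) (use card_name_fibre[OF n] in \<open>simp add: m_def\<close>)
  finally have 1: "q m \<le> card ?N * multiplicity_bound n k" by simp
  obtain E where E: "E \<subseteq> {..<q m}" "inj_on (name n m) E" "?N = name n m ` E"
    using subset_image_inj[of ?N "name n m" "{..<q m}"] by auto
  have "card (base m ` E) \<le> subcover_number (odometer_space q) (iterated_join (odometer_space q) T \<U> (h m))"
  proof (rule subcover_number_join_ge[OF U, where f = "\<lambda>x. restrict x {..n}"])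
    show "restrict x {..n} = restrict y {..n}" if "U \<in> \<U>" "x \<in> U" "y \<in> U" for U x y
      using f that by blast
    show "base m ` E \<subseteq> topspace (odometer_space q)"
      using base_dseqs E(1) by (auto simp: topspace_odometer)
    fix x y assume "x \<in> base m ` E" "y \<in> base m ` E"
      and e: "\<And>i. i < h m \<Longrightarrow> restrict ((T ^^ i) x) {..n} = restrict ((T ^^ i) y) {..n}"
    then obtain u v where uv: "u \<in> E" "v \<in> E" "x = base m u" "y = base m v" by blast
    have "name n m u = name n m v"
      unfolding name_def by (rule restrict_ext) (use e uv(3,4) in blast)
    then show "x = y" using E(2) uv by (auto dest: inj_onD)
  qed
  moreover have "inj_on (base m) E"
    by (rule inj_onI) (metis base_def)
  ultimately have "card E \<le> subcover_number (odometer_space q) (iterated_join (odometer_space q) T \<U> (h m))"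
    by (simp add: card_image)
  moreover have "card ?N = card E" using E(2,3) by (simp add: card_image)
  ultimately show ?thesis
    using order_trans[OF 1 mult_le_mono1] unfolding m_def[symmetric] by simp
qed

text \<open>\<open>l k\<close> bounds from below the logarithm of the number of names. The loss of
  \<open>3\<close> per letter collects \<open>q\<close> from Stirling's formula,
  \<open>2 * ln q \<le> 2 * (q - 1)\<close> from the two fixed digits, and
  \<open>ln 2 \<le> 1\<close> from the uneven use of the orders, for
  \<open>q = q (n + k)\<close>.\<close>

lemma log_names_step:
  fixes n k :: nat
  defines "l \<equiv> \<lambda>k. ln (real (q (n + k))) - ln (real (multiplicity_bound n k))"
  assumes n: "m0 \<le> n"
  shows "real (q (n + k)) * (l k - 3) \<le> l (Suc k)"
proof -
  define m where "m = n + k"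
  have m: "m0 \<le> m" using n by (simp add: m_def)
  let ?R = "real (multiplicity_bound n k)" and ?q = "real (q m)"
  have R: "0 < ?R" and B: "0 < real (B m)" and q': "0 < real (q (Suc m))" and q0: "2 \<le> ?q"
    using multiplicity_bound_pos[OF n, of k] B_pos[OF m] q2[of "Suc m"] q2[of m] by simp_all
  have "ln (real (B m) * fact (q m - 2)) \<le> ln (2 * real (q (Suc m)))"
    using B_le[OF m] B q' by (subst ln_le_cancel_iff) simp_all
  then have "ln (real (B m)) + ln (fact (q m - 2)) \<le> ln 2 + ln (real (q (Suc m)))"
    using B q' by (simp add: ln_mult)
  moreover have "?q * ln ?q - ?q - 2 * ln ?q \<le> ln (fact (q m - 2))"
    by (rule ln_fact_minus_2_ge[OF q2])
  moreover have "ln ?q \<le> ?q - 1" using q0 by (intro ln_le_minus_one) simp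
  moreover have "ln 2 \<le> (1 :: real)" using ln_le_minus_one[of "2 :: real"] by simp
  moreover have "l (Suc k) = ln (real (q (Suc m))) - (?q * ln ?R + ln (real (B m)))"
    using R B by (simp add: l_def m_def ln_mult ln_realpow)
  moreover have "?q * (l k - 3) = ?q * ln ?q - ?q * ln ?R - 3 * ?q"
    by (simp add: l_def m_def algebra_simps)
  ultimately have "?q * (l k - 3) \<le> l (Suc k)" by linarith
  then show ?thesis by (simp add: m_def)
qed

text \<open>The places at least double, so the losses \<open>3 / h\<close> from level
  \<open>n\<close> on add up to at most \<open>6 / h n\<close>. The term
  \<open>6 / h (n + k)\<close> is the part of this budget not yet spent, and
  \<open>6 / h (n + k + 1) \<le> 3 / h (n + k)\<close> pays for a step.\<close>

lemma log_names_lower: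
  fixes n k :: nat
  defines "l \<equiv> \<lambda>k. ln (real (q (n + k))) - ln (real (multiplicity_bound n k))"
  assumes n: "m0 \<le> n"
  shows "(ln (real (q n)) - 6) / real (h n) + 6 / real (h (n + k)) \<le> l k / real (h (n + k))"
proof (induction k)
  case 0
  show ?case by (simp add: l_def add_divide_distrib[symmetric])
next
  case (Suc k)
  let ?q = "real (q (n + k))" and ?h = "real (h (n + k))"
  have q: "2 \<le> ?q" and h: "0 < ?h" using q2[of "n + k"] place_pos[of "n + k"] by simp_all
  have hS: "real (h (n + Suc k)) = ?q * ?h" by (simp add: place_Suc)
  have "l k / ?h - 3 / ?h = (?q * (l k - 3)) / (?q * ?h)" using q h by (simp add: field_simps)
  also have "\<dots> \<le> l (Suc k) / (?q * ?h)"
    using log_names_step[OF n, of k] q h unfolding l_def by (intro divide_right_mono) simp_all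
  finally have 1: "l k / ?h - 3 / ?h \<le> l (Suc k) / (?q * ?h)" .
  have "6 / (?q * ?h) \<le> 6 / (2 * ?h)" using q h by (intro divide_left_mono) simp_all
  also have "\<dots> = 3 / ?h" by simp
  finally have "6 / (?q * ?h) \<le> 3 / ?h" .
  then show ?case using 1 Suc unfolding hS by simp
qed

lemma topological_entropy_lower:
  assumes n: "m0 \<le> n"
  shows "ereal ((ln (real (q n)) - 6) / real (h n)) \<le> topological_entropy (odometer_space q) T"
proof -
  define \<U> where "\<U> = (\<lambda>x. {y \<in> dseqs q. agree (Suc n) y x}) ` dseqs q"
  have U: "open_cover (odometer_space q) \<U>"
    unfolding open_cover_def
  proof (intro conjI ballI)
    fix V assume "V \<in> \<U>"
    then obtain x where V: "V = {y \<in> dseqs q. agree (Suc n) y x}" unfolding \<U>_def by blast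
    show "openin (odometer_space q) V"
      unfolding V openin_odometer by (intro conjI ballI exI[of _ "Suc n"]) auto
  next
    show "topspace (odometer_space q) \<subseteq> \<Union>\<U>" unfolding topspace_odometer \<U>_def by blast
  qed
  have f: "restrict x {..n} = restrict y {..n}" if "U \<in> \<U>" "x \<in> U" "y \<in> U" for U x y
    using that unfolding \<U>_def by (intro restrict_ext) auto
  obtain L where L: "cover_entropy (odometer_space q) T \<U> = ereal L"
    "(\<lambda>n. ln (real (subcover_number (odometer_space q) (iterated_join (odometer_space q) T \<U> n))) / real n)
       \<longlonglongrightarrow> L"
    using cover_entropy_real[OF U] .
  let ?N = "\<lambda>n. subcover_number (odometer_space q) (iterated_join (odometer_space q) T \<U> n)"
  have sm: "strict_mono (\<lambda>k. h (n + k))"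
  proof (rule strict_monoI_Suc)
    fix k
    have "2 * h (n + k) \<le> h (n + Suc k)" using q2[of "n + k"] by (simp add: place_Suc)
    then show "h (n + k) < h (n + Suc k)" using place_pos[of "n + k"] by linarith
  qed
  have "(\<lambda>k. ln (real (?N (h (n + k)))) / real (h (n + k))) \<longlonglongrightarrow> L"
    using LIMSEQ_subseq_LIMSEQ[OF L(2) sm] by (simp add: o_def)
  moreover have "(ln (real (q n)) - 6) / real (h n) \<le> ln (real (?N (h (n + k)))) / real (h (n + k))" for k
  proof -
    let ?R = "multiplicity_bound n k"
    have R: "1 \<le> ?R" by (rule multiplicity_bound_pos[OF n])
    have N: "1 \<le> ?N (h (n + k))" by (rule subcover_number_pos[OF open_cover_join[OF U]])
    have qp: "0 < q (n + k)" using q2[of "n + k"] by simp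
    have hp: "0 < real (h (n + k))" using place_pos by simp
    have "q (n + k) \<le> ?N (h (n + k)) * ?R"
      by (rule subcover_number_lower[OF n U]) (rule f)
    then have "real (q (n + k)) \<le> real (?N (h (n + k))) * real ?R"
      by (metis of_nat_le_iff of_nat_mult)
    then have "ln (real (q (n + k))) \<le> ln (real (?N (h (n + k))) * real ?R)"
      using qp R N by (subst ln_le_cancel_iff) simp_all
    also have "\<dots> = ln (real (?N (h (n + k)))) + ln (real ?R)" using R N by (simp add: ln_mult)
    finally have "(ln (real (q (n + k))) - ln (real ?R)) / real (h (n + k))
        \<le> ln (real (?N (h (n + k)))) / real (h (n + k))"
      using hp by (intro divide_right_mono) simp_all
    moreover have "0 \<le> 6 / real (h (n + k))" by simp
    ultimately show ?thesis using log_names_lower[OF n, of k] by linarith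
  qed
  ultimately have "(ln (real (q n)) - 6) / real (h n) \<le> L"
    by (intro LIMSEQ_le_const) auto
  then have "ereal ((ln (real (q n)) - 6) / real (h n)) \<le> cover_entropy (odometer_space q) T \<U>"
    using L(1) by simp
  also have "\<dots> \<le> topological_entropy (odometer_space q) T"
    unfolding topological_entropy_def by (rule SUP_upper) (use U in simp)
  finally show ?thesis .
qed

lemma topological_entropy_eq:
  assumes lim: "(\<lambda>n. ereal (ln (real (q n)) / real (h n))) \<longlonglongrightarrow> \<alpha>"
  shows "topological_entropy (odometer_space q) T = \<alpha>"
proof (rule antisym)
  show "topological_entropy (odometer_space q) T \<le> \<alpha>"
    unfolding topological_entropy_def
  proof (rule SUP_least)
    fix \<U> assume "\<U> \<in> {\<U>. open_cover (odometer_space q) \<U>}"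
    then have "open_cover (odometer_space q) \<U>" by simp
    from cover_entropy_upper[OF this] obtain m where
      m: "\<And>n. m \<le> n \<Longrightarrow> cover_entropy (odometer_space q) T \<U> \<le> ereal (ln (q n) / h n)" by metis
    show "cover_entropy (odometer_space q) T \<U> \<le> \<alpha>"
      by (rule LIMSEQ_le_const[OF lim]) (use m in blast)
  qed
  have hinf: "(\<lambda>n. 6 / real (h n)) \<longlonglongrightarrow> 0"
  proof (rule tendsto_sandwich[where f = "\<lambda>_. 0" and h = "\<lambda>n. 6 / 2 ^ n"])
    show "\<forall>\<^sub>F n in sequentially. 6 / real (h n) \<le> 6 / 2 ^ n"
    proof (rule always_eventually, rule allI)
      fix n
      have "(2 :: real) ^ n \<le> real (h n)" using place_ge_power[of n] by (metis of_nat_le_iff of_nat_numeral of_nat_power)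
      then show "6 / real (h n) \<le> 6 / 2 ^ n" using place_pos[of n] by (intro divide_left_mono) simp_all
    qed
    show "(\<lambda>n. 6 / 2 ^ n :: real) \<longlonglongrightarrow> 0" by real_asymp
  qed simp_all
  have "(\<lambda>n. ereal (ln (real (q n)) / real (h n)) - ereal (6 / real (h n))) \<longlonglongrightarrow> \<alpha> - ereal 0"
    by (intro tendsto_diff_ereal_general lim) (use hinf in simp_all)
  then have "(\<lambda>n. ereal ((ln (real (q n)) - 6) / real (h n))) \<longlonglongrightarrow> \<alpha>"
    by (simp add: diff_divide_distrib)
  then show "\<alpha> \<le> topological_entropy (odometer_space q) T"
    by (rule LIMSEQ_le_const2) (use topological_entropy_lower in blast)
qed

end

subsection \<open>Choice of the digit sizes\<close>

text \<open>The largest exponent that fits below \<open>E\<close>. The premise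
  \<open>p * a \<le> E\<close> guarantees that it is at least \<open>1\<close>.\<close>

lemma power_bracket:
  fixes p a :: nat and E :: real
  assumes "2 \<le> p" "1 \<le> a" "real (p * a) \<le> E"
  obtains k where "1 \<le> k" "real (p ^ k * a) \<le> E" "E < real (p ^ Suc k * a)"
proof -
  define Q where "Q = (\<lambda>k. E < real (p ^ Suc k * a))"
  obtain n where n: "E < real p ^ n" using real_arch_pow[of "real p" E] assms(1) by auto
  have "real p ^ n * 1 \<le> real p ^ Suc n * real a"
    using assms by (intro mult_mono power_increasing) simp_all
  then have "Q n" using n unfolding Q_def by simp
  define k where "k = (LEAST k. Q k)"
  have k: "Q k" unfolding k_def by (rule LeastI) fact
  have "\<not> Q 0" using assms(3) by (simp add: Q_def)
  then have k1: "1 \<le> k" using k by (cases k) simp_all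
  then have "\<not> Q (k - 1)" unfolding k_def by (intro not_less_Least) simp
  then have "real (p ^ k * a) \<le> E" using k1 by (simp add: Q_def flip: power_Suc)
  then show ?thesis using that k1 k unfolding Q_def by blast
qed

text \<open>Each \<open>q j\<close> splits as \<open>p ^ v j * c j\<close> with \<open>c j\<close>
  prime to \<open>p\<close>. A new digit size is the largest \<open>p ^ k * a\<close> below
  \<open>exp (A n * place q' n)\<close>, where \<open>a\<close> is the next cofactor
  \<open>c j\<close> if there is room for it and \<open>1\<close> otherwise. The supply of factors
  \<open>p\<close> never runs out because the exponent of \<open>p\<close> is infinite, and every
  cofactor is inserted eventually because the bound tends to infinity.\<close>

lemma fast_sequence:
  fixes q :: "nat \<Rightarrow> nat" and A :: "nat \<Rightarrow> real"
  assumes q: "\<And>n. 2 \<le> q n" and p: "prime p" and inf: "supernatural_exponent q p = \<infinity>"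
    and A0: "0 < A 0" and A: "mono A"
  obtains q' where "\<And>n. 2 \<le> q' n"
    "\<And>n. 1 \<le> n \<Longrightarrow> ln (real (q' n)) \<le> A n * real (place q' n)"
    "\<And>n. 1 \<le> n \<Longrightarrow> A n * real (place q' n) - ln (real p) \<le> ln (real (q' n))"
    "\<And>n. 1 \<le> n \<Longrightarrow> fact (q' n - 2) \<le> q' (Suc n)"
    "\<And>n. \<exists>N. place q' n dvd place q N"
    "\<And>N. \<exists>n. place q N dvd place q' n"
proof -
  have p2: "2 \<le> p" by (rule prime_ge_2_nat[OF p])
  have An: "A 0 \<le> A n" for n using A by (simp add: monoD)
  define v where "v = (\<lambda>j. multiplicity p (q j))"
  define c where "c = (\<lambda>j. q j div p ^ v j)"
  have qc: "q j = p ^ v j * c j" for j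
    unfolding c_def v_def using multiplicity_dvd[of p "q j"] by simp
  have c1: "1 \<le> c j" for j using qc[of j] q[of j] by (cases "c j") simp_all
  have pc: "\<not> p dvd c j" for j
  proof -
    have "q j \<noteq> 0" "\<not> is_unit p" using q[of j] p2 by auto
    then show ?thesis unfolding c_def v_def by (rule multiplicity_decompose)
  qed
  have place_q: "place q N = p ^ (\<Sum>j<N. v j) * (\<Prod>j<N. c j)" for N
  proof -
    have "place q N = (\<Prod>j<N. p ^ v j * c j)" unfolding place_def qc[symmetric] ..
    then show ?thesis by (simp add: prod.distrib power_sum)
  qed

  \<comment> \<open>A state consists of the place \<open>H\<close>, the digit size \<open>b\<close>
    and the number \<open>j\<close> of cofactors inserted so far. The inequality for
    \<open>p\<close> ensures room for one factor \<open>p\<close> in the next digit size.\<close>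
  define Pst where "Pst = (\<lambda>n (H, b, j). (n = (0::nat) \<longrightarrow> H = (1::nat)) \<and> 1 \<le> H \<and> 1 \<le> b \<and> p dvd b \<and>
      real p \<le> exp (A 0 * real (H * b)) \<and> (\<exists>e. H * b = p ^ e * (\<Prod>i<j. c i)))"
  \<comment> \<open>Postponing a cofactor is allowed only if it does not fit together with one
    factor \<open>p\<close>; this is what later rules out that \<open>j\<close> stalls.\<close>
  define Qst where "Qst = (\<lambda>n (H, b, j) (H', b', j'). H' = H * b \<and>
      real b' \<le> exp (A (Suc n) * real H') \<and> exp (A (Suc n) * real H') < real p * real b' \<and>
      (j' = Suc j \<or> j' = j \<and> exp (A (Suc n) * real H') < real p * real (c j)))"
  have "\<exists>x. Pst 0 x"
  proof -
    \<comment> \<open>The initial digit size only has to start the recursion: it is a power of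
      \<open>p\<close> so large that \<open>exp (A 0 * H)\<close> exceeds \<open>p\<close> from the
      first level on. Hence the growth estimates begin at \<open>n = 1\<close>.\<close>
    obtain k where k: "real p / A 0 < 2 ^ k" using real_arch_pow[of 2 "real p / A 0"] by auto
    have "real p \<le> A 0 * 2 ^ k" using k A0 by (simp add: field_simps)
    also have "\<dots> \<le> A 0 * real (1 * p ^ Suc k)"
    proof -
      have "(2::real) ^ k \<le> real p ^ k" using p2 by (intro power_mono) simp_all
      also have "\<dots> \<le> real p ^ Suc k" using p2 by (intro power_increasing) simp_all
      finally show ?thesis using A0 by (simp del: power_Suc)
    qed
    also have "\<dots> \<le> exp (A 0 * real (1 * p ^ Suc k))"
      using exp_ge_add_one_self[of "A 0 * real (1 * p ^ Suc k)"] by linarith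
    finally have e: "real p \<le> exp (A 0 * real (1 * p ^ Suc k))" .
    have "Pst 0 (1, p ^ Suc k, 0)"
      unfolding Pst_def case_prod_conv
    proof (intro conjI impI e)
      show "1 \<le> p ^ Suc k" using p2 by (intro one_le_power) simp
      show "\<exists>ea. 1 * p ^ Suc k = p ^ ea * (\<Prod>i<0. c i)" by (intro exI[of _ "Suc k"]) simp
    qed simp_all
    then show ?thesis ..
  qed
  moreover have "\<exists>y. Pst (Suc n) y \<and> Qst n x y" if Px: "Pst n x" for x n
  proof -
    obtain H b j where x: "x = (H, b, j)" by (cases x)
    define H' where "H' = H * b"
    have "\<exists>e. H' = p ^ e * (\<Prod>i<j. c i)" and "1 \<le> H \<and> 1 \<le> b"
      and pE: "real p \<le> exp (A 0 * real H')"
      using Px unfolding Pst_def x H'_def case_prod_conv by blast+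
    then obtain e where e: "H' = p ^ e * (\<Prod>i<j. c i)" by blast
    have H'1: "1 \<le> H'" using \<open>1 \<le> H \<and> 1 \<le> b\<close> by (simp add: H'_def)
    define E where "E = exp (A (Suc n) * real H')"
    define a where "a = (if real (p * c j) \<le> E then c j else 1)"
    define j' where "j' = (if real (p * c j) \<le> E then Suc j else j)"
    have pE': "real p \<le> E"
    proof -
      have "exp (A 0 * real H') \<le> E" unfolding E_def using An by (simp add: mult_right_mono)
      then show ?thesis using pE by linarith
    qed
    have "1 \<le> a" "real (p * a) \<le> E" using c1 pE' by (auto simp: a_def)
    from power_bracket[OF p2 this] obtain k where
      k: "1 \<le> k" "real (p ^ k * a) \<le> E" "E < real (p ^ Suc k * a)" .
    define b' where "b' = p ^ k * a"
    have b1: "1 \<le> b'" using p2 \<open>1 \<le> a\<close> by (simp add: b'_def)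
    have "real p \<le> exp (A 0 * real (H' * b'))"
    proof -
      have "H' \<le> H' * b'" using b1 by simp
      then have "A 0 * real H' \<le> A 0 * real (H' * b')" using A0 by (intro mult_left_mono of_nat_mono) simp_all
      then show ?thesis using pE exp_le_cancel_iff order_trans by blast
    qed
    moreover have "p dvd b'" using k(1) by (simp add: b'_def)
    moreover have "H' * b' = p ^ (e + k) * (\<Prod>i<j'. c i)"
      by (simp add: e b'_def a_def j'_def power_add)
    ultimately have "Pst (Suc n) (H', b', j')"
      unfolding Pst_def case_prod_conv using H'1 b1 by blast
    moreover have "Qst n x (H', b', j')"
      unfolding Qst_def x case_prod_conv H'_def[symmetric] E_def[symmetric]
      using k by (auto simp: b'_def j'_def)
    ultimately show ?thesis by blast
  qed
  ultimately obtain f where f: "\<And>n. Pst n (f n)" "\<And>n. Qst n (f n) (f (Suc n))"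
    using dependent_nat_choice[of Pst Qst] by blast
  define H where "H = (\<lambda>n. fst (f n))"
  define q' where "q' = (\<lambda>n. fst (snd (f n)))"
  define j where "j = (\<lambda>n. snd (snd (f n)))"
  have fn: "f n = (H n, q' n, j n)" for n by (simp add: H_def q'_def j_def)
  have P1: "H 0 = 1" "1 \<le> q' n" "p dvd q' n" "\<exists>e. H n * q' n = p ^ e * (\<Prod>i<j n. c i)" for n
    using f(1)[of 0] f(1)[of n] unfolding fn Pst_def by auto
  have Q1: "H (Suc n) = H n * q' n" "real (q' (Suc n)) \<le> exp (A (Suc n) * real (H (Suc n)))"
      "exp (A (Suc n) * real (H (Suc n))) < real p * real (q' (Suc n))"
      "j (Suc n) = Suc (j n) \<or> j (Suc n) = j n \<and> exp (A (Suc n) * real (H (Suc n))) < real p * real (c (j n))" for n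
    using f(2)[of n] unfolding fn Qst_def by auto
  have Hp: "H n = place q' n" for n
    by (induction n) (simp_all add: P1(1) Q1(1) place_Suc mult.commute)
  have qp: "p \<le> q' n" for n using P1(2,3)[of n] by (intro dvd_imp_le) simp_all
  have q'2: "2 \<le> q' n" for n using qp[of n] p2 by linarith
  interpret R: ordered_odometer q' "\<lambda>_ _. id" by (rule ordered_odometer_id[OF q'2])
  have up: "ln (real (q' n)) \<le> A n * real (place q' n)"
    and lo: "A n * real (place q' n) - ln (real p) \<le> ln (real (q' n))" if n: "1 \<le> n" for n
  proof -
    obtain k where k: "n = Suc k" using n by (cases n) simp_all
    have pos: "0 < real (q' n)" "0 < real p" using q'2[of n] p2 by simp_all
    show "ln (real (q' n)) \<le> A n * real (place q' n)"
      using Q1(2)[of k] pos unfolding Hp k by (metis ln_exp ln_le_cancel_iff exp_gt_zero)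
    have "exp (A n * real (place q' n)) \<le> real p * real (q' n)"
      using Q1(3)[of k] unfolding Hp k by simp
    then have "A n * real (place q' n) \<le> ln (real p * real (q' n))"
      using pos by (subst ln_ge_iff) simp_all
    then show "A n * real (place q' n) - ln (real p) \<le> ln (real (q' n))"
      using pos by (simp add: ln_mult)
  qed
  have fa: "fact (q' n - 2) \<le> q' (Suc n)" if n: "1 \<le> n" for n
  proof -
    define b where "b = q' n"
    have b: "2 \<le> b" "p \<le> b" using q'2 qp by (simp_all add: b_def)
    \<comment> \<open>The two factors missing from the factorial leave space for an extra
      \<open>p \<le> b\<close>. It compensates for the factor by which the next digit size may fall
      short of its exponential bound.\<close>
    have "fact (b - 2) \<le> (b - 2) ^ (b - 2)" using fact_le_power[of "b - 2", where 'a = nat] by simp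
    also have "\<dots> \<le> b ^ (b - 2)" by (intro power_mono) simp_all
    also have "\<dots> \<le> b ^ (b - 1)" using b(1) by (intro power_increasing) simp_all
    finally have "p * fact (b - 2) \<le> b * b ^ (b - 1)" using b(2) by (intro mult_mono) simp_all
    also have "\<dots> = b ^ b" using b(1) by (cases b) simp_all
    finally have "real (p * fact (b - 2)) \<le> real (b ^ b)" by (rule of_nat_mono)
    also have "real (b ^ b) = exp (real b * ln (real b))"
      using b(1) by (simp add: exp_of_nat_mult)
    also have "\<dots> \<le> exp (A (Suc n) * real (place q' (Suc n)))"
    proof -
      have "real b * ln (real b) \<le> real b * (A n * real (place q' n))"
        unfolding b_def using up[OF n] by (intro mult_left_mono) simp_all
      also have "\<dots> = A n * real (place q' (Suc n))" by (simp add: place_Suc b_def)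
      also have "\<dots> \<le> A (Suc n) * real (place q' (Suc n))"
        using A by (intro mult_right_mono monoD[of A]) simp_all
      finally show ?thesis by simp
    qed
    also have "\<dots> < real p * real (q' (Suc n))" using Q1(3)[of n] unfolding Hp .
    finally have "real (p * fact (b - 2)) < real (p * q' (Suc n))" by simp
    then have "p * fact (b - 2) < p * q' (Suc n)" by (simp only: of_nat_less_iff)
    then show ?thesis unfolding b_def by simp
  qed
  have d1: "\<exists>N. place q' n dvd place q N" for n
  proof -
    have "\<exists>e J. place q' n = p ^ e * (\<Prod>i<J. c i)"
    proof (cases n)
      case 0
      then show ?thesis by (intro exI[of _ 0]) simp
    next
      case (Suc m)
      then show ?thesis using P1(4)[of m] by (auto simp: Hp place_Suc mult.commute)
    qed
    then obtain e J where e: "place q' n = p ^ e * (\<Prod>i<J. c i)" by blast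
    have "\<exists>N. e \<le> (\<Sum>i<N. v i)"
    proof (rule ccontr)
      assume "\<not> ?thesis"
      then have le: "(\<Sum>i<N. v i) \<le> e" for N by (simp add: not_le less_imp_le)
      have "(\<Sum>i. enat (v i)) \<le> enat e"
      proof (rule suminf_le_const)
        fix N
        have "(\<Sum>i<N. enat (v i)) = enat (\<Sum>i<N. v i)" by (induction N) (simp_all add: zero_enat_def)
        then show "(\<Sum>i<N. enat (v i)) \<le> enat e" using le by simp
      qed (rule summableI)
      then show False using inf unfolding supernatural_exponent_def v_def by simp
    qed
    then obtain N0 where N0: "e \<le> (\<Sum>i<N0. v i)" ..
    define N where "N = max N0 J"
    have "(\<Sum>i<N0. v i) \<le> (\<Sum>i<N. v i)" by (rule sum_mono2) (auto simp: N_def)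
    then have "p ^ e dvd p ^ (\<Sum>i<N. v i)" using N0 by (intro le_imp_power_dvd) simp
    moreover have "(\<Prod>i<J. c i) dvd (\<Prod>i<N. c i)"
      by (rule prod_dvd_prod_subset) (auto simp: N_def)
    ultimately show ?thesis unfolding e place_q by (intro exI[of _ N] mult_dvd_mono)
  qed
  have jS: "j n \<le> j (Suc n)" for n using Q1(4)[of n] by auto
  have jm: "j m \<le> j n" if "m \<le> n" for m n using lift_Suc_mono_le[of j, OF jS that] .
  have jinf: "\<exists>n. N \<le> j n" for N
  proof (induction N)
    case (Suc N)
    then obtain n where n: "N \<le> j n" ..
    show ?case
    proof (rule ccontr)
      assume no: "\<not> ?case"
      have jN: "j m = N" if "n \<le> m" for m using no n jm[OF that] by (metis le_antisym not_less_eq_eq le_trans)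
      \<comment> \<open>If the insertion stalled at cofactor \<open>N\<close>, the exponential
        bounds would remain below the fixed number \<open>p * c N\<close>, although they exceed
        \<open>A 0 * 2 ^ Suc m\<close> for all large \<open>m\<close>.\<close>
      have bound: "A 0 * 2 ^ Suc m < real p * real (c N)" if "n \<le> m" for m
      proof -
        have "(2::real) ^ Suc m \<le> real (place q' (Suc m))"
          using R.place_ge_power[of "Suc m"] by (metis of_nat_le_iff of_nat_numeral of_nat_power)
        then have "A 0 * 2 ^ Suc m \<le> A (Suc m) * real (place q' (Suc m))"
          using An[of "Suc m"] A0 by (intro mult_mono) simp_all
        also have "\<dots> \<le> exp (A (Suc m) * real (place q' (Suc m)))"
          using exp_ge_add_one_self[of "A (Suc m) * real (place q' (Suc m))"] by linarith
        also have "\<dots> < real p * real (c N)" using Q1(4)[of m] jN[of m] jN[of "Suc m"] that by (simp add: Hp)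
        finally show ?thesis .
      qed
      obtain k where k: "real p * real (c N) / A 0 < 2 ^ k" using real_arch_pow[of 2] by auto
      have "(2::real) ^ k \<le> 2 ^ Suc (n + k)" by (rule power_increasing) simp_all
      then have "real p * real (c N) / A 0 < 2 ^ Suc (n + k)" using k by linarith
      then have "real p * real (c N) < A 0 * 2 ^ Suc (n + k)"
        using A0 by (simp add: pos_divide_less_eq mult.commute)
      then show False using bound[of "n + k"] by simp
    qed
  qed simp
  have pd: "p ^ n dvd place q' n" for n
    by (induction n) (simp_all add: place_Suc mult_dvd_mono P1(3))
  have d2: "\<exists>n. place q N dvd place q' n" for N
  proof -
    define V where "V = (\<Sum>i<N. v i)"
    obtain n0 where n0: "N \<le> j n0" using jinf by blast
    define n where "n = max n0 V"
    have jn: "N \<le> j n" using n0 jm[of n0 n] by (simp add: n_def)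
    obtain e where e: "place q' (Suc n) = p ^ e * (\<Prod>i<j n. c i)"
      using P1(4)[of n] by (auto simp: Hp place_Suc mult.commute)
    have "(\<Prod>i<N. c i) dvd (\<Prod>i<j n. c i)" by (rule prod_dvd_prod_subset) (use jn in auto)
    then have "(\<Prod>i<N. c i) dvd place q' (Suc n)" unfolding e by simp
    moreover have "p ^ V dvd place q' (Suc n)"
    proof (rule dvd_trans[OF le_imp_power_dvd pd])
      show "V \<le> Suc n" by (simp add: n_def)
    qed
    \<comment> \<open>Powers of \<open>p\<close> and cofactors are supplied at unrelated levels;
      coprimality allows their divisibilities to be combined.\<close>
    moreover have "coprime (p ^ V) (\<Prod>i<N. c i)"
    proof -
      have "coprime p (c i)" for i using prime_imp_coprime[OF p pc] .
      then have "coprime p (\<Prod>i<N. c i)" by (intro prod_coprime_right)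
      then show ?thesis by simp
    qed
    ultimately have "place q N dvd place q' (Suc n)"
      unfolding place_q V_def[symmetric] by (intro divides_mult)
    then show ?thesis ..
  qed
  show ?thesis by (rule that[OF q'2 up lo fa d1 d2])
qed

subsection \<open>Summability of the cocycles\<close>

text \<open>Cocycles are integer valued, and by monotonicity the least natural number in the domain
  gives the bound. On real arguments the iterated logarithm can come arbitrarily close to zero for
  \<open>m\<close> \<ge> 1, so the restriction to integers matters.\<close>

lemma phi_domain_lower_bound:
  "\<exists>\<delta>>0. \<forall>k::nat. real k \<in> phi_domain m \<longrightarrow> \<delta> \<le> (ln ^^ m) (real k)"
proof (cases "\<exists>k::nat. real k \<in> phi_domain m")
  case True
  define k0 where "k0 = (LEAST k::nat. real k \<in> phi_domain m)"
  have k0: "real k0 \<in> phi_domain m" unfolding k0_def using True by (rule LeastI_ex)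
  then have pos: "0 < (ln ^^ j) (real k0)" if "j \<le> m" for j using that by (simp add: phi_domain_def)
  have "(ln ^^ m) (real k0) \<le> (ln ^^ m) (real k)" if "real k \<in> phi_domain m" for k
  proof -
    have "k0 \<le> k" unfolding k0_def using that by (rule Least_le)
    have "(ln ^^ j) (real k0) \<le> (ln ^^ j) (real k)" if "j \<le> m" for j
      using that
    proof (induction j)
      case (Suc j)
      then have "(ln ^^ j) (real k0) \<le> (ln ^^ j) (real k)" "0 < (ln ^^ j) (real k0)" using pos[of j] by simp_all
      then show ?case by (simp add: ln_mono)
    qed (use \<open>k0 \<le> k\<close> in simp)
    then show ?thesis by simp
  qed
  then show ?thesis using pos[of m] by blast
next
  case False
  then show ?thesis by (intro exI[of _ 1]) simp
qed

text \<open>Since \<open>g\<close> grows at least exponentially from one index to the next, each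
  logarithm costs at most one index.\<close>

lemma iterated_ln_ge:
  fixes g :: "nat \<Rightarrow> real"
  assumes g: "\<And>n. N \<le> n \<Longrightarrow> 0 < g n" "\<And>n. N \<le> n \<Longrightarrow> g n \<le> ln (g (Suc n))"
    and t: "0 < t" "g n \<le> ln t"
  shows "N + m \<le> n \<Longrightarrow> g (n - m) \<le> (ln ^^ m) t"
proof (induction m)
  case 0
  have "ln t \<le> t" using ln_le_minus_one[OF t(1)] by linarith
  then show ?case using t by simp
next
  case (Suc m)
  then have IH: "g (n - m) \<le> (ln ^^ m) t" by simp
  have n: "n - m = Suc (n - Suc m)" using Suc.prems by simp
  have "g (n - Suc m) \<le> ln (g (n - m))" using g(2)[of "n - Suc m"] Suc.prems n by simp
  also have "\<dots> \<le> ln ((ln ^^ m) t)" using g(1)[of "n - m"] IH Suc.prems by (intro ln_mono) simp_all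
  finally show ?case by simp
qed

text \<open>\<open>A n\<close> is the target for \<open>ln (q n) / h n\<close>, with error at most
  \<open>lp / h n\<close>. The linear bound on \<open>A\<close> admits rates that tend to infinity
  slowly.\<close>

locale fast_odometer = ordered_odometer +
  fixes A :: "nat \<Rightarrow> real" and C lp :: real
  assumes A_pos: "0 < A 0" and A_mono: "mono A" and A_le: "A n \<le> C * real (Suc n)"
    and ln_q_le: "1 \<le> n \<Longrightarrow> ln (real (q n)) \<le> A n * real (h n)"
    and ln_q_ge: "1 \<le> n \<Longrightarrow> A n * real (h n) - lp \<le> ln (real (q n))"
begin

lemma real_place_ge_power: "(2::real) ^ n \<le> real (h n)"
  using place_ge_power[of n] by (metis of_nat_le_iff of_nat_numeral of_nat_power)

lemma real_place_at_top: "filterlim (\<lambda>n. real (h n)) at_top sequentially"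
proof (rule filterlim_at_top_mono)
  show "filterlim (\<lambda>n. (2::real) ^ n) at_top sequentially" by real_asymp
qed (use real_place_ge_power in simp)

text \<open>For \<open>h\<close> itself the inequality can fail when \<open>A 0\<close> is small.
  Passing to square roots absorbs the constants, because
  \<open>2 * sqrt x + lp \<le> A 0 * x\<close> for large \<open>x\<close>.\<close>

lemma sqrt_growth: "\<forall>\<^sub>F n in sequentially. sqrt (real (h n)) \<le> ln (sqrt (real (h (Suc n))))"
proof -
  have "\<forall>\<^sub>F x in at_top. 2 * sqrt x + lp \<le> A 0 * x" using A_pos by real_asymp
  then have "\<forall>\<^sub>F n in sequentially. 2 * sqrt (real (h n)) + lp \<le> A 0 * real (h n)"
    using real_place_at_top by (rule eventually_compose_filterlim)
  then show ?thesis
    using eventually_ge_at_top[of 1]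
  proof eventually_elim
    case (elim n)
    have p: "1 \<le> real (h n)" "0 < real (q n)" using place_pos[of n] q2[of n] by simp_all
    have "A 0 * real (h n) \<le> A n * real (h n)" using A_mono by (intro mult_right_mono monoD[of A]) simp_all
    then have "2 * sqrt (real (h n)) \<le> ln (real (q n))" using elim ln_q_ge[of n] by linarith
    also have "\<dots> \<le> ln (real (h n)) + ln (real (q n))" using p by simp
    also have "\<dots> = ln (real (h (Suc n)))" using p by (simp add: place_Suc ln_mult)
    also have "\<dots> = 2 * ln (sqrt (real (h (Suc n))))" using place_pos[of "Suc n"] by (simp add: ln_sqrt)
    finally show ?case by simp
  qed
qed

lemma sqrt_ge_power: "\<forall>\<^sub>F n in sequentially. 4 ^ n \<le> sqrt (real (h n))"
proof -
  have "\<forall>\<^sub>F n in sequentially. 4 ^ Suc n \<le> exp (sqrt (2 ^ n :: real))" by real_asymp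
  then have "\<forall>\<^sub>F n in sequentially. 4 ^ Suc n \<le> sqrt (real (h (Suc n)))"
    using sqrt_growth
  proof eventually_elim
    case (elim n)
    have "sqrt (2 ^ n) \<le> ln (sqrt (real (h (Suc n))))" using elim(2) real_place_ge_power[of n]
      by (meson order_trans real_sqrt_le_mono)
    then have "exp (sqrt (2 ^ n)) \<le> sqrt (real (h (Suc n)))"
      using place_pos[of "Suc n"] by (simp add: ln_ge_iff)
    then show ?case using elim(1) by linarith
  qed
  then show ?thesis
    using eventually_sequentially_Suc[of "\<lambda>n. 4 ^ n \<le> sqrt (real (h n))"] by blast
qed

lemma ln_place_Suc_le:
  assumes "1 \<le> n" shows "ln (real (h (Suc n))) \<le> (1 + C) * real (Suc n) * real (h n)"
proof -
  have p: "0 < real (h n)" "0 < real (q n)" using place_pos[of n] q2[of n] by simp_all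
  have "ln (real (h (Suc n))) = ln (real (h n)) + ln (real (q n))" using p by (simp add: place_Suc ln_mult)
  also have "ln (real (h n)) \<le> real (h n)" using ln_le_minus_one[OF p(1)] by linarith
  also have "\<dots> \<le> real (Suc n) * real (h n)" using p by (simp add: mult_le_cancel_right1 del: of_nat_Suc)
  also have "ln (real (q n)) \<le> A n * real (h n)" by (rule ln_q_le[OF assms])
  also have "\<dots> \<le> (C * real (Suc n)) * real (h n)" using A_le by (intro mult_right_mono) simp_all
  finally show ?thesis by (simp add: algebra_simps)
qed

text \<open>\<phi> is arbitrary on part of its domain and is not assumed monotone, so its value at
  \<open>h (Suc n)\<close> need not bound the earlier ones.\<close>

definition phi_max :: "(real \<Rightarrow> real) \<Rightarrow> nat \<Rightarrow> real" where
  "phi_max \<phi> n = Max ((\<lambda>k. \<phi> (real k)) ` {..h (Suc n)})"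

lemma phi_max_ge: "k \<le> h (Suc n) \<Longrightarrow> \<phi> (real k) \<le> phi_max \<phi> n"
  unfolding phi_max_def by (intro Max_ge) auto

text \<open>With \<open>g = sqrt h\<close>, the case \<open>ln k < g n\<close> gives \<phi> at most
  \<open>g n / \<delta>\<close>. Otherwise the iterated logarithm is at least
  \<open>g (n - m)\<close>, while \<open>ln k\<close> is at most
  \<open>(1 + C) * (n + 1) * h n\<close>. After division by \<open>h n\<close> the bounds are
  \<open>1 / (\<delta> * g n)\<close> and \<open>(1 + C) * (n + 1) / g (n - m)\<close>; since
  \<open>g n \<ge> 4 ^ n\<close> eventually, both are summable.\<close>

lemma phi_max_summable:
  assumes phi: "is_phi m \<phi>"
  shows "summable (\<lambda>n. phi_max \<phi> n / real (h n))"
proof -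
  define g where "g = (\<lambda>n. sqrt (real (h n)))"
  have nn: "0 \<le> \<phi> t" if "0 \<le> t" for t using phi that by (simp add: is_phi_def)
  obtain D where D: "\<And>t. 0 \<le> t \<Longrightarrow> t \<notin> phi_domain m \<Longrightarrow> \<phi> t \<le> D"
  proof -
    have "bounded (\<phi> ` ({0..} - phi_domain m))" using phi by (simp add: is_phi_def)
    then obtain D where D: "\<And>y. y \<in> \<phi> ` ({0..} - phi_domain m) \<Longrightarrow> norm y \<le> D"
      unfolding bounded_iff by blast
    have "\<phi> t \<le> D" if "0 \<le> t" "t \<notin> phi_domain m" for t using D[of "\<phi> t"] that by auto
    then show ?thesis by (rule that)
  qed
  obtain \<delta> where \<delta>: "0 < \<delta>" "\<And>k::nat. real k \<in> phi_domain m \<Longrightarrow> \<delta> \<le> (ln ^^ m) (real k)"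
    using phi_domain_lower_bound by blast
  obtain n1 where n1: "\<And>n. n1 \<le> n \<Longrightarrow> g n \<le> ln (g (Suc n))"
    using sqrt_growth unfolding g_def eventually_sequentially by blast
  obtain n2 where n2: "\<And>n. n2 \<le> n \<Longrightarrow> 4 ^ n \<le> g n"
    using sqrt_ge_power unfolding g_def eventually_sequentially by blast
  define n0 where "n0 = max 1 (max n1 n2)"
  have gp: "0 < g n" for n using place_pos[of n] by (simp add: g_def)
  have gg: "g n * g n = real (h n)" for n by (simp add: g_def)
  have C0: "0 \<le> C" using A_pos A_le[of 0] by simp
  have bound: "phi_max \<phi> n / real (h n)
      \<le> (\<bar>D\<bar> + 1 / \<delta>) * (1 / 4) ^ n + ((1 + C) * 4 ^ m) * (real (Suc n) * (1 / 4) ^ n)"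
    if n: "n0 + m \<le> n" for n
  proof -
    have "\<phi> (real k) \<le> (\<bar>D\<bar> + 1 / \<delta>) * g n + (1 + C) * real (Suc n) * real (h n) / g (n - m)"
      if k: "k \<le> h (Suc n)" for k
    proof -
      have g1: "1 \<le> g n" using place_pos[of n] by (simp add: g_def)
      have p2: "0 \<le> (1 + C) * real (Suc n) * real (h n) / g (n - m)"
        using C0 gp[of "n - m"] by simp
      have p3: "0 \<le> 1 / \<delta> * g n" "0 \<le> \<bar>D\<bar> * g n" using \<delta>(1) g1 by simp_all
      show ?thesis
      proof (cases "real k \<in> phi_domain m")
        case False
        then have "\<phi> (real k) \<le> \<bar>D\<bar>" using D[of "real k"] by simp
        also have "\<dots> \<le> \<bar>D\<bar> * g n" using g1 by (simp add: mult_le_cancel_left1)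
        finally show ?thesis using p2 p3 by (simp add: distrib_right)
      next
        case True
        then have e: "\<phi> (real k) = ln (real k) / (ln ^^ m) (real k)" using phi by (simp add: is_phi_def)
        have l0: "0 \<le> ln (real k)" "0 < real k" using True by (auto simp: phi_domain_def)
        show ?thesis
        proof (cases "ln (real k) < g n")
          case True
          have "\<phi> (real k) \<le> g n / \<delta>" unfolding e
            using True \<delta>(2)[OF \<open>real k \<in> _\<close>] \<delta>(1) l0 gp[of n] by (intro frac_le) simp_all
          then show ?thesis using p2 p3 by (simp add: distrib_right)
        next
          case False
          then have "g n \<le> ln (real k)" by simp
          then have "g (n - m) \<le> (ln ^^ m) (real k)"
            by (intro iterated_ln_ge[where N = n0]) (use gp n1 l0 n in \<open>auto simp: n0_def\<close>)
          moreover have "ln (real k) \<le> (1 + C) * real (Suc n) * real (h n)"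
          proof -
            have "ln (real k) \<le> ln (real (h (Suc n)))" using l0(2) k by (intro ln_mono) simp_all
            moreover have "1 \<le> n" using n unfolding n0_def by linarith
            ultimately show ?thesis using ln_place_Suc_le[of n] by linarith
          qed
          ultimately have "\<phi> (real k) \<le> (1 + C) * real (Suc n) * real (h n) / g (n - m)"
            unfolding e using l0 gp C0 by (intro frac_le) simp_all
          then show ?thesis using p3 by (simp add: distrib_right)
        qed
      qed
    qed
    then have "phi_max \<phi> n \<le> (\<bar>D\<bar> + 1 / \<delta>) * g n + (1 + C) * real (Suc n) * real (h n) / g (n - m)"
      unfolding phi_max_def by (subst Max_le_iff) auto
    then have "phi_max \<phi> n / real (h n)
        \<le> ((\<bar>D\<bar> + 1 / \<delta>) * g n + (1 + C) * real (Suc n) * real (h n) / g (n - m)) / real (h n)"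
      by (rule divide_right_mono) simp
    also have "\<dots> = (\<bar>D\<bar> + 1 / \<delta>) * (1 / g n) + (1 + C) * real (Suc n) * (1 / g (n - m))"
      using gp[of n] place_pos[of n] unfolding gg[symmetric] by (simp add: add_divide_distrib)
    also have "\<dots> \<le> (\<bar>D\<bar> + 1 / \<delta>) * (1 / 4 ^ n) + (1 + C) * real (Suc n) * (1 / 4 ^ (n - m))"
    proof (intro add_mono mult_left_mono)
      show "1 / g n \<le> 1 / 4 ^ n" using n2[of n] n by (intro divide_left_mono) (simp_all add: n0_def gp)
      show "1 / g (n - m) \<le> 1 / 4 ^ (n - m)"
        using n2[of "n - m"] n by (intro divide_left_mono) (simp_all add: n0_def gp)
    qed (use \<delta>(1) C0 in simp_all)
    also have "(1 / 4 ^ (n - m) :: real) = 4 ^ m * (1 / 4) ^ n"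
      using n by (simp add: power_diff power_one_over)
    finally show ?thesis by (simp only: power_one_over mult.assoc mult.left_commute mult.commute)
  qed
  have "summable (\<lambda>n. (\<bar>D\<bar> + 1 / \<delta>) * (1 / 4 :: real) ^ n + ((1 + C) * 4 ^ m) * (real (Suc n) * (1 / 4) ^ n))"
  proof (intro summable_add summable_mult)
    show "summable (\<lambda>n. (1 / 4 :: real) ^ n)" by (rule summable_geometric) simp
    show "summable (\<lambda>n. real (Suc n) * (1 / 4 :: real) ^ n)"
    proof (rule summable_comparison_test'[where N = 0])
      show "summable (\<lambda>n. (1 / 2 :: real) ^ n * 2)" by (intro summable_mult2 summable_geometric) simp
      fix n :: nat
      have "n < 2 ^ n" by (rule less_exp)
      then have "Suc n \<le> 2 ^ n" by (rule Suc_leI)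
      then have "real (Suc n) \<le> 2 ^ n" by (metis of_nat_le_iff of_nat_numeral of_nat_power)
      then have "real (Suc n) * (1 / 4) ^ n \<le> 2 ^ n * (1 / 4) ^ n" by (intro mult_right_mono) simp_all
      also have "\<dots> = (1 / 2 :: real) ^ n" by (simp add: power_mult_distrib[symmetric])
      finally have "real (Suc n) * (1 / 4) ^ n \<le> (1 / 2 :: real) ^ n" .
      moreover have "0 \<le> (1 / 2 :: real) ^ n" by simp
      ultimately have "real (Suc n) * (1 / 4) ^ n \<le> (1 / 2 :: real) ^ n * 2" by linarith
      then show "norm (real (Suc n) * (1 / 4) ^ n) \<le> (1 / 2 :: real) ^ n * 2" by simp
    qed
  qed
  then show ?thesis
  proof (rule summable_comparison_test'[where N = "n0 + m"])
    fix n assume n: "n0 + m \<le> n"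
    have "0 \<le> phi_max \<phi> n" using phi_max_ge[of 0 n \<phi>] nn[of 0] by simp
    then have e: "norm (phi_max \<phi> n / real (h n)) = phi_max \<phi> n / real (h n)" by simp
    show "norm (phi_max \<phi> n / real (h n))
        \<le> (\<bar>D\<bar> + 1 / \<delta>) * (1 / 4) ^ n + ((1 + C) * 4 ^ m) * (real (Suc n) * (1 / 4) ^ n)"
      unfolding e by (rule bound[OF n])
  qed
qed

text \<open>The integrand is majorised by the sum of \<open>phi_max \<phi> n\<close> times the
  indicators of the sets \<open>M n\<close>, which may overlap. Integrating term by term leads to
  the series of \<open>phi_max_summable\<close>.\<close>

lemma phi_integral_finite:
  assumes phi: "is_phi m \<phi>"
    and M: "\<And>n. M n \<in> sets \<mu>" "\<And>n. emeasure \<mu> (M n) \<le> ennreal (1 / real (h n))"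
    and c: "\<And>x. x \<in> space \<mu> \<Longrightarrow> \<exists>n. x \<in> M n \<and> \<bar>c x\<bar> \<le> int (h (Suc n))"
  shows "(\<integral>\<^sup>+ x. ennreal (\<phi> (real_of_int \<bar>c x\<bar>)) \<partial>\<mu>) < \<infinity>"
proof -
  have nn: "0 \<le> phi_max \<phi> n" for n
    using phi_max_ge[of 0 n \<phi>] phi unfolding is_phi_def by force
  have "(\<integral>\<^sup>+ x. ennreal (\<phi> (real_of_int \<bar>c x\<bar>)) \<partial>\<mu>)
      \<le> (\<integral>\<^sup>+ x. (\<Sum>n. ennreal (phi_max \<phi> n) * indicator (M n) x) \<partial>\<mu>)"
  proof (rule nn_integral_mono)
    fix x assume "x \<in> space \<mu>"
    then obtain n where n: "x \<in> M n" "\<bar>c x\<bar> \<le> int (h (Suc n))" using c by blast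
    have "nat \<bar>c x\<bar> \<le> h (Suc n)" using n(2) by simp
    then have "\<phi> (real (nat \<bar>c x\<bar>)) \<le> phi_max \<phi> n" by (rule phi_max_ge)
    then have "ennreal (\<phi> (real_of_int \<bar>c x\<bar>)) \<le> ennreal (phi_max \<phi> n) * indicator (M n) x"
      using n(1) by (simp add: ennreal_leI)
    also have "\<dots> \<le> (\<Sum>n. ennreal (phi_max \<phi> n) * indicator (M n) x)"
    proof -
      define F where "F = (\<lambda>n. ennreal (phi_max \<phi> n) * indicator (M n) x)"
      have "sum F {n} \<le> suminf F" by (rule sum_le_suminf) simp_all
      then have "F n \<le> suminf F" by simp
      then show ?thesis unfolding F_def .
    qed
    finally show "ennreal (\<phi> (real_of_int \<bar>c x\<bar>)) \<le> (\<Sum>n. ennreal (phi_max \<phi> n) * indicator (M n) x)" .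
  qed
  also have "\<dots> = (\<Sum>n. \<integral>\<^sup>+ x. ennreal (phi_max \<phi> n) * indicator (M n) x \<partial>\<mu>)"
    by (rule nn_integral_suminf) (use M in measurable)
  also have "\<dots> = (\<Sum>n. ennreal (phi_max \<phi> n) * emeasure \<mu> (M n))"
    using M by (simp add: nn_integral_cmult_indicator)
  also have "\<dots> \<le> (\<Sum>n. ennreal (phi_max \<phi> n / real (h n)))"
  proof (intro suminf_le summableI)
    fix n
    have "ennreal (phi_max \<phi> n) * emeasure \<mu> (M n) \<le> ennreal (phi_max \<phi> n) * ennreal (1 / real (h n))"
      using M(2) by (intro mult_left_mono) simp_all
    also have "\<dots> = ennreal (phi_max \<phi> n / real (h n))" using nn by (simp add: ennreal_mult[symmetric])
    finally show "ennreal (phi_max \<phi> n) * emeasure \<mu> (M n) \<le> ennreal (phi_max \<phi> n / real (h n))" .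
  qed
  also have "\<dots> < \<infinity>"
    using phi_max_summable[OF phi] nn by (simp add: suminf_ennreal2 less_top[symmetric])
  finally show ?thesis .
qed

end

subsection \<open>The strong orbit equivalence\<close>

lemma homeo_pow_semiconj:
  assumes f: "bij_betw f (topspace X) (topspace X)" and g: "bij_betw g (topspace Y) (topspace Y)"
    and F: "\<And>x. x \<in> topspace X \<Longrightarrow> F x \<in> topspace Y"
    and c: "\<And>x. x \<in> topspace X \<Longrightarrow> F (f x) = g (F x)"
    and x: "x \<in> topspace X"
  shows "homeo_pow X f k x \<in> topspace X" "F (homeo_pow X f k x) = homeo_pow Y g k (F x)"
proof -
  let ?f' = "inv_into (topspace X) f" and ?g' = "inv_into (topspace Y) g"
  have f': "f y \<in> topspace X" "?f' y \<in> topspace X" "f (?f' y) = y" if "y \<in> topspace X" for y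
    using that f bij_betw_inv_into_right[OF f that] by (auto simp: bij_betw_def inv_into_into)
  have c': "F (?f' y) = ?g' (F y)" if "y \<in> topspace X" for y
  proof -
    have "g (F (?f' y)) = F y" using c[of "?f' y"] f' that by simp
    then show ?thesis
      using bij_betw_inv_into_left[OF g, of "F (?f' y)"] F f' that by simp
  qed
  have "(f ^^ j) x \<in> topspace X \<and> F ((f ^^ j) x) = (g ^^ j) (F x)" for j
    by (induction j) (simp_all add: x f' c)
  moreover have "(?f' ^^ j) x \<in> topspace X \<and> F ((?f' ^^ j) x) = (?g' ^^ j) (F x)" for j
    by (induction j) (simp_all add: x f' c')
  ultimately show "homeo_pow X f k x \<in> topspace X" "F (homeo_pow X f k x) = homeo_pow Y g k (F x)"
    unfolding homeo_pow_def by simp_all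
qed

context ordered_odometer
begin

lemma Z_Suc: "x \<in> dseqs q \<Longrightarrow> Z (k + 1) x = T (Z k x)"
proof (cases k rule: int_cases3)
  case zero
  then show ?thesis by (simp add: homeo_pow_def)
next
  case (pos n)
  then have "k + 1 = int (Suc n)" by simp
  then show ?thesis using pos by (simp only: Z_nat funpow.simps comp_apply)
next
  case (neg n)
  assume x: "x \<in> dseqs q"
  have k: "k = - int (Suc (n - 1))" "k + 1 = - int (n - 1)" using neg by simp_all
  have w: "Z k x \<in> dseqs q" by (rule Z_dseqs[OF x])
  have "(T ^^ (n - 1)) (T (Z k x)) = x"
    using Z_neg(2)[OF x, of "Suc (n - 1)"] unfolding k(1)[symmetric] by (simp add: funpow_swap1)
  then show ?thesis unfolding k(2) by (rule Z_negI[OF vershik_dseqs[OF w]])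
qed

lemma Z_add: "x \<in> dseqs q \<Longrightarrow> Z k (Z l x) = Z (k + l) x"
proof (induction k rule: int_induct[where k = 0])
  case base
  then show ?case by (simp add: homeo_pow_def)
next
  case (step1 k)
  then show ?case using Z_Suc[OF Z_dseqs[OF step1(3)], of k l] Z_Suc[OF step1(3), of "k + l"]
    by (simp add: ac_simps)
next
  case (step2 k)
  have "T (Z (k - 1) (Z l x)) = T (Z (k - 1 + l) x)"
    using Z_Suc[OF Z_dseqs[OF step2(3)], of "k - 1" l] Z_Suc[OF step2(3), of "k - 1 + l"] step2
    by (simp add: ac_simps)
  then show ?case using inj_onD[OF vershik_inj] Z_dseqs step2(3) by metis
qed

end

lemma vershik_step_in_orbit:
  assumes "ordered_odometer q s" "ordered_odometer q s'" and x: "x \<in> dseqs q"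
  shows "\<exists>k. vershik q s' x = homeo_pow (odometer_space q) (vershik q s) k x"
proof (cases "x = top_seq q")
  case True
  then show ?thesis using vershik_crossing_top[OF assms(1,2)] by blast
next
  case False
  obtain n where n: "agree n x (top_seq q)" "x n \<noteq> top_seq q n"
    using ordered_odometer.first_nontop[OF assms(1) False] .
  obtain k where "\<bar>k\<bar> < int (place q (Suc n))" and "\<forall>y\<in>dseqs q. agree (n + 2) y x \<longrightarrow>
       vershik q s' y = homeo_pow (odometer_space q) (vershik q s) k y"
    using vershik_crossing[OF assms n] .
  then show ?thesis using x by blast
qed

lemma vershik_orbit_subset:
  assumes "ordered_odometer q s" "ordered_odometer q s'" and x: "x \<in> dseqs q"
  shows "homeo_orbit (odometer_space q) (vershik q s') x \<subseteq> homeo_orbit (odometer_space q) (vershik q s) x"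
proof -
  interpret A: ordered_odometer q s by fact
  interpret B: ordered_odometer q s' by fact
  have pos: "\<exists>k. (B.T ^^ j) y = A.Z k y" if y: "y \<in> dseqs q" for j y
  proof (induction j)
    case 0
    show ?case by (intro exI[of _ 0]) (simp add: homeo_pow_def)
  next
    case (Suc j)
    then obtain l where l: "(B.T ^^ j) y = A.Z l y" ..
    obtain k where "B.T ((B.T ^^ j) y) = A.Z k ((B.T ^^ j) y)"
      using vershik_step_in_orbit[OF assms(1,2) B.vershik_funpow_dseqs[OF y]] by blast
    then have "(B.T ^^ Suc j) y = A.Z (k + l) y" using l A.Z_add[OF y] by simp
    then show ?case ..
  qed
  have "\<exists>k. B.Z l x = A.Z k x" for l
  proof (cases l rule: int_cases2)
    case (nonneg j)
    then show ?thesis using pos[OF x] B.Z_nat by simp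
  next
    case (nonpos j)
    let ?w = "B.Z l x"
    have w: "?w \<in> dseqs q" "(B.T ^^ j) ?w = x" using B.Z_neg[OF x, of j] nonpos by simp_all
    obtain k where k: "x = A.Z k ?w" using pos[OF w(1), of j] unfolding w(2) ..
    have "A.Z (- k) (A.Z k ?w) = A.Z (- k + k) ?w" by (rule A.Z_add[OF w(1)])
    also have "\<dots> = ?w" by (simp add: homeo_pow_def)
    finally show ?thesis unfolding k[symmetric] by (intro exI[of _ "- k"]) (rule sym)
  qed
  then show ?thesis unfolding homeo_orbit_def by auto
qed

lemma vershik_orbit_eq:
  assumes "ordered_odometer q s" "ordered_odometer q s'" and x: "x \<in> dseqs q"
  shows "homeo_orbit (odometer_space q) (vershik q s') x = homeo_orbit (odometer_space q) (vershik q s) x"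
  by (rule equalityI[OF vershik_orbit_subset[OF assms] vershik_orbit_subset[OF assms(2,1) x]])

text \<open>The equivalence is the base change \<Phi> alone: it conjugates the given odometer to the
  odometer in base \<open>q'\<close>, whose orbits are those of \<open>T\<close> on the same space.
  The two cocycles come from \<open>vershik_crossing\<close>, applied in both directions.\<close>

locale strong_oe =
  F: odometer_pair q q' + F': odometer_pair q' q + V: ordered_odometer q' s
  for q q' :: "nat \<Rightarrow> nat" and s :: "nat \<Rightarrow> nat \<Rightarrow> nat \<Rightarrow> nat"
begin

sublocale O: ordered_odometer q' "\<lambda>_ _. id" by (rule ordered_odometer_id[OF V.q2])
sublocale O0: ordered_odometer q "\<lambda>_ _. id" by (rule ordered_odometer_id[OF F.q2])

abbreviation \<Phi> where "\<Phi> \<equiv> transfer_seq q q'"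
abbreviation T where "T \<equiv> vershik q' s"
abbreviation c_source where
  "c_source \<equiv> source_cocycle (odometer_space q) (odometer q) (odometer_space q') T \<Phi>"
abbreviation c_target where
  "c_target \<equiv> target_cocycle (odometer_space q) (odometer q) (odometer_space q') T \<Phi>"

lemma \<Phi>_bij: "bij_betw \<Phi> (dseqs q) (dseqs q')"
  by (rule transfer_bij[OF F.odometer_pair_axioms F'.odometer_pair_axioms])

lemma \<Phi>_inv:
  assumes "y \<in> dseqs q'"
  shows "inv_into (dseqs q) \<Phi> y \<in> dseqs q" "\<Phi> (inv_into (dseqs q) \<Phi> y) = y"
  by (rule bij_betw_apply[OF bij_betw_inv_into[OF \<Phi>_bij] assms] bij_betw_inv_into_right[OF \<Phi>_bij assms])+

lemma odometer_bij: "bij_betw (odometer q) (dseqs q) (dseqs q)"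
  by (rule bij_betw_cong[THEN iffD2, OF odometer_eq_vershik[OF F.q2] O0.vershik_bij])

lemma odometer_pow:
  assumes x: "x \<in> dseqs q"
  shows "homeo_pow (odometer_space q) (odometer q) k x \<in> dseqs q"
    "\<Phi> (homeo_pow (odometer_space q) (odometer q) k x) = O.Z k (\<Phi> x)"
proof -
  have c: "\<Phi> (odometer q x) = O.T (\<Phi> x)" if "x \<in> dseqs q" for x
    using F.transfer_odometer[OF that] odometer_eq_vershik[OF V.q2 F.transfer_dseqs[OF that]] by simp
  note * = homeo_pow_semiconj[where F = \<Phi>, of "odometer q" "odometer_space q" O.T "odometer_space q'" x k,
      unfolded topspace_odometer, OF odometer_bij O.vershik_bij F.transfer_dseqs c x]
  show "homeo_pow (odometer_space q) (odometer q) k x \<in> dseqs q"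
    "\<Phi> (homeo_pow (odometer_space q) (odometer q) k x) = O.Z k (\<Phi> x)"
    by (rule *; assumption)+
qed

lemma conjugate_pow:
  fixes T'
  defines "T' \<equiv> inv_into (dseqs q) \<Phi> \<circ> T \<circ> \<Phi>"
  assumes x: "x \<in> dseqs q"
  shows "homeo_pow (odometer_space q) T' k x \<in> dseqs q"
    "\<Phi> (homeo_pow (odometer_space q) T' k x) = V.Z k (\<Phi> x)"
proof -
  have bij: "bij_betw T' (dseqs q) (dseqs q)"
    unfolding T'_def
    by (rule bij_betw_trans[OF \<Phi>_bij bij_betw_trans[OF V.vershik_bij bij_betw_inv_into[OF \<Phi>_bij]]])
  have c: "\<Phi> (T' x) = T (\<Phi> x)" if "x \<in> dseqs q" for x
    using \<Phi>_inv(2)[OF V.vershik_dseqs[OF F.transfer_dseqs[OF that]]] by (simp add: T'_def)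
  note * = homeo_pow_semiconj[where F = \<Phi>, of T' "odometer_space q" T "odometer_space q'" x k,
      unfolded topspace_odometer, OF bij V.vershik_bij F.transfer_dseqs c x]
  show "homeo_pow (odometer_space q) T' k x \<in> dseqs q"
    "\<Phi> (homeo_pow (odometer_space q) T' k x) = V.Z k (\<Phi> x)"
    by (rule *; assumption)+
qed

lemma orbits_eq:
  assumes x: "x \<in> dseqs q"
  shows "homeo_orbit (odometer_space q) (odometer q) x
    = homeo_orbit (odometer_space q) (inv_into (dseqs q) \<Phi> \<circ> T \<circ> \<Phi>) x" (is "?L = ?R")
proof -
  have "\<Phi> ` ?L = homeo_orbit (odometer_space q') O.T (\<Phi> x)"
    unfolding homeo_orbit_def image_image odometer_pow(2)[OF x] ..
  also have "\<dots> = homeo_orbit (odometer_space q') T (\<Phi> x)"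
    by (rule vershik_orbit_eq[OF V.ordered_odometer_axioms O.ordered_odometer_axioms F.transfer_dseqs[OF x]])
  also have "\<dots> = \<Phi> ` ?R"
    unfolding homeo_orbit_def image_image conjugate_pow(2)[OF x] ..
  finally have "\<Phi> ` ?L = \<Phi> ` ?R" .
  moreover have "?L \<subseteq> dseqs q" "?R \<subseteq> dseqs q"
    unfolding homeo_orbit_def using odometer_pow(1)[OF x] conjugate_pow(1)[OF x] by auto
  ultimately show ?thesis
    using inj_on_image_eq_iff[OF bij_betw_imp_inj_on[OF \<Phi>_bij]] by blast
qed

lemma c_source_eqI:
  assumes x: "x \<in> dseqs q" and k: "O.T (\<Phi> x) = V.Z k (\<Phi> x)"
  shows "c_source x = k"
proof -
  have y: "\<Phi> x \<in> dseqs q'" by (rule F.transfer_dseqs[OF x])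
  have "odometer q x = inv_into (dseqs q) \<Phi> (V.Z l (\<Phi> x)) \<longleftrightarrow> l = k" for l
  proof -
    have "odometer q x = inv_into (dseqs q) \<Phi> (V.Z l (\<Phi> x)) \<longleftrightarrow> \<Phi> (odometer q x) = V.Z l (\<Phi> x)"
      using \<Phi>_inv(2)[OF V.Z_dseqs[OF y]] bij_betw_inv_into_left[OF \<Phi>_bij, of "odometer q x"]
        bij_betwE[OF odometer_bij] x by metis
    also have "\<Phi> (odometer q x) = V.Z k (\<Phi> x)"
      using k F.transfer_odometer[OF x] odometer_eq_vershik[OF V.q2 y] by simp
    finally show ?thesis using V.Z_inj[OF y] by metis
  qed
  then show ?thesis unfolding source_cocycle_def topspace_odometer by simp
qed

lemma c_target_eqI:
  assumes y: "y \<in> dseqs q'" and k: "T y = O.Z k y"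
  shows "c_target y = k"
proof -
  have "T y = \<Phi> (homeo_pow (odometer_space q) (odometer q) l (inv_into (dseqs q) \<Phi> y)) \<longleftrightarrow> l = k" for l
    unfolding odometer_pow(2)[OF \<Phi>_inv(1)[OF y]] \<Phi>_inv(2)[OF y] k using O.Z_inj[OF y] by metis
  then show ?thesis unfolding target_cocycle_def topspace_odometer by simp
qed

lemma c_source_local:
  assumes x: "x \<in> dseqs q" and n: "agree n (\<Phi> x) (top_seq q')" "\<Phi> x n \<noteq> top_seq q' n"
  shows "\<bar>c_source x\<bar> < int (place q' (Suc n))"
    "\<exists>M. \<forall>y\<in>dseqs q. agree M y x \<longrightarrow> c_source y = c_source x"
proof -
  obtain k where k: "\<bar>k\<bar> < int (place q' (Suc n))"
    "\<forall>y\<in>dseqs q'. agree (n + 2) y (\<Phi> x) \<longrightarrow> O.T y = V.Z k y"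
    using vershik_crossing[OF V.ordered_odometer_axioms O.ordered_odometer_axioms F.transfer_dseqs[OF x] n] .
  have c: "c_source y = k" if "y \<in> dseqs q" "agree (n + 2) (\<Phi> y) (\<Phi> x)" for y
    using c_source_eqI[OF that(1)] k(2) F.transfer_dseqs[OF that(1)] that(2) by blast
  have cx: "c_source x = k" using c[OF x] by simp
  then show "\<bar>c_source x\<bar> < int (place q' (Suc n))" using k(1) by simp
  obtain M where "\<And>y. y \<in> dseqs q \<Longrightarrow> agree M y x \<Longrightarrow> agree (n + 2) (\<Phi> y) (\<Phi> x)"
    using F.transfer_local[OF x, of "n + 2"] by blast
  then have "\<forall>y\<in>dseqs q. agree M y x \<longrightarrow> c_source y = c_source x" unfolding cx using c by simp
  then show "\<exists>M. \<forall>y\<in>dseqs q. agree M y x \<longrightarrow> c_source y = c_source x" by (rule exI[of _ M])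
qed

lemma c_target_local:
  assumes x: "x \<in> dseqs q'" and n: "agree n x (top_seq q')" "x n \<noteq> top_seq q' n"
  shows "\<bar>c_target x\<bar> < int (place q' (Suc n))"
    "\<exists>M. \<forall>y\<in>dseqs q'. agree M y x \<longrightarrow> c_target y = c_target x"
proof -
  obtain k where k: "\<bar>k\<bar> < int (place q' (Suc n))"
    "\<forall>y\<in>dseqs q'. agree (n + 2) y x \<longrightarrow> T y = O.Z k y"
    using vershik_crossing[OF O.ordered_odometer_axioms V.ordered_odometer_axioms x n] .
  have c: "c_target y = k" if "y \<in> dseqs q'" "agree (n + 2) y x" for y
    using c_target_eqI[OF that(1)] k(2) that by blast
  have cx: "c_target x = k" using c[OF x] by simp
  then show "\<bar>c_target x\<bar> < int (place q' (Suc n))" using k(1) by simp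
  show "\<exists>M. \<forall>y\<in>dseqs q'. agree M y x \<longrightarrow> c_target y = c_target x" unfolding cx using c by blast
qed

lemma cocycle_bounds:
  assumes x: "x \<in> dseqs q'"
  obtains n where "agree n x (top_seq q')"
    "\<forall>z\<in>dseqs q. \<Phi> z = x \<longrightarrow> \<bar>c_source z\<bar> \<le> int (place q' (Suc n))"
    "\<bar>c_target x\<bar> \<le> int (place q' (Suc n))"
proof (cases "x = top_seq q'")
  case True
  \<comment> \<open>At the maximal sequence both cocycles equal \<open>1\<close>, so level
    \<open>0\<close> already provides the bound.\<close>
  have p: "1 \<le> int (place q' (Suc 0))" using V.place_pos[of "Suc 0"] by linarith
  have "c_source z = 1" if "z \<in> dseqs q" "\<Phi> z = x" for z
    by (rule c_source_eqI[OF that(1)])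
      (use vershik_crossing_top[OF V.ordered_odometer_axioms O.ordered_odometer_axioms] True that(2) in simp)
  moreover have "c_target x = 1"
    by (rule c_target_eqI[OF x])
      (use vershik_crossing_top[OF O.ordered_odometer_axioms V.ordered_odometer_axioms] True in simp)
  ultimately show ?thesis using p by (intro that[of 0]) simp_all
next
  case False
  obtain n where n: "agree n x (top_seq q')" "x n \<noteq> top_seq q' n" using V.first_nontop[OF False] .
  have "\<bar>c_source z\<bar> \<le> int (place q' (Suc n))" if "z \<in> dseqs q" "\<Phi> z = x" for z
    using c_source_local(1)[OF that(1), of n] n that(2) by simp
  then show ?thesis using c_target_local(1)[OF x n] n by (intro that[of n]) simp_all
qed

lemma strong_orbit_equivalence_\<Phi>:
  "strong_orbit_equivalence (odometer_space q) (odometer q) (odometer_space q') T \<Phi>"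
  unfolding strong_orbit_equivalence_def topspace_odometer
proof (intro conjI ballI)
  show "homeomorphic_map (odometer_space q) (odometer_space q') \<Phi>"
    by (rule transfer_homeomorphic[OF F.odometer_pair_axioms F'.odometer_pair_axioms])
  show "homeo_orbit (odometer_space q) (odometer q) x
    = homeo_orbit (odometer_space q) (inv_into (dseqs q) \<Phi> \<circ> T \<circ> \<Phi>) x" if "x \<in> dseqs q" for x
    by (rule orbits_eq[OF that])
  show "at_most_one_discontinuity (odometer_space q) c_source"
    unfolding at_most_one_discontinuity_def topspace_odometer
  proof (intro exI[of _ "inv_into (dseqs q) \<Phi> (top_seq q')"] ballI impI)
    fix x assume x: "x \<in> dseqs q" and ne: "x \<noteq> inv_into (dseqs q) \<Phi> (top_seq q')"
    have "\<Phi> x \<noteq> top_seq q'" using ne bij_betw_inv_into_left[OF \<Phi>_bij x] by metis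
    then obtain n where n: "agree n (\<Phi> x) (top_seq q')" "\<Phi> x n \<noteq> top_seq q' n" using V.first_nontop by metis
    obtain M where "\<forall>y\<in>dseqs q. agree M y x \<longrightarrow> c_source y = c_source x"
      using c_source_local(2)[OF x n] ..
    then show "topcontinuous_at (odometer_space q) (discrete_topology UNIV) c_source x"
      by (rule topcontinuous_at_odometer[OF x])
  qed
  show "at_most_one_discontinuity (odometer_space q') c_target"
    unfolding at_most_one_discontinuity_def topspace_odometer
  proof (intro exI[of _ "top_seq q'"] ballI impI)
    fix x assume x: "x \<in> dseqs q'" and ne: "x \<noteq> top_seq q'"
    obtain n where n: "agree n x (top_seq q')" "x n \<noteq> top_seq q' n" using V.first_nontop[OF ne] .
    obtain M where "\<forall>y\<in>dseqs q'. agree M y x \<longrightarrow> c_target y = c_target x"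
      using c_target_local(2)[OF x n] ..
    then show "topcontinuous_at (odometer_space q') (discrete_topology UNIV) c_target x"
      by (rule topcontinuous_at_odometer[OF x])
  qed
qed

lemma top_cylinder:
  "openin (odometer_space q') {y \<in> dseqs q'. agree n y (top_seq q')}"
  unfolding openin_odometer
proof (intro conjI ballI exI[of _ n] impI)
  show "y \<in> {y \<in> dseqs q'. agree n y (top_seq q')}"
    if "x \<in> {y \<in> dseqs q'. agree n y (top_seq q')}" "y \<in> dseqs q'" "agree n y x" for x y
    using that by simp
  show "{y \<in> dseqs q'. agree n y (top_seq q')} \<subseteq> dseqs q'" by (rule Collect_restrict)
qed

lemma top_cylinder_preimage:
  "openin (odometer_space q) {x \<in> dseqs q. agree n (\<Phi> x) (top_seq q')}"
proof -
  have "openin (odometer_space q) {x \<in> topspace (odometer_space q). \<Phi> x \<in> {y \<in> dseqs q'. agree n y (top_seq q')}}"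
  proof (rule openin_continuous_map_preimage[OF _ top_cylinder])
    show "continuous_map (odometer_space q) (odometer_space q') \<Phi>"
      using strong_orbit_equivalence_\<Phi> by (simp add: strong_orbit_equivalence_def homeomorphic_imp_continuous_map)
  qed
  moreover have "{x \<in> topspace (odometer_space q). \<Phi> x \<in> {y \<in> dseqs q'. agree n y (top_seq q')}}
      = {x \<in> dseqs q. agree n (\<Phi> x) (top_seq q')}"
    using F.transfer_dseqs by (auto simp: topspace_odometer)
  ultimately show ?thesis by simp
qed

text \<open>The maximal prefix of length \<open>n\<close> is the residue
  \<open>place q' n - 1\<close> modulo \<open>place q' n\<close>. The measure can thus be estimated
  in base \<open>q\<close>, without identifying the image measure.\<close>

lemma emeasure_top_cylinder:
  "emeasure (odometer_measure q) {x \<in> dseqs q. agree n (\<Phi> x) (top_seq q')} \<le> ennreal (1 / real (place q' n))"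
proof -
  obtain N where N: "place q' n dvd place q N" using F.place_dvd_place by blast
  have eq: "{x \<in> dseqs q. residue q (place q' n) x = place q' n - 1} = {x \<in> dseqs q. agree n (\<Phi> x) (top_seq q')}"
  proof (intro Collect_cong conj_cong refl iffI)
    fix x assume x: "x \<in> dseqs q"
    show "residue q (place q' n) x = place q' n - 1" if "agree n (\<Phi> x) (top_seq q')"
      using O.pos_top[OF that] F.val_transfer[OF x, of n] by (simp add: pos_id)
    show "agree n (\<Phi> x) (top_seq q')" if "residue q (place q' n) x = place q' n - 1"
      using O.pos_eq_top[OF F.transfer_dseqs[OF x], of n] F.val_transfer[OF x, of n] that V.place_pos[of n]
      by (simp add: pos_id)
  qed
  show ?thesis using emeasure_residue[OF F.q2 N, of "place q' n - 1"] unfolding eq .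
qed

end

locale fast_strong_oe = strong_oe q q' s + fast_odometer q' s A C lp
  for q q' :: "nat \<Rightarrow> nat" and s A C lp
begin

lemma integrable:
  assumes phi: "is_phi m \<phi>"
  shows "orbit_equivalence_integrable \<phi> (odometer_measure q)
     (odometer_space q) (odometer q) (odometer_space q') T \<Phi>"
proof -
  let ?\<mu> = "odometer_measure q" and ?B = "borel_of_topology (odometer_space q')"
  have sB: "space ?B = dseqs q'" "sets ?B = sigma_sets (dseqs q') {U. openin (odometer_space q') U}"
  proof -
    have sub: "{U. openin (odometer_space q') U} \<subseteq> Pow (dseqs q')"
      using openin_subset[of "odometer_space q'"] by (auto simp: topspace_odometer)
    show "space ?B = dseqs q'" "sets ?B = sigma_sets (dseqs q') {U. openin (odometer_space q') U}"
      unfolding borel_of_topology_def topspace_odometer using sub by simp_all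
  qed
  have meas: "\<Phi> \<in> measurable ?\<mu> ?B"
    unfolding borel_of_topology_def
  proof (rule measurable_measure_of)
    show "{U. openin (odometer_space q') U} \<subseteq> Pow (topspace (odometer_space q'))"
      using openin_subset[of "odometer_space q'"] by auto
    show "\<Phi> \<in> space ?\<mu> \<rightarrow> topspace (odometer_space q')"
      using F.transfer_dseqs by (auto simp: space_odometer_measure topspace_odometer)
    fix U assume "U \<in> {U. openin (odometer_space q') U}"
    then have "openin (odometer_space q) {x \<in> topspace (odometer_space q). \<Phi> x \<in> U}"
      using strong_orbit_equivalence_\<Phi> openin_continuous_map_preimage[of "odometer_space q" "odometer_space q'" \<Phi> U]
      by (simp add: strong_orbit_equivalence_def homeomorphic_imp_continuous_map)
    from open_sets_odometer_measure[OF F.q2 this]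
    show "\<Phi> -` U \<inter> space ?\<mu> \<in> sets ?\<mu>"
      by (simp add: space_odometer_measure topspace_odometer Int_def conj_commute)
  qed
  have 1: "(\<integral>\<^sup>+ x. ennreal (\<phi> (real_of_int \<bar>c_source x\<bar>)) \<partial>?\<mu>) < \<infinity>"
  proof (rule phi_integral_finite[OF phi, where M = "\<lambda>n. {x \<in> dseqs q. agree n (\<Phi> x) (top_seq q')}"])
    show "{x \<in> dseqs q. agree n (\<Phi> x) (top_seq q')} \<in> sets ?\<mu>" for n
      by (rule open_sets_odometer_measure[OF F.q2 top_cylinder_preimage])
    show "emeasure ?\<mu> {x \<in> dseqs q. agree n (\<Phi> x) (top_seq q')} \<le> ennreal (1 / real (place q' n))" for n
      by (rule emeasure_top_cylinder)
    fix x assume "x \<in> space ?\<mu>"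
    then have x: "x \<in> dseqs q" by (simp add: space_odometer_measure)
    show "\<exists>n. x \<in> {x \<in> dseqs q. agree n (\<Phi> x) (top_seq q')} \<and> \<bar>c_source x\<bar> \<le> int (place q' (Suc n))"
    proof -
      obtain n where "agree n (\<Phi> x) (top_seq q')"
        "\<forall>z\<in>dseqs q. \<Phi> z = \<Phi> x \<longrightarrow> \<bar>c_source z\<bar> \<le> int (place q' (Suc n))"
        using cocycle_bounds[OF F.transfer_dseqs[OF x]] .
      then show ?thesis using x by blast
    qed
  qed
  have 2: "(\<integral>\<^sup>+ y. ennreal (\<phi> (real_of_int \<bar>c_target y\<bar>)) \<partial>distr ?\<mu> ?B \<Phi>) < \<infinity>"
  proof (rule phi_integral_finite[OF phi, where M = "\<lambda>n. {y \<in> dseqs q'. agree n y (top_seq q')}"])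
    show s: "{y \<in> dseqs q'. agree n y (top_seq q')} \<in> sets (distr ?\<mu> ?B \<Phi>)" for n
      using top_cylinder[of n] by (simp add: sB)
    show "emeasure (distr ?\<mu> ?B \<Phi>) {y \<in> dseqs q'. agree n y (top_seq q')} \<le> ennreal (1 / real (place q' n))" for n
    proof -
      have v: "\<Phi> -` {y \<in> dseqs q'. agree n y (top_seq q')} \<inter> space ?\<mu> = {x \<in> dseqs q. agree n (\<Phi> x) (top_seq q')}"
        using F.transfer_dseqs by (auto simp: space_odometer_measure)
      have "{y \<in> dseqs q'. agree n y (top_seq q')} \<in> sets ?B" using s[of n] by (simp only: sets_distr)
      from emeasure_distr[OF meas this] show ?thesis unfolding v using emeasure_top_cylinder[of n] by simp
    qed
    fix y assume "y \<in> space (distr ?\<mu> ?B \<Phi>)"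
    then have y: "y \<in> dseqs q'" by (simp add: sB)
    show "\<exists>n. y \<in> {y \<in> dseqs q'. agree n y (top_seq q')} \<and> \<bar>c_target y\<bar> \<le> int (place q' (Suc n))"
    proof -
      obtain n where n: "agree n y (top_seq q')" "\<bar>c_target y\<bar> \<le> int (place q' (Suc n))"
        using cocycle_bounds[OF y] .
      show ?thesis using y n by (intro exI[of _ n] conjI CollectI)
    qed
  qed
  show ?thesis unfolding orbit_equivalence_integrable_def using 1 2 by blast
qed

end

text \<open>The digits \<open>v\<close> run cyclically through a list of all \<open>K n\<close>
  orders, so an order occurs at most \<open>q (Suc n) div K n + 1\<close> times. This is at most
  twice the average because \<open>K n \<le> q (Suc n)\<close>, which is known from level
  \<open>1\<close> on.\<close>

lemma rich_orders:
  fixes q :: "nat \<Rightarrow> nat"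
  assumes q: "\<And>n. 2 \<le> q n" and fa: "\<And>n. 1 \<le> n \<Longrightarrow> fact (q n - 2) \<le> q (Suc n)"
  obtains s B where "rich_odometer q s 1 B"
proof -
  define K where "K = (\<lambda>n. fact (q n - 2) :: nat)"
  define S where "S = (\<lambda>n. {\<pi>. \<pi> permutes {1..<q n - 1}})"
  have "\<exists>e. bij_betw e {..<K n} (S n)" for n
  proof -
    have "finite (S n)" unfolding S_def by (rule finite_permutations) simp
    moreover have "card (S n) = K n" unfolding S_def K_def by (rule card_permutations) simp_all
    ultimately show ?thesis by (intro finite_same_card_bij) simp_all
  qed
  then obtain e where e: "\<And>n. bij_betw (e n) {..<K n} (S n)" by metis
  define s where "s = (\<lambda>n v. e n (v mod K n))"
  have K0: "0 < K n" for n by (simp add: K_def)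
  define B where "B = (\<lambda>n. q (Suc n) div K n + 1)"
  have sp: "s n v permutes {1..<q n - 1}" for n v
  proof -
    have "v mod K n \<in> {..<K n}" using K0 by simp
    then have "s n v \<in> S n" unfolding s_def using bij_betwE[OF e[of n]] by blast
    then show ?thesis by (simp add: S_def)
  qed
  interpret ordered_odometer q s by unfold_locales (use q sp in auto)
  have "rich_odometer q s 1 B"
  proof (unfold_locales)
    fix m :: nat and g assume m: "1 \<le> m"
    let ?F = "{v. v < q (Suc m) \<and> (\<forall>i<q m. s m v i = g i)}"
    have inj: "v mod K m = w mod K m" if "v \<in> ?F" "w \<in> ?F" for v w
    proof -
      have "s m v i = s m w i" for i
      proof (cases "i < q m")
        case True
        then show ?thesis using that by simp
      next
        case False
        then have "i \<notin> {1..<q m - 1}" by auto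
        then show ?thesis using permutes_not_in[OF sp] by metis
      qed
      then have "e m (v mod K m) = e m (w mod K m)" unfolding s_def by blast
      then show ?thesis
        using bij_betw_imp_inj_on[OF e[of m]] K0[of m] by (auto dest!: inj_onD)
    qed
    have "card ?F \<le> card {..q (Suc m) div K m}"
    proof (rule card_inj_on_le[where f = "\<lambda>v. v div K m"])
      show "inj_on (\<lambda>v. v div K m) ?F"
      proof (rule inj_onI)
        fix v w assume v: "v \<in> ?F" and w: "w \<in> ?F" and d: "v div K m = w div K m"
        have "v = v div K m * K m + v mod K m" by simp
        also have "\<dots> = w div K m * K m + w mod K m" unfolding d inj[OF v w] ..
        finally show "v = w" by simp
      qed
      show "(\<lambda>v. v div K m) ` ?F \<subseteq> {..q (Suc m) div K m}"
        by (auto intro!: div_le_mono)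
    qed simp
    then show "card ?F \<le> B m" by (simp add: B_def)
    show "1 \<le> B m" by (simp add: B_def)
    have "K m * (q (Suc m) div K m) \<le> q (Suc m)" by simp
    moreover have "K m \<le> q (Suc m)" unfolding K_def by (rule fa[OF m])
    moreover have "B m * K m = K m * (q (Suc m) div K m) + K m" by (simp add: B_def)
    ultimately have "B m * K m \<le> 2 * q (Suc m)" by linarith
    then have "real (B m * K m) \<le> real (2 * q (Suc m))" by (rule of_nat_mono)
    then show "real (B m) * fact (q m - 2) \<le> 2 * real (q (Suc m))" by (simp add: K_def)
  qed
  then show ?thesis by (rule that)
qed

text \<open>A finite \<alpha> is approached by the constant rate. For infinite \<alpha> the rate
  must diverge, but at most linearly so that the cocycles remain integrable.\<close>

lemma entropy_rates:
  fixes \<alpha> :: ereal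
  assumes "0 < \<alpha>"
  obtains A :: "nat \<Rightarrow> real" and C where "0 < A 0" "mono A" "\<And>n. A n \<le> C * real (Suc n)"
    "(\<lambda>n. ereal (A n)) \<longlonglongrightarrow> \<alpha>"
proof (cases \<alpha>)
  case (real a)
  have "a \<le> a * real (Suc n)" for n using assms real by (simp add: algebra_simps)
  then show ?thesis using assms real by (intro that[of "\<lambda>_. a" a]) (simp_all add: mono_def del: of_nat_Suc)
next
  case PInf
  have "(\<lambda>n. ereal (real (Suc n))) \<longlonglongrightarrow> \<infinity>"
    unfolding tendsto_PInfty_eq_at_top by real_asymp
  then show ?thesis using PInf by (intro that[of "\<lambda>n. real (Suc n)" 1]) (simp_all add: mono_def)
next
  case MInf
  then show ?thesis using assms by simp
qed

theorem theorem3: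
  fixes \<alpha> :: ereal and q :: "nat \<Rightarrow> nat"
  assumes "0 < \<alpha>"
    and "\<And>n. 2 \<le> q n"
    and "\<exists>p. prime p \<and> supernatural_exponent q p = \<infinity>"
  shows "\<exists>(Y :: (nat \<Rightarrow> nat) topology) T.
           cantor_minimal Y T \<and>
           topological_entropy Y T = \<alpha> \<and>
           (\<exists>\<Psi>. strong_orbit_equivalence (odometer_space q) (odometer q) Y T \<Psi> \<and>
                (\<forall>m \<phi>. is_phi m \<phi> \<longrightarrow>
                   orbit_equivalence_integrable \<phi> (odometer_measure q)
                     (odometer_space q) (odometer q) Y T \<Psi>))"
proof -
  obtain p where p: "prime p" "supernatural_exponent q p = \<infinity>" using assms(3) by blast
  obtain A C where A: "0 < A 0" "mono A" "\<And>n. A n \<le> C * real (Suc n)"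
    and lim: "(\<lambda>n. ereal (A n)) \<longlonglongrightarrow> \<alpha>"
    using entropy_rates[OF assms(1)] by metis
  obtain q' where q': "\<And>n. 2 \<le> q' n"
    "\<And>n. 1 \<le> n \<Longrightarrow> ln (real (q' n)) \<le> A n * real (place q' n)"
    "\<And>n. 1 \<le> n \<Longrightarrow> A n * real (place q' n) - ln (real p) \<le> ln (real (q' n))"
    "\<And>n. 1 \<le> n \<Longrightarrow> fact (q' n - 2) \<le> q' (Suc n)"
    "\<And>n. \<exists>N. place q' n dvd place q N"
    "\<And>N. \<exists>n. place q N dvd place q' n"
    using fast_sequence[OF assms(2) p A(1,2)] by metis
  obtain s B where "rich_odometer q' s 1 B" using rich_orders[of q'] q'(1,4) by metis
  then interpret R: rich_odometer q' s 1 B .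
  interpret fast_strong_oe q q' s A C "ln (real p)"
    by unfold_locales (rule assms(2) q'(1) q'(5) q'(6) A | erule q'(2) q'(3))+
  \<comment> \<open>The quotient is squeezed between \<open>A n - ln p / h n\<close> and
    \<open>A n\<close>, with \<open>h = place q'\<close>.\<close>
  have "(\<lambda>n. ereal (ln (real (q' n)) / real (place q' n))) \<longlonglongrightarrow> \<alpha>"
  proof (rule tendsto_sandwich)
    have p0: "0 < real (place q' n)" for n using R.place_pos by simp
    show "\<forall>\<^sub>F n in sequentially. ereal (A n) - ereal (ln (real p) / real (place q' n))
        \<le> ereal (ln (real (q' n)) / real (place q' n))"
      using eventually_ge_at_top[of 1]
    proof eventually_elim
      case (elim n)
      have "(A n * real (place q' n) - ln (real p)) / real (place q' n) \<le> ln (real (q' n)) / real (place q' n)"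
        using q'(3)[OF elim] p0[of n] by (intro divide_right_mono) simp_all
      then show ?case using p0[of n] by (simp add: diff_divide_distrib)
    qed
    show "\<forall>\<^sub>F n in sequentially. ereal (ln (real (q' n)) / real (place q' n)) \<le> ereal (A n)"
      using eventually_ge_at_top[of 1]
    proof eventually_elim
      case (elim n)
      show ?case using q'(2)[OF elim] p0[of n] by (simp add: field_simps)
    qed
    have "(\<lambda>n. ln (real p) / real (place q' n)) \<longlonglongrightarrow> 0"
      by (rule tendsto_divide_0[OF tendsto_const filterlim_at_top_imp_at_infinity[OF real_place_at_top]])
    then have "(\<lambda>n. ereal (A n) - ereal (ln (real p) / real (place q' n))) \<longlonglongrightarrow> \<alpha> - ereal 0"
      by (intro tendsto_diff_ereal_general lim) simp_all
    then show "(\<lambda>n. ereal (A n) - ereal (ln (real p) / real (place q' n))) \<longlonglongrightarrow> \<alpha>" by simp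
  qed (rule lim)
  then have "topological_entropy (odometer_space q') T = \<alpha>" by (rule R.topological_entropy_eq)
  then show ?thesis
    using R.cantor_minimal_vershik strong_orbit_equivalence_\<Phi> integrable by blast
qed

end
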